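(* Let $G=([n],E)$ be an undirected graph and $\mathcal{C}=\mathrm{global}(G)$. For a generic $n$-player binary game $X$, the Spohn CI variety $\mathcal{V}_{X,\mathcal{C}}$ is smooth away from the hyperplanes $\{p_{j_1j_2\cdots j_n}=0\}$ and $\{p_{++\cdots+}=0\}$. In particular, the set of totally mixed CI equilibria of $X$, i.e. $\mathcal{V}_{X,\mathcal{C}}\cap\Delta$, is a smooth semialgebraic manifold.
   Context: Notation: $[m]=\{1,\dots,m\}$. Varieties are over $\mathbb{C}$; payoffs are real. Game. An $n$-player binary game $X$ is given by $n$ real payoff tensors $X^{(1)},\dots,X^{(n)}$ of format $2\times\cdots\times2$, with entries $X^{(i)}_{j_1\cdots j_n}$, $j_1,\dots,j_n\in[2]$. "Generic" means: for all $(X^{(1)},\dots,X^{(n)})\in(\mathbb{R}^{2^n})^n$ outside some proper Zariski closed subset. Spohn variety. Let $\mathbb{P}^{2^n-1}$ have coordinates $p_{j_1\cdots j_n}$, $j\in[2]^n$. A "$+$" in place of an index (or indices) means summing over it. $\Delta$ denotes the open probability simplex, i.e. the set of real points of $\mathbb{P}^{2^n-1}$ all of whose coordinates are positive (normalized to have sum $1$). The Spohn variety $\mathcal{V}_X\subseteq\mathbb{P}^{2^n-1}$ is the common zero locus of $\det M_1,\dots,\det M_n$, where for $k=1,2$ the $k$-th row of the $2\times2$ matrix $M_i$ is $$\Big(\ \sum_{j\in[2]^n:\,j_i=k}p_{j_1\cdots j_n},\quad \sum_{j\in[2]^n:\,j_i=k}X^{(i)}_{j_1\cdots j_n}p_{j_1\cdots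 j_n}\ \Big).$$ Independence model. Vertices of $G$ correspond to players. For pairwise disjoint $A,B,C\subseteq[n]$, $C$ separates $A$ and $B$ in $G$ if every path in $G$ from a vertex of $A$ to a vertex of $B$ contains a vertex of $C$. $\mathrm{global}(G)$ is the set of all conditional independence statements "$A$ independent of $B$ given $C$" for disjoint $A,B,C$ such that $C$ separates $A$ and $B$. Such a statement imposes the equations $$p_{i_Ai_Bi_C+}\,p_{j_Aj_Bi_C+}-p_{i_Aj_Bi_C+}\,p_{j_Ai_Bi_C+}=0$$ for all $i_A,j_A\in[2]^A$, $i_B,j_B\in[2]^B$, $i_C\in[2]^C$, where $p_{i_Ai_Bi_C+}$ is the sum of all $p_j$ with $j$ restricting to $i_A,i_B,i_C$ on $A,B,C$. $\mathcal{M}_{\mathcal{C}}\subseteq\mathbb{P}^{2^n-1}$ is the projective variety defined by these equations for all statements in $\mathcal{C}=\mathrm{global}(G)$. Let $\mathcal{W}$ be the union of all the coordinate hyperplanes $\{p_{j_1\cdots j_n}=0\}$ and the hyperplane $\{p_{++\cdots+}=0\}$. Spohn CI variety. $\mathcal{V}_{X,\mathcal{C}}:=\overline{(\mathcal{V}_X\cap\mathcal{M}_{\mathcal{C}})\setminus\mathcal{W}}$ (Zariski closure). The empty set counts as a smooth manifold. *)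

theory Defs
  imports "HOL-Analysis.Analysis" "HOL-Library.Poly_Mapping" "HOL-Library.Extended_Nat"
begin

text \<open>Polynomials with coefficients in \<open>'a\<close> and variables indexed by \<open>'v\<close>: finitely supported
  families of coefficients, indexed by the exponent vectors.\<close>

type_synonym ('v, 'a) mpoly = "('v \<Rightarrow>\<^sub>0 nat) \<Rightarrow>\<^sub>0 'a"

definition mpoly_eval :: "('v, 'a::comm_semiring_1) mpoly \<Rightarrow> ('v \<Rightarrow> 'a) \<Rightarrow> 'a" where
  "mpoly_eval f x =
    (\<Sum>m\<in>Poly_Mapping.keys f. Poly_Mapping.lookup f m *
      (\<Prod>v\<in>Poly_Mapping.keys m. x v ^ Poly_Mapping.lookup m v))"

definition homogeneous :: "('v, 'a::comm_semiring_1) mpoly \<Rightarrow> bool" where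
  "homogeneous f \<longleftrightarrow>
    (\<exists>d. \<forall>m\<in>Poly_Mapping.keys f. (\<Sum>v\<in>Poly_Mapping.keys m. Poly_Mapping.lookup m v) = d)"

text \<open>A subset of the projective space with homogeneous coordinates indexed by \<open>'v\<close> is represented
  by the set of all (nonzero) homogeneous coordinate vectors of its points.\<close>

definition proj_closed :: "(complex ^ 'v::finite) set \<Rightarrow> bool" where
  "proj_closed Z \<longleftrightarrow>
    (\<exists>F :: ('v, complex) mpoly set. (\<forall>f\<in>F. homogeneous f) \<and>
      Z = {z. z \<noteq> 0 \<and> (\<forall>f\<in>F. mpoly_eval f (($) z) = 0)})"

definition zariski_closure :: "(complex ^ 'v::finite) set \<Rightarrow> (complex ^ 'v) set" where
  "zariski_closure S = proj_closed hull S"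

definition proj_irreducible :: "(complex ^ 'v::finite) set \<Rightarrow> bool" where
  "proj_irreducible Z \<longleftrightarrow> proj_closed Z \<and> Z \<noteq> {} \<and>
    (\<forall>Z1 Z2. proj_closed Z1 \<longrightarrow> proj_closed Z2 \<longrightarrow> Z = Z1 \<union> Z2 \<longrightarrow> Z = Z1 \<or> Z = Z2)"

text \<open>The dimension of \<open>V\<close> at \<open>p\<close> is the Krull dimension of the local ring of \<open>V\<close> at \<open>p\<close>, i.e. the
  supremum of the lengths of chains of irreducible closed subsets of \<open>V\<close> that all contain \<open>p\<close>.\<close>

definition local_dim :: "(complex ^ 'v::finite) set \<Rightarrow> complex ^ 'v \<Rightarrow> enat" where
  "local_dim V p = (SUP d \<in> {d. \<exists>Z. (\<forall>i\<le>d. proj_irreducible (Z i)) \<and>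
      (\<forall>i<d. Z i \<subset> Z (Suc i)) \<and> p \<in> Z 0 \<and> Z d \<subseteq> V}. enat d)"

text \<open>The common kernel of the differentials at \<open>p\<close> of all elements of the homogeneous ideal of \<open>V\<close>.
  This is the tangent space at \<open>p\<close> of the affine cone over \<open>V\<close>; by Euler's formula it contains the
  line through \<open>p\<close>, so its dimension is one more than that of the Zariski tangent space of \<open>V\<close>
  at the projective point given by \<open>p\<close>.\<close>

definition cone_tangent_space :: "(complex ^ 'v::finite) set \<Rightarrow> complex ^ 'v \<Rightarrow> (complex ^ 'v) set" where
  "cone_tangent_space V p = {u. \<forall>f :: ('v, complex) mpoly.
      homogeneous f \<and> (\<forall>z\<in>V. mpoly_eval f (($) z) = 0) \<longrightarrow>
      ((\<lambda>t. mpoly_eval f (($) (p + t *s u))) has_field_derivative 0) (at 0)}"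

definition smooth_at :: "(complex ^ 'v::finite) set \<Rightarrow> complex ^ 'v \<Rightarrow> bool" where
  "smooth_at V p \<longleftrightarrow> enat (vec.dim (cone_tangent_space V p)) = local_dim V p + 1"

definition semialgebraic :: "(real ^ 'v::finite) set \<Rightarrow> bool" where
  "semialgebraic S \<longleftrightarrow>
    (\<exists>D :: (('v, real) mpoly set \<times> ('v, real) mpoly set) set.
      finite D \<and> (\<forall>(P, Q)\<in>D. finite P \<and> finite Q) \<and>
      S = (\<Union>(P, Q)\<in>D. {x. (\<forall>f\<in>P. mpoly_eval f (($) x) = 0) \<and> (\<forall>g\<in>Q. mpoly_eval g (($) x) > 0)}))"

text \<open>Class \<open>C\<^sup>k\<close>, meaningful for open \<open>U\<close> only.\<close>

primrec cont_diff ::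
  "nat \<Rightarrow> ('a::euclidean_space \<Rightarrow> 'b::euclidean_space) \<Rightarrow> 'a set \<Rightarrow> bool" where
  "cont_diff 0 f U = continuous_on U f"
| "cont_diff (Suc k) f U =
    (\<exists>f'. (\<forall>x\<in>U. (f has_derivative f' x) (at x)) \<and> (\<forall>v. cont_diff k (\<lambda>x. f' x v) U))"

definition diffeomorphism ::
  "'a::euclidean_space set \<Rightarrow> 'b::euclidean_space set \<Rightarrow> ('a \<Rightarrow> 'b) \<Rightarrow> ('b \<Rightarrow> 'a) \<Rightarrow> bool" where
  "diffeomorphism U W \<phi> \<psi> \<longleftrightarrow> open U \<and> open W \<and> homeomorphism U W \<phi> \<psi> \<and>
    (\<forall>k. cont_diff k \<phi> U) \<and> (\<forall>k. cont_diff k \<psi> W)"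

definition smooth_submanifold :: "nat \<Rightarrow> 'a::euclidean_space set \<Rightarrow> bool" where
  "smooth_submanifold d S \<longleftrightarrow>
    (\<forall>x\<in>S. \<exists>U W \<phi> \<psi> (L :: 'a set). x \<in> U \<and> diffeomorphism U W \<phi> \<psi> \<and>
      subspace L \<and> dim L = d \<and> \<phi> ` (S \<inter> U) = L \<inter> W)"

definition smooth_semialgebraic_manifold :: "(real ^ 'v::finite) set \<Rightarrow> bool" where
  "smooth_semialgebraic_manifold S \<longleftrightarrow> semialgebraic S \<and> (\<exists>d. smooth_submanifold d S)"

text \<open>Players are the elements of a finite type \<open>'n\<close>; the strategies of each player are the two
  elements \<open>1\<close> and \<open>2\<close> of the type \<open>2\<close>. The tensor \<open>X $ i\<close> contains the payoffs of player \<open>i\<close>.\<close>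

type_synonym 'n profile = "'n \<Rightarrow> 2"
type_synonym 'n game = "(real ^ ('n profile)) ^ 'n"

definition game_zariski_closed :: "('n::finite) game set \<Rightarrow> bool" where
  "game_zariski_closed Z \<longleftrightarrow>
    (\<exists>F :: ('n \<times> 'n profile, real) mpoly set.
      Z = {X. \<forall>f\<in>F. mpoly_eval f (\<lambda>(i, j). X $ i $ j) = 0})"

definition generic_game :: "(('n::finite) game \<Rightarrow> bool) \<Rightarrow> bool" where
  "generic_game P \<longleftrightarrow> (\<exists>Z. game_zariski_closed Z \<and> Z \<noteq> UNIV \<and> (\<forall>X. X \<notin> Z \<longrightarrow> P X))"

definition spohn_matrix ::
  "('n::finite) game \<Rightarrow> 'n \<Rightarrow> complex ^ ('n profile) \<Rightarrow> complex ^ 2 ^ 2" where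
  "spohn_matrix X i p = (\<chi> k l.
    if l = 1 then \<Sum>j\<in>{j. j i = k}. p $ j
    else \<Sum>j\<in>{j. j i = k}. complex_of_real (X $ i $ j) * p $ j)"

definition spohn_variety :: "('n::finite) game \<Rightarrow> (complex ^ ('n profile)) set" where
  "spohn_variety X = {p. p \<noteq> 0 \<and> (\<forall>i. det (spohn_matrix X i p) = 0)}"

text \<open>An undirected graph on the vertex set \<open>'n\<close> is given by its symmetric adjacency relation \<open>E\<close>.\<close>

definition graph_path :: "('n \<times> 'n) set \<Rightarrow> 'n list \<Rightarrow> bool" where
  "graph_path E xs \<longleftrightarrow> xs \<noteq> [] \<and> distinct xs \<and> successively (\<lambda>u v. (u, v) \<in> E) xs"

definition separates :: "('n \<times> 'n) set \<Rightarrow> 'n set \<Rightarrow> 'n set \<Rightarrow> 'n set \<Rightarrow> bool" where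
  "separates E C A B \<longleftrightarrow>
    (\<forall>xs. graph_path E xs \<and> hd xs \<in> A \<and> last xs \<in> B \<longrightarrow> set xs \<inter> C \<noteq> {})"

text \<open>The triple \<open>(A, B, C)\<close> stands for the statement that \<open>A\<close> is independent of \<open>B\<close> given \<open>C\<close>.\<close>

type_synonym 'n ci_statement = "'n set \<times> 'n set \<times> 'n set"

definition global_markov :: "('n \<times> 'n) set \<Rightarrow> 'n ci_statement set" where
  "global_markov E =
    {(A, B, C). A \<inter> B = {} \<and> A \<inter> C = {} \<and> B \<inter> C = {} \<and> separates E C A B}"

text \<open>\<open>marginal p A a B b C c\<close> only depends on the restrictions of the profiles \<open>a\<close>, \<open>b\<close>, \<open>c\<close> to
  \<open>A\<close>, \<open>B\<close>, \<open>C\<close>, respectively.\<close>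

definition marginal :: "complex ^ (('n::finite) profile) \<Rightarrow>
    'n set \<Rightarrow> 'n profile \<Rightarrow> 'n set \<Rightarrow> 'n profile \<Rightarrow> 'n set \<Rightarrow> 'n profile \<Rightarrow> complex" where
  "marginal p A a B b C c =
    (\<Sum>j\<in>{j. (\<forall>v\<in>A. j v = a v) \<and> (\<forall>v\<in>B. j v = b v) \<and> (\<forall>v\<in>C. j v = c v)}. p $ j)"

definition independence_model :: "('n::finite) ci_statement set \<Rightarrow> (complex ^ ('n profile)) set" where
  "independence_model \<C> = {p. p \<noteq> 0 \<and> (\<forall>(A, B, C)\<in>\<C>. \<forall>a a' b b' c.
      marginal p A a B b C c * marginal p A a' B b' C c
      - marginal p A a B b' C c * marginal p A a' B b C c = 0)}"

definition hyperplanes :: "(complex ^ (('n::finite) profile)) set" where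
  "hyperplanes = {p. p \<noteq> 0 \<and> ((\<exists>j. p $ j = 0) \<or> (\<Sum>j\<in>UNIV. p $ j) = 0)}"

definition spohn_ci_variety ::
  "('n::finite) game \<Rightarrow> 'n ci_statement set \<Rightarrow> (complex ^ ('n profile)) set" where
  "spohn_ci_variety X \<C> =
    zariski_closure ((spohn_variety X \<inter> independence_model \<C>) - hyperplanes)"

definition open_simplex :: "(real ^ (('n::finite) profile)) set" where
  "open_simplex = {q. (\<forall>j. q $ j > 0) \<and> (\<Sum>j\<in>UNIV. q $ j) = 1}"

text \<open>Each point of the projective open simplex is represented by its unique representative
  with real coordinates of sum \<open>1\<close>.\<close>

definition totally_mixed_ci_equilibria ::
  "('n::finite) game \<Rightarrow> 'n ci_statement set \<Rightarrow> (real ^ ('n profile)) set" where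
  "totally_mixed_ci_equilibria X \<C> =
    {q \<in> open_simplex. (\<chi> j. complex_of_real (q $ j)) \<in> spohn_ci_variety X \<C>}"

end

theory Submission
  imports Defs "HOL-Complex_Analysis.Conformal_Mappings"
begin

text \<open>Off the coordinate hyperplanes and the hyperplane where the coordinates sum to \<open>0\<close>, the variety is cut out
  by few quadrics: one Spohn equation for each player and one binomial for each set of players that is not a
  clique. That these binomials suffice is the theorem of Hammersley and Clifford, which holds at all complex
  points of the torus (\<open>independence_model_torus\<close>). The theorem follows once, for generic payoffs, the gradients of all these
  quadrics are linearly independent at every common zero in question.

  This is a statement of Bertini type (\<open>generic_transversality\<close>). The binomials are triangular and hence
  independent, and the Spohn equation of a player is linear in the payoffs of that player, with coefficients that do
  not all vanish. So at a zero where the gradients with respect to the probabilities are dependent, some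
  nontrivial combination of the full gradients involves only the differentials of payoffs: the payoffs are
  differentially dependent modulo the equations. The Jacobian criterion (\<open>algebraic_dependence\<close>) converts
  this pointwise dependence into a polynomial relation that all bad payoffs satisfy. Its proof passes to a generic
  point with coordinates in an ultrapower of the complex numbers: if there were no relation, some
  derivation of that field would kill all payoffs but one, and applying it to the equations contradicts the
  dependence.

  Transversality implies smoothness in the algebraic sense (\<open>smooth_at_transversal\<close>). The inverse function theorem
  straightens the zero set to its linear tangent space \<open>T\<close>, which identifies the Zariski tangent space
  with \<open>T\<close>; the closures of the images of a flag of subspaces of \<open>T\<close> form a chain of irreducible subvarieties of
  the expected length. No chain is longer (\<open>chain_bound\<close>): a chain yields algebraically independent functions
  on its largest member, and the Jacobian criterion bounds their number by the dimension of \<open>T\<close>.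

  For the equilibria, the same straightening over the reals, together with the normalization of the probabilities,
  gives the charts of a submanifold. Its dimension is the same everywhere, as the number of equations is.\<close>

section \<open>Polynomial functions\<close>

text \<open>Polynomials are handled as functions, closed under the ring operations and composition; formal polynomials
  enter only through their evaluation. The set \<open>I\<close> contains the variables that may occur.\<close>

inductive polyfun :: "'v set \<Rightarrow> (('v \<Rightarrow> 'a::comm_ring_1) \<Rightarrow> 'a) \<Rightarrow> bool" for I where
  polyfun_const: "polyfun I (\<lambda>x. c)"
| polyfun_var: "v \<in> I \<Longrightarrow> polyfun I (\<lambda>x. x v)"
| polyfun_add: "polyfun I F \<Longrightarrow> polyfun I G \<Longrightarrow> polyfun I (\<lambda>x. F x + G x)"
| polyfun_mult: "polyfun I F \<Longrightarrow> polyfun I G \<Longrightarrow> polyfun I (\<lambda>x. F x * G x)"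

text \<open>A polynomial function together with a symbolic gradient. The relation is syntactic, so that the gradient can
  be used both for analytic derivatives and for arbitrary derivations of fields that contain the values.\<close>

inductive has_grad :: "(('v \<Rightarrow> 'a::comm_ring_1) \<Rightarrow> 'a) \<Rightarrow> ('v \<Rightarrow> ('v \<Rightarrow> 'a) \<Rightarrow> 'a) \<Rightarrow> bool" where
  has_grad_const: "has_grad (\<lambda>x. c) (\<lambda>v x. 0)"
| has_grad_var: "has_grad (\<lambda>x. x w) (\<lambda>v x. if v = w then 1 else 0)"
| has_grad_add: "has_grad F F' \<Longrightarrow> has_grad G G' \<Longrightarrow>
    has_grad (\<lambda>x. F x + G x) (\<lambda>v x. F' v x + G' v x)"
| has_grad_mult: "has_grad F F' \<Longrightarrow> has_grad G G' \<Longrightarrow>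
    has_grad (\<lambda>x. F x * G x) (\<lambda>v x. F' v x * G x + F x * G' v x)"

lemma polyfun_sum: "(\<And>a. a \<in> A \<Longrightarrow> polyfun I (F a)) \<Longrightarrow> polyfun I (\<lambda>x. \<Sum>a\<in>A. F a x)"
  by (induction A rule: infinite_finite_induct) (auto intro: polyfun.intros)

lemma polyfun_prod: "(\<And>a. a \<in> A \<Longrightarrow> polyfun I (F a)) \<Longrightarrow> polyfun I (\<lambda>x. \<Prod>a\<in>A. F a x)"
  by (induction A rule: infinite_finite_induct) (auto intro: polyfun.intros)

lemma polyfun_power: "polyfun I F \<Longrightarrow> polyfun I (\<lambda>x. F x ^ n)"
  by (induction n) (auto intro: polyfun.intros)

lemma polyfun_uminus: "polyfun I F \<Longrightarrow> polyfun I (\<lambda>x. - F x)"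
  using polyfun_mult[OF polyfun_const[of I "-1"]] by fastforce

lemma polyfun_diff:
  assumes "polyfun I F" "polyfun I G"
  shows "polyfun I (\<lambda>x. F x - G x)"
proof -
  have "polyfun I (\<lambda>x. F x + - G x)"
    by (intro polyfun_add polyfun_uminus assms)
  then show ?thesis by simp
qed

lemma polyfun_mono: "polyfun I F \<Longrightarrow> I \<subseteq> J \<Longrightarrow> polyfun J F"
  by (induction rule: polyfun.induct) (auto intro: polyfun.intros)

lemma polyfun_cong: "polyfun I F \<Longrightarrow> (\<And>v. v \<in> I \<Longrightarrow> x v = y v) \<Longrightarrow> F x = F y"
  by (induction rule: polyfun.induct) auto

lemma polyfun_comp:
  "polyfun J F \<Longrightarrow> (\<And>v. v \<in> J \<Longrightarrow> polyfun I (\<lambda>x. h x v)) \<Longrightarrow> polyfun I (\<lambda>x. F (h x))"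
  by (induction rule: polyfun.induct) (auto intro: polyfun.intros)

lemma polyfun_imp_has_grad: "polyfun I F \<Longrightarrow> \<exists>F'. has_grad F F'"
  by (induction rule: polyfun.induct) (blast intro: has_grad.intros)+

lemma has_grad_imp_polyfun: "has_grad F F' \<Longrightarrow> polyfun UNIV F"
  by (induction rule: has_grad.induct) (auto intro: polyfun.intros)

lemma has_grad_imp_polyfun_grad: "has_grad F F' \<Longrightarrow> polyfun UNIV (F' v)"
proof (induction rule: has_grad.induct)
  case (has_grad_var w)
  then show ?case by (cases "v = w") (auto intro: polyfun.intros)
next
  case (has_grad_mult F F' G G')
  then show ?case
    using has_grad_imp_polyfun polyfun_add polyfun_mult by metis
qed (auto intro: polyfun.intros)

lemma has_grad_cong:
  "has_grad F F' \<Longrightarrow> (\<And>x. F x = G x) \<Longrightarrow> (\<And>v x. F' v x = G' v x) \<Longrightarrow> has_grad G G'"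
  by (subgoal_tac "F = G \<and> F' = G'") (auto simp: fun_eq_iff)

lemma has_grad_sum:
  "(\<And>a. a \<in> A \<Longrightarrow> has_grad (F a) (F' a)) \<Longrightarrow>
    has_grad (\<lambda>x. \<Sum>a\<in>A. F a x) (\<lambda>v x. \<Sum>a\<in>A. F' a v x)"
  by (induction A rule: infinite_finite_induct) (auto intro: has_grad.intros)

lemma has_grad_diff:
  assumes "has_grad F F'" "has_grad G G'"
  shows "has_grad (\<lambda>x. F x - G x) (\<lambda>v x. F' v x - G' v x)"
  using has_grad_add[OF assms(1) has_grad_mult[OF has_grad_const[of "-1"] assms(2)]]
  by (rule has_grad_cong) auto

lemma has_derivative_polyfun_comp:
  fixes P :: "('w::finite \<Rightarrow> 'a::real_normed_field) \<Rightarrow> 'a"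
    and \<Psi> :: "'w \<Rightarrow> 'e::real_normed_vector \<Rightarrow> 'a"
  assumes "has_grad P P'" "\<And>w. (\<Psi> w has_derivative D w) (at y)"
  shows "((\<lambda>y. P (\<lambda>w. \<Psi> w y)) has_derivative (\<lambda>u. \<Sum>w\<in>UNIV. P' w (\<lambda>w. \<Psi> w y) * D w u)) (at y)"
  using assms(1)
proof (induction rule: has_grad.induct)
  case (has_grad_const c)
  then show ?case by simp
next
  case (has_grad_var w)
  have "(\<lambda>u. \<Sum>v\<in>UNIV. (if v = w then 1 else 0) * D v u) = D w"
    by (simp add: fun_eq_iff if_distrib[of "\<lambda>a. a * _"] cong: if_cong)
  then show ?case using assms(2)[of w] by simp
next
  case (has_grad_add F F' G G')
  show ?case
    by (rule has_derivative_eq_rhs[OF has_derivative_add[OF has_grad_add.IH]])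
      (auto simp: fun_eq_iff sum.distrib algebra_simps)
next
  case (has_grad_mult F F' G G')
  show ?case
    by (rule has_derivative_eq_rhs[OF has_derivative_mult[OF has_grad_mult.IH]])
      (auto simp: fun_eq_iff sum.distrib algebra_simps sum_distrib_left sum_distrib_right)
qed

lemma has_grad_has_derivative:
  fixes F :: "('v::finite \<Rightarrow> 'a::real_normed_field) \<Rightarrow> 'a"
  assumes "has_grad F F'"
  shows "((\<lambda>z::'a^'v. F (($) z)) has_derivative (\<lambda>u. \<Sum>v\<in>UNIV. F' v (($) z) * u $ v)) (at z)"
  by (rule has_derivative_polyfun_comp[OF assms, of "\<lambda>v z. z $ v"])
    (intro bounded_linear_imp_has_derivative bounded_linear_vec_nth)

lemma polyfun_continuous:
  fixes F :: "('v::finite \<Rightarrow> 'a::real_normed_field) \<Rightarrow> 'a"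
  assumes "polyfun I F"
  shows "continuous_on A (\<lambda>z::'a^'v. F (($) z))"
  using assms by (induction rule: polyfun.induct) (auto intro!: continuous_intros)

lemma polyfun_on_line:
  assumes "polyfun I F"
  shows "\<exists>P. \<forall>s. F (\<lambda>v. a v + s * b v) = poly P s"
  using assms
proof (induction rule: polyfun.induct)
  case (polyfun_const c)
  show ?case by (rule exI[of _ "[:c:]"]) simp
next
  case (polyfun_var v)
  show ?case by (rule exI[of _ "[:a v, b v:]"]) simp
next
  case (polyfun_add F G)
  then obtain P Q where "\<forall>s. F (\<lambda>v. a v + s * b v) = poly P s"
    "\<forall>s. G (\<lambda>v. a v + s * b v) = poly Q s" by blast
  then show ?case by (intro exI[of _ "P + Q"]) simp
next
  case (polyfun_mult F G)
  then obtain P Q where "\<forall>s. F (\<lambda>v. a v + s * b v) = poly P s"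
    "\<forall>s. G (\<lambda>v. a v + s * b v) = poly Q s" by blast
  then show ?case by (intro exI[of _ "P * Q"]) simp
qed

text \<open>On a line that joins a nonzero of one function to a nonzero of the other, both become nonzero polynomials in
  one variable, which have finitely many roots.\<close>

lemma polyfun_mult_nonzero:
  fixes F G :: "('v \<Rightarrow> 'a::field_char_0) \<Rightarrow> 'a"
  assumes "polyfun I F" "polyfun J G" "F x \<noteq> 0" "G y \<noteq> 0"
  shows "\<exists>z. F z * G z \<noteq> 0"
proof -
  obtain P where P: "\<And>s. F (\<lambda>v. x v + s * (y v - x v)) = poly P s"
    using polyfun_on_line[OF assms(1), of x "\<lambda>v. y v - x v"] by blast
  obtain Q where Q: "\<And>s. G (\<lambda>v. x v + s * (y v - x v)) = poly Q s"
    using polyfun_on_line[OF assms(2), of x "\<lambda>v. y v - x v"] by blast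
  have "P \<noteq> 0" "Q \<noteq> 0"
    using P[of 0] Q[of 1] assms(3,4) by auto
  then have "P * Q \<noteq> 0" by simp
  then obtain s where "poly (P * Q) s \<noteq> 0"
    using poly_all_0_iff_0 by blast
  then show ?thesis
    using P[of s] Q[of s] by (intro exI[of _ "\<lambda>v. x v + s * (y v - x v)"]) simp
qed

text \<open>The expansion in powers of the variable \<open>w\<close>; the uniform bound on the degree makes the values
  of \<open>P x\<close> at polynomial functions of \<open>x\<close> polynomial again.\<close>

lemma polyfun_expand:
  assumes "polyfun I F"
  shows "\<exists>P n. (\<forall>j. polyfun (I - {w}) (\<lambda>x. coeff (P x) j)) \<and> (\<forall>x. degree (P x) \<le> n) \<and>
    (\<forall>x. F x = poly (P x) (x w))"
  using assms
proof (induction rule: polyfun.induct)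
  case (polyfun_const c)
  have "polyfun (I - {w}) (\<lambda>x. coeff [:c:] j)" for j
    by (rule polyfun.polyfun_const)
  then show ?case by (intro exI[of _ "\<lambda>x. [:c:]"] exI[of _ 0]) simp
next
  case (polyfun_var v)
  show ?case
  proof (cases "v = w")
    case True
    have "polyfun (I - {w}) (\<lambda>x. coeff [:0,1:] j)" for j
      by (rule polyfun.polyfun_const)
    then show ?thesis using True
      by (intro exI[of _ "\<lambda>x. [:0,1:]"] exI[of _ 1] conjI allI) simp_all
  next
    case False
    have "polyfun (I - {w}) (\<lambda>x. coeff [:x v:] j)" for j
      using False polyfun_var by (cases j) (auto intro: polyfun.intros)
    then show ?thesis 
      by (intro exI[of _ "\<lambda>x. [:x v:]"] exI[of _ 0] conjI allI) simp_all
  qed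
next
  case (polyfun_add F G)
  then obtain P Q m n where P: "\<And>j. polyfun (I - {w}) (\<lambda>x. coeff (P x) j)" "\<And>x. degree (P x) \<le> m"
      "\<And>x. F x = poly (P x) (x w)"
    and Q: "\<And>j. polyfun (I - {w}) (\<lambda>x. coeff (Q x) j)" "\<And>x. degree (Q x) \<le> n"
      "\<And>x. G x = poly (Q x) (x w)"
    by metis
  have "degree (P x + Q x) \<le> max m n" for x
    using P(2)[of x] Q(2)[of x] by (intro order.trans[OF degree_add_le_max]) auto
  then show ?case using P Q
    by (intro exI[of _ "\<lambda>x. P x + Q x"] exI[of _ "max m n"]) (auto intro: polyfun.intros)
next
  case (polyfun_mult F G)
  then obtain P Q m n where P: "\<And>j. polyfun (I - {w}) (\<lambda>x. coeff (P x) j)" "\<And>x. degree (P x) \<le> m"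
      "\<And>x. F x = poly (P x) (x w)"
    and Q: "\<And>j. polyfun (I - {w}) (\<lambda>x. coeff (Q x) j)" "\<And>x. degree (Q x) \<le> n"
      "\<And>x. G x = poly (Q x) (x w)"
    by metis
  have "degree (P x * Q x) \<le> m + n" for x
    using P(2)[of x] Q(2)[of x] by (intro order.trans[OF degree_mult_le]) auto
  then show ?case using P Q
    by (intro exI[of _ "\<lambda>x. P x * Q x"] exI[of _ "m + n"])
      (auto simp: coeff_mult intro!: polyfun.intros polyfun_sum)
qed

text \<open>Replace one coordinate at a time: a polynomial in one variable that vanishes at all real numbers is zero.\<close>

lemma polyfun_zero_of_real:
  fixes F :: "('v::finite \<Rightarrow> complex) \<Rightarrow> complex"
  assumes "polyfun I F" and zero: "\<And>y :: 'v \<Rightarrow> real. F (\<lambda>v. of_real (y v)) = 0"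
  shows "F x = 0"
proof -
  have "finite J \<Longrightarrow> F (\<lambda>v. if v \<in> J then x v else of_real (y v)) = 0" for J and y :: "'v \<Rightarrow> real"
  proof (induction J arbitrary: y rule: finite_induct)
    case empty
    then show ?case using zero by simp
  next
    case (insert w J)
    obtain P where P: "\<And>s. F (\<lambda>v. (if v = w then 0 else if v \<in> J then x v else of_real (y v))
        + s * (if v = w then 1 else 0)) = poly P s"
      using polyfun_on_line[OF assms(1), of
        "\<lambda>v. if v = w then 0 else if v \<in> J then x v else of_real (y v)"
        "\<lambda>v. if v = w then 1 else 0"] by auto
    have eq: "(\<lambda>v. (if v = w then 0 else if v \<in> J then x v else of_real (y v)) + s * (if v = w then 1 else 0))
        = (\<lambda>v. if v = w then s else if v \<in> J then x v else of_real (y v))" for s :: complex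
      by auto
    have "poly P (of_real r) = 0" for r :: real
    proof -
      have "(\<lambda>v. if v = w then complex_of_real r else if v \<in> J then x v else of_real (y v))
         = (\<lambda>v. if v \<in> J then x v else of_real ((y(w := r)) v))"
        using insert.hyps by auto
      then show ?thesis using P[of "of_real r"] insert.IH[of "y(w := r)"] by (simp add: eq)
    qed
    then have "range complex_of_real \<subseteq> {s. poly P s = 0}" by auto
    moreover have "infinite (range complex_of_real)"
      by (simp add: finite_image_iff inj_of_real infinite_UNIV_char_0)
    ultimately have "P = 0" using poly_roots_finite finite_subset by blast
    then have "F (\<lambda>v. if v = w then x w else if v \<in> J then x v else of_real (y v)) = 0"
      using P[of "x w"] by (simp add: eq)
    moreover have "(\<lambda>v. if v = w then x w else if v \<in> J then x v else of_real (y v))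
       = (\<lambda>v. if v \<in> insert w J then x v else of_real (y v))"
      by auto
    ultimately show ?case by simp
  qed
  from this[of UNIV] show ?thesis by simp
qed

text \<open>Real and imaginary parts turn a complex relation between real payoffs into real relations.\<close>

lemma polyfun_re_im:
  assumes "polyfun I F"
  shows "\<exists>A B :: ('v \<Rightarrow> real) \<Rightarrow> real. polyfun I A \<and> polyfun I B \<and>
    (\<forall>y. F (\<lambda>v. complex_of_real (y v)) = Complex (A y) (B y))"
  using assms
proof (induction rule: polyfun.induct)
  case (polyfun_const c)
  then show ?case
    by (intro exI[of _ "\<lambda>x. Re c"] exI[of _ "\<lambda>x. Im c"]) (auto intro: polyfun.intros)
next
  case (polyfun_var v)
  then show ?case
    by (intro exI[of _ "\<lambda>x. x v"] exI[of _ "\<lambda>x. 0"])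
      (auto intro: polyfun.intros simp: complex_eq_iff)
next
  case (polyfun_add F G)
  then obtain A B C D where "polyfun I A" "polyfun I B" "polyfun I C" "polyfun I D"
    "\<forall>y. F (\<lambda>v. complex_of_real (y v)) = Complex (A y) (B y)"
    "\<forall>y. G (\<lambda>v. complex_of_real (y v)) = Complex (C y) (D y)" by blast
  then show ?case
    by (intro exI[of _ "\<lambda>x. A x + C x"] exI[of _ "\<lambda>x. B x + D x"])
      (auto intro: polyfun.intros simp: complex_eq_iff)
next
  case (polyfun_mult F G)
  then obtain A B C D where "polyfun I A" "polyfun I B" "polyfun I C" "polyfun I D"
    "\<forall>y. F (\<lambda>v. complex_of_real (y v)) = Complex (A y) (B y)"
    "\<forall>y. G (\<lambda>v. complex_of_real (y v)) = Complex (C y) (D y)" by blast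
  then show ?case
    by (intro exI[of _ "\<lambda>x. A x * C x - B x * D x"] exI[of _ "\<lambda>x. A x * D x + B x * C x"])
      (auto intro!: polyfun.intros polyfun_diff simp: complex_eq_iff)
qed

section \<open>Formal polynomials and their evaluation\<close>

definition monom_eval :: "('v \<Rightarrow>\<^sub>0 nat) \<Rightarrow> ('v \<Rightarrow> 'a::comm_semiring_1) \<Rightarrow> 'a" where
  "monom_eval m x = (\<Prod>v\<in>Poly_Mapping.keys m. x v ^ Poly_Mapping.lookup m v)"

definition total_deg :: "('v \<Rightarrow>\<^sub>0 nat) \<Rightarrow> nat" where
  "total_deg m = (\<Sum>v\<in>Poly_Mapping.keys m. Poly_Mapping.lookup m v)"

lemma monom_eval_superset:
  "finite A \<Longrightarrow> Poly_Mapping.keys m \<subseteq> A \<Longrightarrow>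
    monom_eval m x = (\<Prod>v\<in>A. x v ^ Poly_Mapping.lookup m v)"
  unfolding monom_eval_def by (rule prod.mono_neutral_left) (auto simp: in_keys_iff)

lemma total_deg_superset:
  "finite A \<Longrightarrow> Poly_Mapping.keys m \<subseteq> A \<Longrightarrow> total_deg m = (\<Sum>v\<in>A. Poly_Mapping.lookup m v)"
  unfolding total_deg_def by (rule sum.mono_neutral_left) (auto simp: in_keys_iff)

lemma monom_eval_add: "monom_eval (m + n) x = monom_eval m x * monom_eval n x"
proof -
  let ?A = "Poly_Mapping.keys m \<union> Poly_Mapping.keys n"
  have "finite ?A" "Poly_Mapping.keys (m + n) \<subseteq> ?A" "Poly_Mapping.keys m \<subseteq> ?A" "Poly_Mapping.keys n \<subseteq> ?A"
    using keys_add[of m n] by auto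
  then show ?thesis
    by (simp add: monom_eval_superset[of ?A] lookup_add power_add prod.distrib)
qed

lemma total_deg_add: "total_deg (m + n) = total_deg m + total_deg n"
proof -
  let ?A = "Poly_Mapping.keys m \<union> Poly_Mapping.keys n"
  have "finite ?A" "Poly_Mapping.keys (m + n) \<subseteq> ?A" "Poly_Mapping.keys m \<subseteq> ?A" "Poly_Mapping.keys n \<subseteq> ?A"
    using keys_add[of m n] by auto
  then show ?thesis
    by (simp add: total_deg_superset[of ?A] lookup_add sum.distrib)
qed

lemma mpoly_eval_superset:
  "finite A \<Longrightarrow> Poly_Mapping.keys f \<subseteq> A \<Longrightarrow>
    mpoly_eval f x = (\<Sum>m\<in>A. Poly_Mapping.lookup f m * monom_eval m x)"
  unfolding mpoly_eval_def monom_eval_def[symmetric]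
  by (rule sum.mono_neutral_left) (auto simp: in_keys_iff)

lemma mpoly_eval_add: "mpoly_eval (f + g) x = mpoly_eval f x + mpoly_eval g x"
proof -
  let ?A = "Poly_Mapping.keys f \<union> Poly_Mapping.keys g"
  have "finite ?A" "Poly_Mapping.keys (f + g) \<subseteq> ?A" "Poly_Mapping.keys f \<subseteq> ?A" "Poly_Mapping.keys g \<subseteq> ?A"
    using keys_add[of f g] by auto
  then show ?thesis
    by (simp add: mpoly_eval_superset[of ?A] lookup_add sum.distrib algebra_simps)
qed

lemma mpoly_eval_single: "mpoly_eval (Poly_Mapping.single m c) x = c * monom_eval m x"
  by (subst mpoly_eval_superset[of "{m}"]) auto

lemma mpoly_eval_zero [simp]: "mpoly_eval 0 x = 0"
  by (simp add: mpoly_eval_def)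

lemma mpoly_eval_sum: "mpoly_eval (\<Sum>a\<in>A. f a) x = (\<Sum>a\<in>A. mpoly_eval (f a) x)"
  by (induction A rule: infinite_finite_induct) (auto simp: mpoly_eval_add)

lemma mpoly_sum_singles:
  fixes f :: "('v, 'a::comm_semiring_1) mpoly"
  shows "f = (\<Sum>m\<in>Poly_Mapping.keys f. Poly_Mapping.single m (Poly_Mapping.lookup f m))"
  by (rule poly_mapping_eqI)
    (auto simp: lookup_sum lookup_single when_def in_keys_iff if_distrib cong: if_cong)

lemma mpoly_eval_mult:
  fixes f g :: "('v, 'a::comm_semiring_1) mpoly"
  shows "mpoly_eval (f * g) x = mpoly_eval f x * mpoly_eval g x"
proof -
  have "mpoly_eval (f * g) x = mpoly_eval ((\<Sum>m\<in>Poly_Mapping.keys f. Poly_Mapping.single m (Poly_Mapping.lookup f m))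
     * (\<Sum>m\<in>Poly_Mapping.keys g. Poly_Mapping.single m (Poly_Mapping.lookup g m))) x"
    by (intro arg_cong2[where f = "\<lambda>a b. mpoly_eval (a * b) x"] mpoly_sum_singles)
  also have "\<dots> = mpoly_eval f x * mpoly_eval g x"
    by (simp add: sum_product mult_single mpoly_eval_sum mpoly_eval_single monom_eval_add
        mpoly_eval_superset[OF _ order_refl] ac_simps)
  finally show ?thesis .
qed

lemma polyfun_mpoly_eval: "polyfun UNIV (mpoly_eval f)"
  unfolding mpoly_eval_def[abs_def]
  by (intro polyfun_sum polyfun_mult polyfun_prod polyfun_power polyfun_const polyfun_var) auto

text \<open>The zero function is a form of every degree, so that the forms of one degree are closed under sums.\<close>

definition is_form :: "nat \<Rightarrow> (('v \<Rightarrow> 'a::comm_ring_1) \<Rightarrow> 'a) \<Rightarrow> bool" where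
  "is_form d F \<longleftrightarrow> (\<exists>f. (\<forall>m\<in>Poly_Mapping.keys f. total_deg m = d) \<and> mpoly_eval f = F)"

lemma is_form_homogeneous: "is_form d F \<Longrightarrow> \<exists>f. homogeneous f \<and> mpoly_eval f = F"
  unfolding is_form_def homogeneous_def total_deg_def by blast

lemma homogeneous_is_form: "homogeneous f \<Longrightarrow> \<exists>d. is_form d (mpoly_eval f)"
  unfolding is_form_def homogeneous_def total_deg_def by blast

lemma is_form_zero: "is_form d (\<lambda>x. 0)"
  unfolding is_form_def by (rule exI[of _ 0]) (auto simp: fun_eq_iff)

lemma is_form_const: "is_form 0 (\<lambda>x. c)"
  unfolding is_form_def
  by (rule exI[of _ "Poly_Mapping.single 0 c"])
    (auto simp: fun_eq_iff mpoly_eval_single monom_eval_def total_deg_def split: if_splits)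

lemma is_form_var: "is_form 1 (\<lambda>x. x v)"
  unfolding is_form_def
  by (rule exI[of _ "Poly_Mapping.single (Poly_Mapping.single v 1) 1"])
    (auto simp: fun_eq_iff mpoly_eval_single monom_eval_def total_deg_def split: if_splits)

lemma is_form_add:
  assumes "is_form d F" "is_form d G"
  shows "is_form d (\<lambda>x. F x + G x)"
proof -
  obtain f g where "\<forall>m\<in>Poly_Mapping.keys f. total_deg m = d" "mpoly_eval f = F"
    "\<forall>m\<in>Poly_Mapping.keys g. total_deg m = d" "mpoly_eval g = G"
    using assms unfolding is_form_def by blast
  then show ?thesis unfolding is_form_def
    using keys_add[of f g] by (intro exI[of _ "f + g"]) (auto simp: fun_eq_iff mpoly_eval_add)
qed

lemma is_form_mult:
  assumes "is_form d F" "is_form e G"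
  shows "is_form (d + e) (\<lambda>x. F x * G x)"
proof -
  obtain f g where "\<forall>m\<in>Poly_Mapping.keys f. total_deg m = d" "mpoly_eval f = F"
    "\<forall>m\<in>Poly_Mapping.keys g. total_deg m = e" "mpoly_eval g = G"
    using assms unfolding is_form_def by blast
  moreover from this have "total_deg m = d + e" if "m \<in> Poly_Mapping.keys (f * g)" for m
    using that keys_mult[of f g] by (auto simp: total_deg_add)
  moreover have "mpoly_eval (f * g) = (\<lambda>x. F x * G x)"
    using calculation by (simp add: fun_eq_iff mpoly_eval_mult)
  ultimately show ?thesis unfolding is_form_def by blast
qed

lemma is_form_sum: "(\<And>a. a \<in> A \<Longrightarrow> is_form d (F a)) \<Longrightarrow> is_form d (\<lambda>x. \<Sum>a\<in>A. F a x)"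
  by (induction A rule: infinite_finite_induct) (auto intro: is_form_zero is_form_add)

lemma is_form_cmult: "is_form d F \<Longrightarrow> is_form d (\<lambda>x. c * F x)"
  using is_form_mult[OF is_form_const] by fastforce

lemma is_form_diff: "is_form d F \<Longrightarrow> is_form d G \<Longrightarrow> is_form d (\<lambda>x. F x - G x)"
  using is_form_add[OF _ is_form_cmult[of d G "-1"]] by fastforce

lemma is_form_polyfun: "is_form d F \<Longrightarrow> polyfun UNIV F"
  unfolding is_form_def using polyfun_mpoly_eval by blast

lemma is_form_prod:
  "(\<And>a. a \<in> A \<Longrightarrow> is_form (d a) (F a)) \<Longrightarrow> is_form (\<Sum>a\<in>A. d a) (\<lambda>x. \<Prod>a\<in>A. F a x)"
  by (induction A rule: infinite_finite_induct) (auto intro: is_form_const is_form_mult)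

lemma is_form_scale:
  assumes "is_form d F"
  shows "F (\<lambda>v. t * x v) = t ^ d * F x"
proof -
  obtain f where f: "\<forall>m\<in>Poly_Mapping.keys f. total_deg m = d" "mpoly_eval f = F"
    using assms unfolding is_form_def by blast
  have "monom_eval m (\<lambda>v. t * x v) = t ^ total_deg m * monom_eval m x" for m
    by (simp add: monom_eval_def total_deg_def power_mult_distrib prod.distrib power_sum)
  then show ?thesis
    using f(1) unfolding f(2)[symmetric] mpoly_eval_superset[OF _ order_refl, of f, simplified]
    by (auto simp: sum_distrib_left intro!: sum.cong)
qed

lemma polyfun_imp_mpoly: "polyfun I F \<Longrightarrow> \<exists>f. mpoly_eval f = F"
proof (induction rule: polyfun.induct)
  case (polyfun_const c)
  then show ?case using is_form_const[of c] unfolding is_form_def by blast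
next
  case (polyfun_var v)
  then show ?case using is_form_var[of v] unfolding is_form_def by blast
next
  case (polyfun_add F G)
  then obtain f g where "mpoly_eval f = F" "mpoly_eval g = G" by blast
  then have "mpoly_eval (f + g) = (\<lambda>x. F x + G x)" by (simp add: fun_eq_iff mpoly_eval_add)
  then show ?case by blast
next
  case (polyfun_mult F G)
  then obtain f g where "mpoly_eval f = F" "mpoly_eval g = G" by blast
  then have "mpoly_eval (f * g) = (\<lambda>x. F x * G x)" by (simp add: fun_eq_iff mpoly_eval_mult)
  then show ?case by blast
qed

lemma polyfun_forms:
  assumes "polyfun I F"
  shows "\<exists>n H. (\<forall>d. is_form d (H d)) \<and> F = (\<lambda>x. \<Sum>d\<le>n. H d x)"
proof -
  obtain f where f: "mpoly_eval f = F" using polyfun_imp_mpoly[OF assms] by blast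
  define K where "K = Poly_Mapping.keys f"
  define H where "H d = (\<lambda>x. \<Sum>m\<in>{m\<in>K. total_deg m = d}. Poly_Mapping.lookup f m * monom_eval m x)" for d
  define n where "n = Max (insert 0 (total_deg ` K))"
  have fin: "finite K" by (simp add: K_def)
  have "is_form d (H d)" for d
    unfolding H_def
  proof (rule is_form_sum)
    fix m assume m: "m \<in> {m \<in> K. total_deg m = d}"
    show "is_form d (\<lambda>x. Poly_Mapping.lookup f m * monom_eval m x)"
      unfolding is_form_def using m
      by (intro exI[of _ "Poly_Mapping.single m (Poly_Mapping.lookup f m)"])
        (auto simp: mpoly_eval_single fun_eq_iff split: if_splits)
  qed
  moreover have "F x = (\<Sum>d\<le>n. H d x)" for x
  proof -
    have "total_deg ` K \<subseteq> {..n}" using fin by (auto simp: n_def)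
    then have "(\<Sum>d\<le>n. H d x) = (\<Sum>m\<in>K. Poly_Mapping.lookup f m * monom_eval m x)"
      unfolding H_def by (rule sum.group[OF fin finite_atMost])
    then show ?thesis
      unfolding f[symmetric] K_def by (simp add: mpoly_eval_superset[OF _ order_refl])
  qed
  ultimately show ?thesis by blast
qed

text \<open>Euler's formula, by differentiating \<open>F (t x) = t\<^sup>d F x\<close> at \<open>t = 1\<close>.\<close>

lemma is_form_euler:
  fixes z :: "'a::real_normed_field ^ 'v::finite"
  assumes "is_form d F" "has_grad F F'"
  shows "(\<Sum>v\<in>UNIV. F' v (($) z) * z $ v) = of_nat d * F (($) z)"
proof -
  have 1: "((\<lambda>t. F (($) (t *s z))) has_field_derivative (\<Sum>v\<in>UNIV. F' v (($) z) * z $ v)) (at 1)"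
  proof -
    have "bounded_linear (\<lambda>t::'a. t *s z)"
    proof
      show "\<exists>K. \<forall>t. norm (t *s z) \<le> norm t * K"
      proof (intro exI allI)
        fix t :: 'a
        have "norm (t *s z) \<le> (\<Sum>v\<in>UNIV. norm ((t *s z) $ v))"
          unfolding norm_vec_def by (rule L2_set_le_sum) simp
        then show "norm (t *s z) \<le> norm t * (\<Sum>v\<in>UNIV. norm (z $ v))"
          by (simp add: norm_mult sum_distrib_left)
      qed
    qed (auto simp: vec_eq_iff algebra_simps)
    then have "((\<lambda>t. t *s z) has_derivative (\<lambda>t. t *s z)) (at (1::'a))"
      by (rule bounded_linear_imp_has_derivative)
    from has_derivative_compose[OF this has_grad_has_derivative[OF assms(2)]]
    show ?thesis unfolding has_field_derivative_def
      by (rule has_derivative_eq_rhs) (simp add: fun_eq_iff sum_distrib_left ac_simps)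
  qed
  have "($) (t *s z) = (\<lambda>v. t * z $ v)" for t
    by (simp add: fun_eq_iff)
  then have "(\<lambda>t. F (($) (t *s z))) = (\<lambda>t. t ^ d * F (($) z))"
    using is_form_scale[OF assms(1), of _ "($) z"] by simp
  moreover have "((\<lambda>t. t ^ d * F (($) z)) has_field_derivative (of_nat d * F (($) z))) (at 1)"
  proof -
    have "((\<lambda>t. t ^ d) has_field_derivative of_nat d) (at (1::'a))"
      using DERIV_power[OF DERIV_ident, where x = 1 and n = d and 'a = 'a] by simp
    from DERIV_cmult_right[OF this, of "F (($) z)"] show ?thesis by simp
  qed
  ultimately show ?thesis using 1 DERIV_unique by metis
qed

section \<open>Extending derivations\<close>

definition is_subring :: "'a::comm_ring_1 set \<Rightarrow> bool" where
  "is_subring K \<longleftrightarrow> 1 \<in> K \<and> (\<forall>x\<in>K. - x \<in> K) \<and>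
    (\<forall>x\<in>K. \<forall>y\<in>K. x + y \<in> K \<and> x * y \<in> K)"

text \<open>The values of the derivation may lie outside of \<open>K\<close>. Working with subrings instead of subfields avoids
  fractions when elements are adjoined.\<close>

definition derivation_on :: "'a::comm_ring_1 set \<Rightarrow> ('a \<Rightarrow> 'a) \<Rightarrow> bool" where
  "derivation_on K D \<longleftrightarrow> is_subring K \<and>
    (\<forall>x\<in>K. \<forall>y\<in>K. D (x + y) = D x + D y \<and> D (x * y) = D x * y + x * D y)"

definition polys_over :: "'a::comm_ring_1 set \<Rightarrow> 'a poly set" where
  "polys_over K = {p. \<forall>i. coeff p i \<in> K}"

lemma is_subringD:
  assumes "is_subring K"
  shows "1 \<in> K" "0 \<in> K" "x \<in> K \<Longrightarrow> - x \<in> K" "x \<in> K \<Longrightarrow> y \<in> K \<Longrightarrow> x + y \<in> K"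
    "x \<in> K \<Longrightarrow> y \<in> K \<Longrightarrow> x * y \<in> K" "x \<in> K \<Longrightarrow> y \<in> K \<Longrightarrow> x - y \<in> K" "of_nat n \<in> K"
proof -
  show *: "1 \<in> K" "x \<in> K \<Longrightarrow> - x \<in> K" "x \<in> K \<Longrightarrow> y \<in> K \<Longrightarrow> x + y \<in> K"
    "x \<in> K \<Longrightarrow> y \<in> K \<Longrightarrow> x * y \<in> K" for x y
    using assms unfolding is_subring_def by auto
  show 0: "0 \<in> K" using *(3)[OF *(1) *(2)[OF *(1)]] by simp
  show "x \<in> K \<Longrightarrow> y \<in> K \<Longrightarrow> x - y \<in> K" using *(3)[OF _ *(2), of x y] by simp
  show "of_nat n \<in> K" by (induction n) (use 0 * in auto)
qed

lemma is_subring_sum: "is_subring K \<Longrightarrow> (\<And>a. a \<in> A \<Longrightarrow> f a \<in> K) \<Longrightarrow> sum f A \<in> K"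
  by (induction A rule: infinite_finite_induct) (auto intro: is_subringD)

lemma derivation_onD:
  assumes "derivation_on K D"
  shows "is_subring K" "x \<in> K \<Longrightarrow> y \<in> K \<Longrightarrow> D (x + y) = D x + D y"
    "x \<in> K \<Longrightarrow> y \<in> K \<Longrightarrow> D (x * y) = D x * y + x * D y" "D 0 = 0" "D 1 = 0" "x \<in> K \<Longrightarrow> D (- x) = - D x"
proof -
  show *: "is_subring K" "x \<in> K \<Longrightarrow> y \<in> K \<Longrightarrow> D (x + y) = D x + D y"
    "x \<in> K \<Longrightarrow> y \<in> K \<Longrightarrow> D (x * y) = D x * y + x * D y" for x y
    using assms unfolding derivation_on_def by auto
  show 0: "D 0 = 0" using *(2)[of 0 0] is_subringD(2)[OF *(1)] by simp
  show "D 1 = 0" using *(3)[of 1 1] is_subringD(1)[OF *(1)] by simp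
  show "x \<in> K \<Longrightarrow> D (- x) = - D x"
    using *(2)[of x "- x"] is_subringD(3)[OF *(1)] 0 by (simp add: eq_neg_iff_add_eq_0 add.commute)
qed

lemma derivation_on_sum:
  assumes "derivation_on K D" "\<And>a. a \<in> A \<Longrightarrow> f a \<in> K"
  shows "D (sum f A) = (\<Sum>a\<in>A. D (f a))"
  using assms(2)
proof (induction A rule: infinite_finite_induct)
  case (insert a A)
  then show ?case
    using derivation_onD(2)[OF assms(1), of "f a" "sum f A"]
      is_subring_sum[OF derivation_onD(1)[OF assms(1)], of A f] by simp
qed (auto simp: derivation_onD[OF assms(1)])

context
  fixes K :: "'a::field_char_0 set" and D :: "'a \<Rightarrow> 'a" and t :: 'a
  assumes der: "derivation_on K D"
begin

private lemma sub: "is_subring K"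
  using der by (rule derivation_onD)

lemma polys_over_closed:
  assumes "p \<in> polys_over K" "q \<in> polys_over K"
  shows "p + q \<in> polys_over K" "p - q \<in> polys_over K" "p * q \<in> polys_over K"
    "pderiv p \<in> polys_over K"
  using assms is_subringD[OF sub] unfolding polys_over_def
  by (auto simp: coeff_mult coeff_pderiv is_subring_sum[OF sub]
      simp flip: of_nat_Suc simp del: of_nat_Suc)

lemma polys_over_monom: "c \<in> K \<Longrightarrow> monom c n \<in> polys_over K"
  using is_subringD[OF sub] unfolding polys_over_def by auto

text \<open>The only candidate for an extension of \<open>D\<close> to \<open>K[t]\<close> that maps \<open>t\<close> to \<open>w\<close>.\<close>

definition ext_der :: "'a \<Rightarrow> 'a poly \<Rightarrow> 'a" where
  "ext_der w p = poly (map_poly D p) t + poly (pderiv p) t * w"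

lemma ext_der_add:
  assumes "p \<in> polys_over K" "q \<in> polys_over K"
  shows "ext_der w (p + q) = ext_der w p + ext_der w q"
proof -
  have "map_poly D (p + q) = map_poly D p + map_poly D q"
    using assms derivation_onD[OF der] by (intro poly_eqI) (simp add: coeff_map_poly polys_over_def)
  then show ?thesis by (simp add: ext_der_def pderiv_add algebra_simps)
qed

lemma ext_der_mult:
  assumes "p \<in> polys_over K" "q \<in> polys_over K"
  shows "ext_der w (p * q) = ext_der w p * poly q t + poly p t * ext_der w q"
proof -
  have "map_poly D (p * q) = map_poly D p * q + p * map_poly D q"
  proof (rule poly_eqI)
    fix n
    have "D (\<Sum>i\<le>n. coeff p i * coeff q (n - i)) = (\<Sum>i\<le>n. D (coeff p i * coeff q (n - i)))"
      using assms is_subringD[OF sub] by (intro derivation_on_sum[OF der]) (auto simp: polys_over_def)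
    also have "\<dots> = (\<Sum>i\<le>n. D (coeff p i) * coeff q (n - i)) + (\<Sum>i\<le>n. coeff p i * D (coeff q (n - i)))"
      using assms derivation_onD[OF der] by (simp add: polys_over_def sum.distrib)
    finally show "coeff (map_poly D (p * q)) n = coeff (map_poly D p * q + p * map_poly D q) n"
      using derivation_onD[OF der] by (simp add: coeff_map_poly coeff_mult)
  qed
  then show ?thesis by (simp add: ext_der_def pderiv_mult algebra_simps)
qed

lemma ext_der_diff:
  assumes "p \<in> polys_over K" "q \<in> polys_over K"
  shows "ext_der w (p - q) = ext_der w p - ext_der w q"
  using ext_der_add[OF polys_over_closed(2)[OF assms] assms(2), of w] by (simp add: algebra_simps)

text \<open>If \<open>t\<close> is algebraic over \<open>K\<close>, the value at \<open>t\<close> is forced by a polynomial \<open>h\<close> of minimal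
  degree that vanishes at \<open>t\<close>: its derivative does not vanish there, as the characteristic is \<open>0\<close>, and every
  other polynomial relation reduces to \<open>h\<close> by pseudo-division.\<close>

lemma ext_der_compatible:
  assumes "h \<in> polys_over K" "h \<noteq> 0" "poly h t = 0"
  shows "\<exists>w. \<forall>p\<in>polys_over K. poly p t = 0 \<longrightarrow> ext_der w p = 0"
proof -
  define P where "P n \<longleftrightarrow> (\<exists>h\<in>polys_over K. h \<noteq> 0 \<and> poly h t = 0 \<and> degree h = n)" for n
  have "P (LEAST n. P n)"
    by (rule LeastI[of P "degree h"]) (use assms P_def in blast)
  then obtain g where g: "g \<in> polys_over K" "g \<noteq> 0" "poly g t = 0" "degree g = (LEAST n. P n)"
    unfolding P_def by blast
  have min: "q = 0" if "q \<in> polys_over K" "poly q t = 0" "degree q < degree g" for q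
    using that not_less_Least[of "degree q" P] g(4) unfolding P_def by auto
  have "degree g \<noteq> 0"
  proof
    assume "degree g = 0"
    then obtain c where "g = [:c:]" by (rule degree_eq_zeroE)
    then show False using g by simp
  qed
  then have "degree (pderiv g) < degree g" "pderiv g \<noteq> 0"
    by (auto simp: degree_pderiv pderiv_eq_0_iff)
  then have g': "poly (pderiv g) t \<noteq> 0"
    using min[of "pderiv g"] polys_over_closed(4)[OF g(1) g(1)] by blast
  define w where "w = - poly (map_poly D g) t / poly (pderiv g) t"
  have Eg: "ext_der w g = 0" using g' by (simp add: ext_der_def w_def)
  have "ext_der w p = 0" if "p \<in> polys_over K" "poly p t = 0" for p
    using that
  proof (induction "degree p" arbitrary: p rule: less_induct)
    case less
    show ?case
    proof (cases "degree p < degree g")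
      case True
      then have "p = 0" using min less.prems by blast
      then show ?thesis by (simp add: ext_der_def)
    next
      case False
      define c where "c = lead_coeff g"
      define m where "m = monom (lead_coeff p) (degree p - degree g)"
      define q where "q = monom c 0 * p - m * g"
      have K: "monom c 0 \<in> polys_over K" "m \<in> polys_over K"
        using less.prems g polys_over_monom by (auto simp: c_def m_def polys_over_def)
      have q: "q \<in> polys_over K" "poly q t = 0"
        using K less.prems g by (auto simp: q_def polys_over_closed)
      have "degree q < degree p \<or> q = 0"
      proof (cases "p = 0")
        case True
        then show ?thesis by (simp add: q_def m_def)
      next
        case p: False
        have "degree (monom c 0 * p) \<le> degree p"
          using degree_mult_le[of "monom c 0" p] by (simp add: degree_monom_eq monom_0)
        moreover have "degree (m * g) \<le> degree p"
          using degree_mult_le[of m g] degree_monom_le[of "lead_coeff p" "degree p - degree g"] False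
          unfolding m_def by linarith
        ultimately have le: "degree q \<le> degree p" unfolding q_def by (rule degree_diff_le)
        have "coeff (monom c 0 * p) (degree p) = c * lead_coeff p"
          by (simp add: monom_0)
        moreover have "coeff (m * g) (degree p) = lead_coeff p * c"
          using False by (simp add: m_def c_def coeff_monom_mult)
        ultimately have "coeff q (degree p) = 0" by (simp add: q_def)
        with le show ?thesis
          by (metis leading_coeff_0_iff le_neq_implies_less)
      qed
      then have "ext_der w q = 0"
        using less.hyps[of q] q by (auto simp: ext_der_def)
      moreover have "ext_der w q = c * ext_der w p"
        unfolding q_def using less.prems g K Eg
        by (subst ext_der_diff) (auto simp: polys_over_closed ext_der_mult poly_monom)
      ultimately show ?thesis using g(2) by (simp add: c_def)
    qed
  qed
  then show ?thesis by blast
qed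

text \<open>If \<open>t\<close> is transcendental over \<open>K\<close>, there is no relation to respect and its image \<open>w0\<close> is free; otherwise
  it is forced. In both cases the extension is well defined, as \<open>ext_der\<close> kills every polynomial over \<open>K\<close> that vanishes
  at \<open>t\<close>.\<close>

lemma derivation_extend:
  shows "\<exists>K' D'. derivation_on K' D' \<and> K \<subseteq> K' \<and> t \<in> K' \<and> (\<forall>x\<in>K. D' x = D x) \<and>
    ((\<forall>p\<in>polys_over K. poly p t = 0 \<longrightarrow> p = 0) \<longrightarrow> D' t = w0)"
proof -
  obtain w where w: "\<And>p. p \<in> polys_over K \<Longrightarrow> poly p t = 0 \<Longrightarrow> ext_der w p = 0"
    and w0: "(\<forall>p\<in>polys_over K. poly p t = 0 \<longrightarrow> p = 0) \<Longrightarrow> w = w0"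
  proof (cases "\<forall>p\<in>polys_over K. poly p t = 0 \<longrightarrow> p = 0")
    case True
    then have "ext_der w0 p = 0" if "p \<in> polys_over K" "poly p t = 0" for p
      using that by (auto simp: ext_der_def)
    then show ?thesis using that by blast
  next
    case False
    then show ?thesis using ext_der_compatible that by metis
  qed
  define K' where "K' = (\<lambda>p. poly p t) ` polys_over K"
  define D' where "D' y = ext_der w (SOME p. p \<in> polys_over K \<and> poly p t = y)" for y
  have D': "D' (poly p t) = ext_der w p" if "p \<in> polys_over K" for p
  proof -
    define q where "q = (SOME q. q \<in> polys_over K \<and> poly q t = poly p t)"
    have q: "q \<in> polys_over K" "poly q t = poly p t"
      using someI[of "\<lambda>q. q \<in> polys_over K \<and> poly q t = poly p t" p] that by (auto simp: q_def)
    then have "ext_der w (q - p) = 0"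
      using that by (intro w) (auto simp: polys_over_closed)
    then show ?thesis using q that by (simp add: ext_der_diff D'_def q_def)
  qed
  have const: "[:c:] \<in> polys_over K" if "c \<in> K" for c
    using polys_over_monom[OF that, of 0] by (simp add: monom_0)
  have X: "[:0, 1:] \<in> polys_over K"
    using polys_over_monom[of 1 1] is_subringD(1)[OF sub] by (simp add: monom_altdef)
  have one: "1 \<in> polys_over K" using const[of 1] is_subringD(1)[OF sub] by (simp add: one_pCons)
  have "derivation_on K' D'"
    unfolding derivation_on_def is_subring_def
  proof (intro conjI ballI)
    show "1 \<in> K'" unfolding K'_def using one by (intro image_eqI[of _ _ 1]) auto
  next
    fix x assume "x \<in> K'"
    then obtain p where p: "x = poly p t" "p \<in> polys_over K" unfolding K'_def by blast
    have "0 - p \<in> polys_over K"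
      by (rule polys_over_closed) (use p const[of 0] is_subringD(2)[OF sub] in auto)
    then show "- x \<in> K'" unfolding K'_def using p by (intro image_eqI[of _ _ "0 - p"]) auto
  next
    fix x y assume "x \<in> K'" "y \<in> K'"
    then obtain p q where p: "x = poly p t" "p \<in> polys_over K" and q: "y = poly q t" "q \<in> polys_over K"
      unfolding K'_def by blast
    show "x + y \<in> K'" "x * y \<in> K'" unfolding K'_def using p q polys_over_closed
      by (metis image_eqI poly_add, metis image_eqI poly_mult)
    show "D' (x + y) = D' x + D' y"
      using D'[of "p + q"] D'[of p] D'[of q] p q by (simp add: polys_over_closed ext_der_add)
    show "D' (x * y) = D' x * y + x * D' y"
      using D'[of "p * q"] D'[of p] D'[of q] p q by (simp add: polys_over_closed ext_der_mult)
  qed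
  moreover have "x \<in> K' \<and> D' x = D x" if "x \<in> K" for x
  proof -
    have "D' x = D x"
      using D'[OF const[OF that]] derivation_onD[OF der] by (simp add: ext_der_def map_poly_pCons)
    moreover have "x \<in> K'" unfolding K'_def using const[OF that] by (intro image_eqI[of _ _ "[:x:]"]) auto
    ultimately show ?thesis by simp
  qed
  moreover have "t \<in> K'" unfolding K'_def using X by (intro image_eqI[of _ _ "[:0, 1:]"]) auto
  moreover have "D' t = w"
    using D'[OF X] derivation_onD[OF der] by (simp add: ext_der_def map_poly_pCons pderiv_pCons)
  ultimately show ?thesis using w0 by blast
qed

end

lemma derivation_extend_finite:
  fixes K :: "'a::field_char_0 set"
  assumes "finite T" "derivation_on K D"
  shows "\<exists>K' D'. derivation_on K' D' \<and> K \<subseteq> K' \<and> T \<subseteq> K' \<and> (\<forall>x\<in>K. D' x = D x)"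
  using assms
proof (induction T rule: finite_induct)
  case (insert t T)
  then obtain K1 D1 where 1: "derivation_on K1 D1" "K \<subseteq> K1" "T \<subseteq> K1" "\<forall>x\<in>K. D1 x = D x" by blast
  obtain K2 D2 where "derivation_on K2 D2" "K1 \<subseteq> K2" "t \<in> K2" "\<forall>x\<in>K1. D2 x = D1 x"
    using derivation_extend[OF 1(1), of t] by blast
  with 1 show ?case by (intro exI[of _ K2] exI[of _ D2]) auto
qed blast

section \<open>An ultrapower of the complex numbers\<close>

definition ultrafilter :: "'a filter \<Rightarrow> bool" where
  "ultrafilter U \<longleftrightarrow> U \<noteq> bot \<and> (\<forall>P. eventually P U \<or> eventually (\<lambda>x. \<not> P x) U)"

lemma ex_ultrafilter_le:
  fixes F :: "'a filter"
  assumes "F \<noteq> bot"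
  shows "\<exists>U\<le>F. ultrafilter U"
proof -
  define A where "A = {G. G \<noteq> bot \<and> G \<le> F}"
  have "\<exists>m\<in>A. \<forall>a\<in>A. m \<ge> a \<longrightarrow> a = m"
  proof (rule predicate_Zorn)
    show "partial_order_on A (relation_of (\<ge>) A)"
      by (rule partial_order_on_relation_ofI) auto
  next
    fix C assume C: "C \<in> Chains (relation_of (\<ge>) A)"
    have sub: "C \<subseteq> A" and tot: "\<And>a b. a \<in> C \<Longrightarrow> b \<in> C \<Longrightarrow> a \<le> b \<or> b \<le> a"
      using C unfolding Chains_def relation_of_def by blast+
    have min: "\<exists>m\<in>insert F C. \<forall>x\<in>X. m \<le> x" if "finite X" "X \<subseteq> insert F C" for X
      using that
    proof (induction X rule: finite_induct)
      case (insert x X)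
      then obtain m where m: "m \<in> insert F C" "\<forall>x\<in>X. m \<le> x" by blast
      have x: "x \<in> insert F C" using insert.prems by simp
      have le: "c \<le> F" if "c \<in> C" for c using that sub by (auto simp: A_def)
      have "m \<le> x \<or> x \<le> m" using m(1) x
      proof (elim insertE)
        assume "m \<in> C" "x \<in> C" then show ?thesis by (rule tot)
      qed (use le in auto)
      then show ?case
      proof
        assume "m \<le> x" then show ?thesis using m by (intro bexI[of _ m]) auto
      next
        assume "x \<le> m" then show ?thesis using m x by (intro bexI[of _ x]) (auto intro: order.trans)
      qed
    qed blast
    have "Inf (insert F C) \<noteq> bot"
    proof (rule Inf_filter_not_bot)
      fix X assume "X \<subseteq> insert F C" "finite X"
      then obtain m where "m \<in> insert F C" "m \<le> Inf X" using min by (meson Inf_greatest)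
      moreover from this have "m \<noteq> bot" using sub assms by (auto simp: A_def)
      ultimately show "Inf X \<noteq> bot" by (auto simp: bot_unique)
    qed
    then have "Inf (insert F C) \<in> A" unfolding A_def by (simp add: Inf_lower)
    then show "\<exists>u\<in>A. \<forall>a\<in>C. a \<ge> u" by (meson Inf_lower insertI2)
  qed
  then obtain U where U: "U \<in> A" "\<And>G. G \<in> A \<Longrightarrow> G \<le> U \<Longrightarrow> G = U" by blast
  have "eventually P U" if P: "\<not> eventually (\<lambda>x. \<not> P x) U" for P
  proof -
    have "inf U (principal {x. P x}) \<noteq> bot"
      using P by (simp add: trivial_limit_def eventually_inf_principal)
    then have "inf U (principal {x. P x}) = U"
      using U(1) by (intro U(2)) (auto simp: A_def intro: le_infI1)
    moreover have "eventually P (inf U (principal {x. P x}))"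
      by (simp add: eventually_inf_principal)
    ultimately show ?thesis by simp
  qed
  then show ?thesis using U(1) unfolding ultrafilter_def A_def by blast
qed

text \<open>The index set consists of the sets of subsets of \<open>'b\<close>, and the ultrafilter refines the filter
  of large finite sets: every family of subsets of \<open>'b\<close> with the finite intersection property
  then has a generic point, as \<open>generic_family\<close> below makes precise.\<close>

definition large :: "'b set set filter" where
  "large = (SOME U. ultrafilter U \<and> U \<le> finite_subsets_at_top UNIV)"

lemma large: "ultrafilter (large :: 'b set set filter)"
    "(large :: 'b set set filter) \<le> finite_subsets_at_top UNIV"
proof -
  have "\<exists>U :: 'b set set filter. ultrafilter U \<and> U \<le> finite_subsets_at_top UNIV"
    using ex_ultrafilter_le[of "finite_subsets_at_top (UNIV :: 'b set set)"] by auto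
  from someI_ex[OF this] show "ultrafilter (large :: 'b set set filter)"
    "(large :: 'b set set filter) \<le> finite_subsets_at_top UNIV"
    unfolding large_def by auto
qed

lemma large_nonbot: "large \<noteq> bot"
  using large(1) unfolding ultrafilter_def by blast

lemma large_not: "eventually (\<lambda>i. \<not> P i) large \<longleftrightarrow> \<not> eventually P large"
proof -
  have "large \<noteq> bot" using large(1) unfolding ultrafilter_def by blast
  then show ?thesis
    using large(1) eventually_conj[of P large "\<lambda>i. \<not> P i"]
    unfolding ultrafilter_def by (auto simp: trivial_limit_def)
qed

lemma large_finite_disj:
  assumes "finite A" "eventually (\<lambda>i. \<exists>a\<in>A. P a i) large"
  shows "\<exists>a\<in>A. eventually (P a) large"
proof (rule ccontr)
  assume "\<not> ?thesis"
  then have "\<forall>a\<in>A. eventually (\<lambda>i. \<not> P a i) large" by (simp add: large_not)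
  then have "eventually (\<lambda>i. \<forall>a\<in>A. \<not> P a i) large"
    using assms(1) by (simp add: eventually_ball_finite)
  then have "eventually (\<lambda>i. \<not> (\<exists>a\<in>A. P a i)) large" by simp
  then show False using assms(2) unfolding large_not by blast
qed

text \<open>Index the point by a finite set of subsets and choose it in the intersection of those that belong to the
  family.\<close>

lemma generic_family:
  fixes \<S> :: "'b set set"
  assumes "\<And>T. finite T \<Longrightarrow> T \<subseteq> \<S> \<Longrightarrow> \<Inter>T \<noteq> {}"
  shows "\<exists>b :: 'b set set \<Rightarrow> 'b. \<forall>S\<in>\<S>. eventually (\<lambda>i. b i \<in> S) large"
proof (intro exI ballI)
  fix S assume S: "S \<in> \<S>"
  have "eventually (\<lambda>i. finite i \<and> S \<in> i) (finite_subsets_at_top (UNIV :: 'b set set))"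
    unfolding eventually_finite_subsets_at_top by (rule exI[of _ "{S}"]) auto
  then have "eventually (\<lambda>i. finite i \<and> S \<in> i) large"
    using large(2) unfolding le_filter_def by blast
  then show "eventually (\<lambda>i. (SOME x. x \<in> \<Inter>(i \<inter> \<S>)) \<in> S) large"
  proof (rule eventually_mono)
    fix i assume i: "finite i \<and> S \<in> i"
    then have "\<Inter>(i \<inter> \<S>) \<noteq> {}" by (intro assms) auto
    then have "(SOME x. x \<in> \<Inter>(i \<inter> \<S>)) \<in> \<Inter>(i \<inter> \<S>)" by (rule some_in_eq[THEN iffD2])
    then show "(SOME x. x \<in> \<Inter>(i \<inter> \<S>)) \<in> S" using i S by blast
  qed
qed

text \<open>The elements of this field are the coordinates of generic points of subsets of \<open>'b\<close>.\<close>

quotient_type 'b hyper = "'b set set \<Rightarrow> complex" / "\<lambda>f g. eventually (\<lambda>i. f i = g i) large"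
  morphisms rep_hyper hyper
proof (rule equivpI)
  show "reflp (\<lambda>f g :: 'b set set \<Rightarrow> complex. eventually (\<lambda>i. f i = g i) large)"
    by (auto intro!: reflpI)
  show "symp (\<lambda>f g :: 'b set set \<Rightarrow> complex. eventually (\<lambda>i. f i = g i) large)"
    by (auto intro!: sympI simp: eq_commute)
  show "transp (\<lambda>f g :: 'b set set \<Rightarrow> complex. eventually (\<lambda>i. f i = g i) large)"
    by (auto intro!: transpI elim: eventually_elim2)
qed

lemma hyper_eq_iff: "hyper f = hyper g \<longleftrightarrow> eventually (\<lambda>i. f i = g i) large"
  by (rule hyper.abs_eq_iff)

instantiation hyper :: (type) field
begin

lift_definition zero_hyper :: "'a hyper" is "\<lambda>i. 0" .
lift_definition one_hyper :: "'a hyper" is "\<lambda>i. 1" .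
lift_definition plus_hyper :: "'a hyper \<Rightarrow> 'a hyper \<Rightarrow> 'a hyper" is "\<lambda>f g i. f i + g i"
  by (auto elim: eventually_elim2)
lift_definition minus_hyper :: "'a hyper \<Rightarrow> 'a hyper \<Rightarrow> 'a hyper" is "\<lambda>f g i. f i - g i"
  by (auto elim: eventually_elim2)
lift_definition times_hyper :: "'a hyper \<Rightarrow> 'a hyper \<Rightarrow> 'a hyper" is "\<lambda>f g i. f i * g i"
  by (auto elim: eventually_elim2)
lift_definition uminus_hyper :: "'a hyper \<Rightarrow> 'a hyper" is "\<lambda>f i. - f i"
  by (auto elim: eventually_mono)
lift_definition inverse_hyper :: "'a hyper \<Rightarrow> 'a hyper" is "\<lambda>f i. inverse (f i)"
  by (auto elim: eventually_mono)
lift_definition divide_hyper :: "'a hyper \<Rightarrow> 'a hyper \<Rightarrow> 'a hyper" is "\<lambda>f g i. f i / g i"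
  by (auto elim: eventually_elim2)

instance
proof
  fix a b c :: "'a hyper"
  show "a * b * c = a * (b * c)" by transfer (simp add: ac_simps)
  show "a * b = b * a" by transfer (simp add: ac_simps)
  show "1 * a = a" by transfer simp
  show "a + b + c = a + (b + c)" by transfer (simp add: ac_simps)
  show "a + b = b + a" by transfer (simp add: ac_simps)
  show "0 + a = a" by transfer simp
  show "- a + a = 0" by transfer simp
  show "a - b = a + - b" by transfer simp
  show "(a + b) * c = a * c + b * c" by transfer (simp add: algebra_simps)
  show "(0 :: 'a hyper) \<noteq> 1"
    by transfer (simp add: large_nonbot)
  show "a \<noteq> 0 \<Longrightarrow> inverse a * a = 1"
  proof transfer
    fix a :: "'a set set \<Rightarrow> complex"
    assume "\<not> eventually (\<lambda>i. a i = 0) large"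
    then have "eventually (\<lambda>i. a i \<noteq> 0) large" by (simp add: large_not)
    then show "eventually (\<lambda>i. inverse (a i) * a i = 1) large" by (rule eventually_mono) simp
  qed
  show "a div b = a * inverse b" by transfer (simp add: divide_inverse)
  show "inverse (0 :: 'a hyper) = 0" by transfer simp
qed

end

lemma hyper_arith:
  "hyper f + hyper g = hyper (\<lambda>i. f i + g i)"
  "hyper f * hyper g = hyper (\<lambda>i. f i * g i)"
  "0 = hyper (\<lambda>i. 0)" "1 = hyper (\<lambda>i. 1)"
  by (transfer, simp)+

lemma hyper_of_nat: "of_nat n = hyper (\<lambda>i. of_nat n)"
  by (induction n) (simp_all add: hyper_arith)

instance hyper :: (type) field_char_0
proof
  show "inj (of_nat :: nat \<Rightarrow> 'a hyper)"
    by (simp add: inj_def hyper_of_nat hyper_eq_iff large_nonbot)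
qed

lemma hyper_sum: "(\<Sum>a\<in>A. hyper (f a)) = hyper (\<lambda>i. \<Sum>a\<in>A. f a i)"
  by (induction A rule: infinite_finite_induct) (simp_all add: hyper_arith)

section \<open>The Jacobian criterion for algebraic dependence\<close>

lemma hyper_power: "hyper f ^ n = hyper (\<lambda>i. f i ^ n)"
  by (induction n) (simp_all add: hyper_arith)

text \<open>Suppose that the functions \<open>h k\<close> satisfy no polynomial relation on \<open>B\<close>. The sets where a given nonzero
  polynomial in them does not vanish then have the finite intersection property, so \<open>B\<close> has a generic point, with
  coordinates in the ultrapower, at which the \<open>h k\<close> are algebraically independent over the complex numbers. The pointwise
  dependence of the differentials passes to the ultrapower, with some coefficient \<open>l k0\<close> different from
  zero. By independence there is a derivation that kills the constants and every \<open>h k\<close> with \<open>k \<noteq> k0\<close>, but maps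
  \<open>h k0\<close> to \<open>1\<close>. It kills the equations \<open>G e\<close>, so the dependence says \<open>l k0 = 0\<close>.\<close>

lemma algebraic_dependence:
  fixes B :: "('m::finite \<Rightarrow> complex) set" and I :: "'k set" and R :: "'r set"
  assumes fin: "finite I"
    and h: "\<And>k. k \<in> I \<Longrightarrow> has_grad (h k) (dh k)"
    and G: "\<And>e. e \<in> R \<Longrightarrow> has_grad (G e) (dG e)"
    and G0: "\<And>e b. e \<in> R \<Longrightarrow> b \<in> B \<Longrightarrow> G e b = 0"
    and dep: "\<And>b. b \<in> B \<Longrightarrow> \<exists>l m. (\<exists>k\<in>I. l k \<noteq> 0) \<and>
      (\<forall>v. (\<Sum>k\<in>I. l k * dh k v b) = (\<Sum>e\<in>R. m e * dG e v b))"
  shows "\<exists>F. polyfun I F \<and> (\<exists>y. F y \<noteq> 0) \<and> (\<forall>b\<in>B. F (\<lambda>k. h k b) = 0)"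
proof (rule ccontr)
  assume contra: "\<not> ?thesis"
  define S where "S F = {b\<in>B. F (\<lambda>k. h k b) \<noteq> 0}" for F :: "('k \<Rightarrow> complex) \<Rightarrow> complex"
  define \<S> where "\<S> = {S F | F. polyfun I F \<and> (\<exists>y. F y \<noteq> 0)}"
  have FIP: "\<exists>F. polyfun I F \<and> (\<exists>y. F y \<noteq> 0) \<and> S F \<subseteq> \<Inter>T" if "finite T" "T \<subseteq> \<S>" for T
    using that
  proof (induction T rule: finite_induct)
    case empty
    show ?case by (rule exI[of _ "\<lambda>y. 1"]) (auto intro: polyfun_const)
  next
    case (insert A T)
    then obtain F y where F: "polyfun I F" "F y \<noteq> 0" "S F \<subseteq> \<Inter>T" by auto
    obtain E x where E: "polyfun I E" "E x \<noteq> 0" "A = S E" using insert.prems unfolding \<S>_def by auto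
    have "\<exists>z. E z * F z \<noteq> 0" 
      using polyfun_mult_nonzero[of I E I F x y] E F by blast
    moreover have "polyfun I (\<lambda>y. E y * F y)" by (rule polyfun_mult[OF E(1) F(1)])
    moreover have "S (\<lambda>y. E y * F y) \<subseteq> \<Inter>(insert A T)"
      using E(3) F(3) unfolding S_def by auto
    ultimately show ?case by blast
  qed
  have "\<Inter>T \<noteq> {}" if T: "finite T" "T \<subseteq> \<S>" for T
  proof -
    obtain F where F: "polyfun I F" "\<exists>y. F y \<noteq> 0" "S F \<subseteq> \<Inter>T" using FIP[OF T] by blast
    moreover have "S F \<noteq> {}" using contra F unfolding S_def by auto
    ultimately show ?thesis by blast
  qed
  then have "\<exists>b :: ('m \<Rightarrow> complex) set set \<Rightarrow> 'm \<Rightarrow> complex. \<forall>A\<in>\<S>. eventually (\<lambda>i. b i \<in> A) large"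
    by (intro generic_family)
  then obtain b :: "('m \<Rightarrow> complex) set set \<Rightarrow> 'm \<Rightarrow> complex"
    where gen: "\<forall>A\<in>\<S>. eventually (\<lambda>i. b i \<in> A) large" ..
  have b: "eventually (\<lambda>i. b i \<in> B \<and> F (\<lambda>k. h k (b i)) \<noteq> 0) large"
    if "polyfun I F" "F y \<noteq> 0" for F y
  proof -
    have "S F \<in> \<S>" unfolding \<S>_def
      by (intro CollectI exI[of _ F] conjI refl that(1) exI[of _ y] that(2))
    with gen have "eventually (\<lambda>i. b i \<in> S F) large" ..
    then show ?thesis unfolding S_def by simp
  qed
  have bB: "eventually (\<lambda>i. b i \<in> B) large"
  proof -
    have "eventually (\<lambda>i. b i \<in> B \<and> (1::complex) \<noteq> 0) large"
      using b[of "\<lambda>y. 1", OF polyfun_const] by simp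
    then show ?thesis by simp
  qed
  \<comment> \<open>The value of a function at the generic point.\<close>
  define H where "H f = hyper (\<lambda>i. f (b i))" for f :: "('m \<Rightarrow> complex) \<Rightarrow> complex"
  have H_add: "H (\<lambda>x. f x + g x) = H f + H g" and H_mult: "H (\<lambda>x. f x * g x) = H f * H g" for f g
    by (simp_all add: H_def hyper_arith)
  define l m where "l i = (SOME l. \<exists>m. (\<exists>k\<in>I. l k \<noteq> 0) \<and>
      (\<forall>v. (\<Sum>k\<in>I. l k * dh k v (b i)) = (\<Sum>e\<in>R. m e * dG e v (b i))))"
    and "m i = (SOME m. (\<forall>v. (\<Sum>k\<in>I. l i k * dh k v (b i)) = (\<Sum>e\<in>R. m e * dG e v (b i))))" for i
  have lm: "(\<exists>k\<in>I. l i k \<noteq> 0) \<and> (\<forall>v. (\<Sum>k\<in>I. l i k * dh k v (b i)) = (\<Sum>e\<in>R. m i e * dG e v (b i)))"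
    if "b i \<in> B" for i
  proof -
    have *: "\<exists>m. (\<exists>k\<in>I. l i k \<noteq> 0) \<and>
      (\<forall>v. (\<Sum>k\<in>I. l i k * dh k v (b i)) = (\<Sum>e\<in>R. m e * dG e v (b i)))"
      unfolding l_def by (rule someI_ex[OF dep[OF that]])
    then have "\<exists>m. \<forall>v. (\<Sum>k\<in>I. l i k * dh k v (b i)) = (\<Sum>e\<in>R. m e * dG e v (b i))" by blast
    from someI_ex[OF this] * show ?thesis unfolding m_def by blast
  qed
  have "eventually (\<lambda>i. \<exists>k\<in>I. l i k \<noteq> 0) large"
    using bB by (rule eventually_mono) (use lm in blast)
  from large_finite_disj[OF fin this] obtain k0 where k0: "k0 \<in> I" "eventually (\<lambda>i. l i k0 \<noteq> 0) large"
    by blast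
  have rel: "(\<Sum>k\<in>I. hyper (\<lambda>i. l i k) * H (dh k v)) = (\<Sum>e\<in>R. hyper (\<lambda>i. m i e) * H (dG e v))" for v
    unfolding H_def hyper_arith hyper_sum hyper_eq_iff
    using bB by (rule eventually_mono) (use lm in blast)
  have l0: "hyper (\<lambda>i. l i k0) \<noteq> 0"
    using k0(2) by (simp add: hyper_arith(3) hyper_eq_iff large_not)
  have HG: "H (G e) = 0" if "e \<in> R" for e
    unfolding H_def hyper_arith(3) hyper_eq_iff
    using bB by (rule eventually_mono) (use G0 that in blast)

  \<comment> \<open>The ring over which \<open>h k0\<close> is transcendental; the derivation vanishes on it.\<close>
  define K where "K = {H (\<lambda>x. F (\<lambda>k. h k x)) | F. polyfun (I - {k0}) F}"
  have K: "H (\<lambda>x. F (\<lambda>k. h k x)) \<in> K" if "polyfun (I - {k0}) F" for F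
    using that unfolding K_def by blast
  have const: "H (\<lambda>x. c) \<in> K" for c
    using K[OF polyfun_const] by simp
  have "is_subring K"
    unfolding is_subring_def
  proof (intro conjI ballI)
    show "1 \<in> K" using const[of 1] by (simp add: H_def hyper_arith)
  next
    fix x y assume "x \<in> K" "y \<in> K"
    then obtain F E where F: "polyfun (I - {k0}) F" "x = H (\<lambda>x. F (\<lambda>k. h k x))"
      and E: "polyfun (I - {k0}) E" "y = H (\<lambda>x. E (\<lambda>k. h k x))" unfolding K_def by blast
    show "x + y \<in> K" using K[OF polyfun_add[OF F(1) E(1)]] F E by (simp add: H_add)
    show "x * y \<in> K" using K[OF polyfun_mult[OF F(1) E(1)]] F E by (simp add: H_mult)
  next
    fix x assume "x \<in> K"
    then obtain F where F: "polyfun (I - {k0}) F" "x = H (\<lambda>x. F (\<lambda>k. h k x))" unfolding K_def by blast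
    have "- x = H (\<lambda>x. - F (\<lambda>k. h k x))"
      using F(2) H_add[of "\<lambda>x. F (\<lambda>k. h k x)" "\<lambda>x. - F (\<lambda>k. h k x)"]
      by (simp add: H_def hyper_arith(3)[symmetric] eq_neg_iff_add_eq_0 neg_eq_iff_add_eq_0)
    then show "- x \<in> K" using K[OF polyfun_uminus[OF F(1)]] by simp
  qed
  then have der0: "derivation_on K (\<lambda>x. 0)" by (simp add: derivation_on_def)
  have trans: "p = 0" if p: "p \<in> polys_over K" "poly p (H (h k0)) = 0" for p
  proof -
    have "\<exists>F. polyfun (I - {k0}) F \<and> coeff p j = H (\<lambda>x. F (\<lambda>k. h k x))" for j
      using p(1) unfolding polys_over_def K_def by blast
    then obtain F where F: "\<And>j. polyfun (I - {k0}) (F j)" "\<And>j. coeff p j = H (\<lambda>x. F j (\<lambda>k. h k x))"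
      by metis
    define Q where "Q y = (\<Sum>j\<le>degree p. F j y * y k0 ^ j)" for y
    have "polyfun I Q" unfolding Q_def using k0(1)
      by (intro polyfun_sum polyfun_mult polyfun_power polyfun_var polyfun_mono[OF F(1)]) auto
    moreover have "H (\<lambda>x. Q (\<lambda>k. h k x)) = 0"
      using p(2) by (simp add: poly_altdef F(2) Q_def H_def hyper_arith hyper_sum hyper_power)
    ultimately have Q0: "Q y = 0" for y
    proof -
      assume Q: "polyfun I Q" and "H (\<lambda>x. Q (\<lambda>k. h k x)) = 0"
      then have "eventually (\<lambda>i. Q (\<lambda>k. h k (b i)) = 0) large"
        by (simp add: H_def hyper_arith(3) hyper_eq_iff)
      then have "\<not> eventually (\<lambda>i. Q (\<lambda>k. h k (b i)) \<noteq> 0) large"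
        by (simp add: large_not)
      then have "\<not> eventually (\<lambda>i. b i \<in> B \<and> Q (\<lambda>k. h k (b i)) \<noteq> 0) large"
        by (simp add: eventually_conj_iff)
      then show "Q y = 0" using b[OF Q, of y] by blast
    qed
    have "F j y = 0" if "j \<le> degree p" for j y
    proof -
      have "poly (\<Sum>j\<le>degree p. monom (F j y) j) s = Q (y(k0 := s))" for s
        unfolding Q_def poly_sum poly_monom
        by (intro sum.cong refl arg_cong2[where f = "(*)"] polyfun_cong[OF F(1)]) auto
      then have "(\<Sum>j\<le>degree p. monom (F j y) j) = 0"
        using Q0 poly_all_0_iff_0 by metis
      then have "coeff (\<Sum>j\<le>degree p. monom (F j y) j) j = 0" by simp
      then show ?thesis using that by (simp add: coeff_sum coeff_monom if_distrib cong: if_cong)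
    qed
    then have "coeff p j = 0" if "j \<le> degree p" for j
      using that by (simp add: F(2) H_def hyper_arith(3))
    then show ?thesis using leading_coeff_0_iff by blast
  qed
  obtain K1 D1 where 1: "derivation_on K1 D1" "K \<subseteq> K1" "H (h k0) \<in> K1" "\<forall>x\<in>K. D1 x = 0" "D1 (H (h k0)) = 1"
    using derivation_extend[OF der0, of "H (h k0)" 1] trans by blast
  obtain K2 D where 2: "derivation_on K2 D" "K1 \<subseteq> K2" "range (\<lambda>v. H (\<lambda>x. x v)) \<subseteq> K2"
      "\<forall>x\<in>K1. D x = D1 x"
    using derivation_extend_finite[OF _ 1(1), of "range (\<lambda>v. H (\<lambda>x. x v))"] by auto
  note D = derivation_onD[OF 2(1)]
  have D_K: "D x = 0" if "x \<in> K" for x using 1 2 that by auto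
  \<comment> \<open>The chain rule for the derivation \<open>D\<close>.\<close>
  have grad: "H F \<in> K2 \<and> D (H F) = (\<Sum>v\<in>UNIV. H (F' v) * D (H (\<lambda>x. x v)))" if "has_grad F F'" for F F'
    using that
  proof (induction rule: has_grad.induct)
    case (has_grad_const c)
    have "H (\<lambda>x. 0) = 0" by (simp add: H_def hyper_arith)
    then show ?case using const[of c] D_K 1(2) 2(2) by auto
  next
    case (has_grad_var w)
    have "H (\<lambda>x. if v = w then 1 else 0) = (if v = w then 1 else 0)" for v
      by (simp add: H_def hyper_arith)
    then have "(\<Sum>v\<in>UNIV. H (\<lambda>x. if v = w then 1 else 0) * D (H (\<lambda>x. x v))) = D (H (\<lambda>x. x w))"
      by (simp add: if_distrib[of "\<lambda>a. a * _"] cong: if_cong)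
    then show ?case using 2(3) by auto
  next
    case (has_grad_add F F' G G')
    then show ?case using D
      by (auto simp: H_add is_subringD[OF D(1)] sum.distrib algebra_simps)
  next
    case (has_grad_mult F F' G G')
    then show ?case using D
      by (auto simp: H_add H_mult is_subringD[OF D(1)] sum.distrib algebra_simps sum_distrib_left)
  qed
  have Dh: "D (H (h k)) = (if k = k0 then 1 else 0)" if "k \<in> I" for k
  proof (cases "k = k0")
    case True
    then show ?thesis using 1 2 by simp
  next
    case False
    then show ?thesis using D_K[OF K[OF polyfun_var[of k]]] that by simp
  qed
  have "(\<Sum>v\<in>UNIV. (\<Sum>k\<in>I. hyper (\<lambda>i. l i k) * H (dh k v)) * D (H (\<lambda>x. x v)))
      = (\<Sum>k\<in>I. hyper (\<lambda>i. l i k) * D (H (h k)))"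
    using grad[OF h] by (subst sum_distrib_right, subst sum.swap) (simp add: sum_distrib_left mult.assoc)
  also have "\<dots> = hyper (\<lambda>i. l i k0)"
    using fin k0(1) by (simp add: Dh if_distrib[of "\<lambda>a. _ * a"] cong: if_cong)
  finally have "hyper (\<lambda>i. l i k0) = (\<Sum>v\<in>UNIV. (\<Sum>e\<in>R. hyper (\<lambda>i. m i e) * H (dG e v)) * D (H (\<lambda>x. x v)))"
    by (simp add: rel)
  also have "\<dots> = (\<Sum>e\<in>R. hyper (\<lambda>i. m i e) * D (H (G e)))"
    using grad[OF G] by (subst sum_distrib_right, subst sum.swap) (simp add: sum_distrib_left mult.assoc)
  also have "\<dots> = 0" using HG D by simp
  finally show False using l0 by simp
qed

section \<open>Linear functionals and their common kernel\<close>

definition pairing :: "'a::comm_ring_1 ^ 'v::finite \<Rightarrow> 'a ^ 'v \<Rightarrow> 'a" where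
  "pairing a u = (\<Sum>v\<in>UNIV. a $ v * u $ v)"

text \<open>Independence of indexed families rules out repeated members, which the independence of their set of values
  would allow.\<close>

definition indep_fam :: "'r set \<Rightarrow> ('r \<Rightarrow> 'a::comm_ring_1 ^ 'v) \<Rightarrow> bool" where
  "indep_fam R a \<longleftrightarrow> (\<forall>c. (\<forall>v. (\<Sum>e\<in>R. c e * a e $ v) = 0) \<longrightarrow> (\<forall>e\<in>R. c e = 0))"

lemma pairing_simps [simp]:
  "pairing a (u + w) = pairing a u + pairing a w" "pairing a (u - w) = pairing a u - pairing a w"
  "pairing a (c *s u) = c * pairing a u" "pairing a 0 = 0"
  "pairing (c *s a) u = c * pairing a u" "pairing (a + b) u = pairing a u + pairing b u"
  "pairing (a - b) u = pairing a u - pairing b u"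
  by (simp_all add: pairing_def algebra_simps sum.distrib sum_subtractf sum_distrib_left)

lemma pairing_sum [simp]: "pairing a (\<Sum>i\<in>A. u i) = (\<Sum>i\<in>A. pairing a (u i))"
  by (induction A rule: infinite_finite_induct) simp_all

lemma indep_fam_independent:
  fixes a :: "'r \<Rightarrow> 'a::field ^ 'v::finite"
  assumes "finite R" "indep_fam R a"
  shows "inj_on a R" "vec.independent (a ` R)"
proof -
  show inj: "inj_on a R"
  proof (rule inj_onI, rule ccontr)
    fix e f assume ef: "e \<in> R" "f \<in> R" "a e = a f" "e \<noteq> f"
    define c where "c x = (if x = e then 1 else if x = f then -1 else 0 :: 'a)" for x
    have "(\<Sum>x\<in>R. c x * a x $ v) = 0" for v
    proof -
      have "(\<Sum>x\<in>R. c x * a x $ v) = (\<Sum>x\<in>{e, f}. c x * a x $ v)"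
        using assms(1) ef by (intro sum.mono_neutral_right) (auto simp: c_def)
      then show ?thesis using ef by (simp add: c_def)
    qed
    then have "c e = 0" using assms(2) ef unfolding indep_fam_def by blast
    then show False by (simp add: c_def)
  qed
  show "vec.independent (a ` R)"
  proof (subst vec.independent_explicit_finite_subsets, intro allI impI ballI)
    fix A u x
    assume A: "A \<subseteq> a ` R" "finite A" "(\<Sum>v\<in>A. u v *s v) = 0" "x \<in> A"
    define c where "c e = (if a e \<in> A then u (a e) else 0)" for e
    have "(\<Sum>e\<in>R. c e * a e $ v) = 0" for v
    proof -
      have "(\<Sum>e\<in>R. c e * a e $ v) = (\<Sum>y\<in>a ` R. (if y \<in> A then u y else 0) * y $ v)"
        by (subst sum.reindex[OF inj]) (simp add: c_def)
      also have "\<dots> = (\<Sum>y\<in>A. (if y \<in> A then u y else 0) * y $ v)"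
        using A assms(1) by (intro sum.mono_neutral_right) auto
      also have "\<dots> = (\<Sum>y\<in>A. u y *s y) $ v"
        by simp
      finally show ?thesis using A(3) by simp
    qed
    then have "\<forall>e\<in>R. c e = 0" using assms(2) unfolding indep_fam_def by blast
    moreover obtain e where "e \<in> R" "x = a e" using A by blast
    ultimately show "u x = 0" using A(4) by (force simp: c_def)
  qed
qed

lemma indep_fam_dual:
  fixes a :: "'r \<Rightarrow> 'a::field ^ 'v::finite"
  assumes "finite R" "indep_fam R a"
  shows "\<exists>s. \<forall>e\<in>R. \<forall>f\<in>R. pairing (a e) (s f) = (if e = f then 1 else 0)"
proof -
  have "\<exists>s. \<forall>e\<in>R. pairing (a e) s = (if e = f then 1 else 0)" if f: "f \<in> R" for f
  proof -
    have "\<exists>g :: 'a ^ 'v \<Rightarrow> 'a ^ 'v. Vector_Spaces.linear (*s) (*s) g \<and>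
      (\<forall>x\<in>a ` R. g x = (if x = a f then 1 else 0))"
      by (rule vec.linear_independent_extend[OF indep_fam_independent(2)[OF assms]])
    then obtain g :: "'a ^ 'v \<Rightarrow> 'a ^ 'v" where g: "Vector_Spaces.linear (*s) (*s) g"
      "\<forall>x\<in>a ` R. g x = (if x = a f then 1 else 0)" by auto
    interpret g: Vector_Spaces.linear "(*s)" "(*s)" g by fact
    define k :: 'v where "k = undefined"
    have gsum: "g x = (\<Sum>v\<in>UNIV. x $ v *s g (axis v 1))" for x
    proof -
      have "g x = g (\<Sum>v\<in>UNIV. x $ v *s axis v 1)" by (simp only: basis_expansion)
      also have "\<dots> = (\<Sum>v\<in>UNIV. x $ v *s g (axis v 1))" by (simp only: g.sum g.scale)
      finally show ?thesis .
    qed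
    have gx: "g x $ k = pairing x (\<chi> v. g (axis v 1) $ k)" for x
      by (subst gsum) (simp add: pairing_def)
    have "pairing (a e) (\<chi> v. g (axis v 1) $ k) = (if e = f then 1 else 0)" if "e \<in> R" for e
      using g(2) that f inj_onD[OF indep_fam_independent(1)[OF assms], of e f]
      by (auto simp: gx[symmetric])
    then show ?thesis by blast
  qed
  then show ?thesis by metis
qed

lemma subspace_kernel: "vec.subspace {u. \<forall>e\<in>R. pairing (a e) u = 0}"
  for a :: "'r \<Rightarrow> 'a::field ^ 'v::finite"
  by (auto simp: vec.subspace_def)

text \<open>The span of a dual family is a complement of the common kernel.\<close>

lemma dim_kernel:
  fixes a :: "'r \<Rightarrow> 'a::field ^ 'v::finite"
  assumes "finite R" "indep_fam R a"
  shows "vec.dim {u. \<forall>e\<in>R. pairing (a e) u = 0} + card R = CARD('v)"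
proof -
  obtain s where s: "\<And>e f. e \<in> R \<Longrightarrow> f \<in> R \<Longrightarrow> pairing (a e) (s f) = (if e = f then 1 else 0)"
    using indep_fam_dual[OF assms] by blast
  let ?T = "{u. \<forall>e\<in>R. pairing (a e) u = 0}"
  have coord: "pairing (a e) (\<Sum>f\<in>R. c f *s s f) = c e" if "e \<in> R" for c e
    using that assms(1) by (simp add: s if_distrib cong: if_cong)
  have "indep_fam R s"
    unfolding indep_fam_def
  proof (intro allI impI ballI)
    fix c e assume c: "\<forall>v. (\<Sum>e\<in>R. c e * s e $ v) = 0" and e: "e \<in> R"
    then have "(\<Sum>f\<in>R. c f *s s f) = 0" by (simp add: vec_eq_iff)
    then show "c e = 0" using coord[OF e, of c] by simp
  qed
  then have ind: "inj_on s R" "vec.independent (s ` R)"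
    using indep_fam_independent[OF assms(1)] by blast+
  have span: "vec.span (s ` R) = {\<Sum>f\<in>R. c f *s s f |c. True}"
  proof -
    have "vec.span (s ` R) = range (\<lambda>u. \<Sum>v\<in>s ` R. u v *s v)"
      using assms(1) by (simp add: vec.span_finite)
    also have "\<dots> = {\<Sum>f\<in>R. c f *s s f |c. True}"
    proof (intro equalityI subsetI)
      fix x assume "x \<in> range (\<lambda>u. \<Sum>v\<in>s ` R. u v *s v)"
      then obtain u where "x = (\<Sum>v\<in>s ` R. u v *s v)" by blast
      then have "x = (\<Sum>f\<in>R. u (s f) *s s f)" by (simp add: sum.reindex[OF ind(1)])
      then show "x \<in> {\<Sum>f\<in>R. c f *s s f |c. True}"
        by (intro CollectI exI[of _ "\<lambda>f. u (s f)"]) simp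
    next
      fix x assume "x \<in> {\<Sum>f\<in>R. c f *s s f |c. True}"
      then obtain c where "x = (\<Sum>f\<in>R. c f *s s f)" by blast
      then have "x = (\<Sum>v\<in>s ` R. c (the_inv_into R s v) *s v)"
        by (simp add: sum.reindex[OF ind(1)] the_inv_into_f_f[OF ind(1)])
      then show "x \<in> range (\<lambda>u. \<Sum>v\<in>s ` R. u v *s v)" by (intro image_eqI) auto
    qed
    finally show ?thesis .
  qed
  have "?T \<inter> vec.span (s ` R) = {0}"
  proof (intro equalityI subsetI)
    fix x assume "x \<in> ?T \<inter> vec.span (s ` R)"
    then obtain c where x: "x = (\<Sum>f\<in>R. c f *s s f)" "\<forall>e\<in>R. pairing (a e) x = 0"
      unfolding span by blast
    have "c e = 0" if "e \<in> R" for e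
      using x(2) that unfolding x(1) by (metis coord)
    then show "x \<in> {0}" using x(1) by simp
  next
    fix x :: "'a ^ 'v" assume "x \<in> {0}"
    then show "x \<in> ?T \<inter> vec.span (s ` R)" using vec.span_zero by simp
  qed
  moreover have "{x + y |x y. x \<in> ?T \<and> y \<in> vec.span (s ` R)} = UNIV"
  proof -
    have "\<exists>x y. u = x + y \<and> x \<in> ?T \<and> y \<in> vec.span (s ` R)" for u
      unfolding span
      by (intro exI[of _ "u - (\<Sum>f\<in>R. pairing (a f) u *s s f)"]
          exI[of _ "\<Sum>f\<in>R. pairing (a f) u *s s f"]) (auto simp: coord simp del: pairing_sum)
    then show ?thesis by blast
  qed
  ultimately have "CARD('v) + 0 = vec.dim ?T + vec.dim (vec.span (s ` R))"
    using vec.dim_sums_Int[OF subspace_kernel[of R a] vec.subspace_span[of "s ` R"]]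
    by (simp add: vec_dim_card vec.dim_singleton card_cart_basis)
  moreover have "vec.dim (vec.span (s ` R)) = card R"
    using vec.dim_span_eq_card_independent[OF ind(2)] card_image[OF ind(1)] by simp
  ultimately show ?thesis by simp
qed

lemma card_indep_fam_le:
  fixes a :: "'r \<Rightarrow> 'a::field ^ 'v::finite"
  shows "finite R \<Longrightarrow> indep_fam R a \<Longrightarrow> card R \<le> CARD('v)"
  using dim_kernel[of R a] by simp

text \<open>In this form, a count of dimensions provides the hypothesis of \<open>algebraic_dependence\<close>.\<close>

lemma dependent_modulo:
  fixes a :: "'r \<Rightarrow> 'a::field ^ 'v::finite" and h :: "'k \<Rightarrow> 'a ^ 'v"
  assumes "finite R" "finite I" "indep_fam R a" "card I + card R > CARD('v)"
  shows "\<exists>l m. (\<exists>k\<in>I. l k \<noteq> 0) \<and> (\<forall>v. (\<Sum>k\<in>I. l k * h k $ v) = (\<Sum>e\<in>R. m e * a e $ v))"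
proof -
  have "card (I <+> R) = card I + card R" using assms by (simp add: card_Plus)
  then have "\<not> indep_fam (I <+> R) (case_sum h a)"
    using card_indep_fam_le[of "I <+> R" "case_sum h a"] assms by auto
  then obtain c x where c: "\<And>v. (\<Sum>x\<in>I <+> R. c x * case_sum h a x $ v) = 0" "x \<in> I <+> R" "c x \<noteq> 0"
    unfolding indep_fam_def by blast
  have split: "(\<Sum>k\<in>I. c (Inl k) * h k $ v) + (\<Sum>e\<in>R. c (Inr e) * a e $ v) = 0" for v
    using c(1)[of v] assms by (simp add: sum.Plus)
  have "\<exists>k\<in>I. c (Inl k) \<noteq> 0"
  proof (rule ccontr)
    assume *: "\<not> ?thesis"
    then have "(\<Sum>k\<in>I. c (Inl k) * h k $ v) = 0" for v by (intro sum.neutral) auto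
    then have "\<forall>v. (\<Sum>e\<in>R. c (Inr e) * a e $ v) = 0" using split by simp
    then have "\<forall>e\<in>R. c (Inr e) = 0"
      using assms(3)[unfolded indep_fam_def, rule_format, of "\<lambda>e. c (Inr e)"] by blast
    then show False using * c by auto
  qed
  moreover have "(\<Sum>k\<in>I. c (Inl k) * h k $ v) = (\<Sum>e\<in>R. - c (Inr e) * a e $ v)" for v
    using split[of v] by (simp add: sum_negf eq_neg_iff_add_eq_0)
  ultimately show ?thesis by (intro exI[of _ "\<lambda>k. c (Inl k)"] exI[of _ "\<lambda>e. - c (Inr e)"]) auto
qed

section \<open>Zariski closed sets\<close>

lemma proj_closed_iff:
  "proj_closed Z \<longleftrightarrow> (\<exists>\<F> :: ((('v::finite \<Rightarrow> complex) \<Rightarrow> complex) set).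
    (\<forall>F\<in>\<F>. \<exists>d. is_form d F) \<and> Z = {z. z \<noteq> 0 \<and> (\<forall>F\<in>\<F>. F (($) z) = 0)})"
proof
  assume "proj_closed Z"
  then obtain F :: "('v, complex) mpoly set" where F: "\<forall>f\<in>F. homogeneous f"
    "Z = {z. z \<noteq> 0 \<and> (\<forall>f\<in>F. mpoly_eval f (($) z) = 0)}" unfolding proj_closed_def by blast
  then show "\<exists>\<F>. (\<forall>F\<in>\<F>. \<exists>d. is_form d F) \<and> Z = {z. z \<noteq> 0 \<and> (\<forall>F\<in>\<F>. F (($) z) = 0)}"
    using homogeneous_is_form by (intro exI[of _ "mpoly_eval ` F"]) auto
next
  assume "\<exists>\<F>. (\<forall>F\<in>\<F>. \<exists>d. is_form d F) \<and> Z = {z. z \<noteq> 0 \<and> (\<forall>F\<in>\<F>. F (($) z) = 0)}"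
  then obtain \<F> :: "(('v \<Rightarrow> complex) \<Rightarrow> complex) set" where F: "\<forall>F\<in>\<F>. \<exists>d. is_form d F"
    "Z = {z. z \<noteq> 0 \<and> (\<forall>F\<in>\<F>. F (($) z) = 0)}" by blast
  show "proj_closed Z"
    unfolding proj_closed_def
  proof (intro exI conjI ballI)
    let ?F = "{f. homogeneous f \<and> mpoly_eval f \<in> \<F>}"
    show "homogeneous f" if "f \<in> ?F" for f using that by simp
    have "(\<forall>F\<in>\<F>. P F) \<longleftrightarrow> (\<forall>f\<in>?F. P (mpoly_eval f))" for P
      using F(1) is_form_homogeneous by (metis (mono_tags, lifting) mem_Collect_eq)
    then show "Z = {z. z \<noteq> 0 \<and> (\<forall>f\<in>?F. mpoly_eval f (($) z) = 0)}" unfolding F(2) by simp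
  qed
qed

lemma proj_closed_nonzero: "proj_closed Z \<Longrightarrow> z \<in> Z \<Longrightarrow> z \<noteq> 0"
  unfolding proj_closed_def by blast

lemma proj_closed_separate:
  assumes "proj_closed Z" "z \<notin> Z" "z \<noteq> 0"
  shows "\<exists>d F. is_form d F \<and> (\<forall>x\<in>Z. F (($) x) = 0) \<and> F (($) z) \<noteq> 0"
  using assms unfolding proj_closed_iff by blast

lemma proj_closed_Int_zeros:
  assumes "proj_closed Z" "is_form d F"
  shows "proj_closed {z\<in>Z. F (($) z) = 0}"
proof -
  obtain \<F> where "\<forall>F\<in>\<F>. \<exists>d. is_form d F" "Z = {z. z \<noteq> 0 \<and> (\<forall>F\<in>\<F>. F (($) z) = 0)}"
    using assms(1) unfolding proj_closed_iff by blast
  then show ?thesis unfolding proj_closed_iff using assms(2)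
    by (intro exI[of _ "insert F \<F>"]) auto
qed

lemma proj_closed_scale:
  assumes "proj_closed Z" "z \<in> Z" "t \<noteq> 0"
  shows "t *s z \<in> Z"
proof (rule ccontr)
  assume *: "t *s z \<notin> Z"
  have "t *s z \<noteq> 0" using assms proj_closed_nonzero by auto
  from proj_closed_separate[OF assms(1) * this] obtain d F where
    F: "is_form d F" "\<forall>x\<in>Z. F (($) x) = 0" "F (($) (t *s z)) \<noteq> 0" by blast
  have "($) (t *s z) = (\<lambda>v. t * z $ v)" by (simp add: fun_eq_iff)
  then show False using is_form_scale[OF F(1), of t "($) z"] F assms by simp
qed

lemma zariski_closure_eq:
  assumes "0 \<notin> S"
  shows "zariski_closure S = {z. z \<noteq> 0 \<and>
    (\<forall>d F. is_form d F \<longrightarrow> (\<forall>x\<in>S. F (($) x) = 0) \<longrightarrow> F (($) z) = 0)}" (is "_ = ?C")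
proof -
  have "proj_closed ?C"
    unfolding proj_closed_iff
    by (intro exI[of _ "{F. (\<exists>d. is_form d F) \<and> (\<forall>x\<in>S. F (($) x) = 0)}"]) auto
  moreover have "S \<subseteq> ?C" using assms by auto
  moreover have "?C \<subseteq> Z" if "proj_closed Z" "S \<subseteq> Z" for Z
    using proj_closed_separate[OF that(1)] that(2) by blast
  ultimately show ?thesis unfolding zariski_closure_def by (intro hull_unique) blast+
qed

lemma zariski_closure_closed: "0 \<notin> S \<Longrightarrow> proj_closed (zariski_closure S)"
  unfolding zariski_closure_eq proj_closed_iff
  by (rule exI[of _ "{F. (\<exists>d. is_form d F) \<and> (\<forall>x\<in>S. F (($) x) = 0)}"]) auto

lemma zariski_closure_supset: "S \<subseteq> zariski_closure S"
  unfolding zariski_closure_def by (rule hull_subset)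

lemma zariski_closure_minimal: "S \<subseteq> Z \<Longrightarrow> proj_closed Z \<Longrightarrow> zariski_closure S \<subseteq> Z"
  unfolding zariski_closure_def by (rule hull_minimal)

lemma irreducible_forms:
  assumes Z: "proj_irreducible Z" and F: "is_form d F" "is_form e G"
    and FG: "\<And>z. z \<in> Z \<Longrightarrow> F (($) z) = 0 \<or> G (($) z) = 0"
  shows "(\<forall>z\<in>Z. F (($) z) = 0) \<or> (\<forall>z\<in>Z. G (($) z) = 0)"
proof -
  have "Z = {z\<in>Z. F (($) z) = 0} \<union> {z\<in>Z. G (($) z) = 0}" using FG by blast
  moreover have "proj_closed {z\<in>Z. F (($) z) = 0}" "proj_closed {z\<in>Z. G (($) z) = 0}"
    using Z proj_closed_Int_zeros[OF _ F(1)] proj_closed_Int_zeros[OF _ F(2)]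
    unfolding proj_irreducible_def by blast+
  ultimately have "Z = {z\<in>Z. F (($) z) = 0} \<or> Z = {z\<in>Z. G (($) z) = 0}"
    using Z unfolding proj_irreducible_def by blast
  then show ?thesis by blast
qed

text \<open>Take for each factor a homogeneous component that does not vanish on \<open>Z\<close> and a point \<open>z\<close> of \<open>Z\<close> where both
  components do not vanish: on the line through \<open>0\<close> and \<open>z\<close> both factors are nonzero polynomials. So the vanishing ideal is
  prime also with respect to inhomogeneous polynomials.\<close>

lemma irreducible_polyfuns:
  assumes Z: "proj_irreducible Z" and F: "polyfun I F" "polyfun J G"
    and FG: "\<And>z. z \<in> Z \<Longrightarrow> F (($) z) = 0 \<or> G (($) z) = 0"
  shows "(\<forall>z\<in>Z. F (($) z) = 0) \<or> (\<forall>z\<in>Z. G (($) z) = 0)"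
proof (rule ccontr)
  assume "\<not> ?thesis"
  then obtain x y where xy: "x \<in> Z" "F (($) x) \<noteq> 0" "y \<in> Z" "G (($) y) \<noteq> 0" by blast
  have closed: "proj_closed Z" using Z unfolding proj_irreducible_def by blast
  obtain n H where H: "\<And>d. is_form d (H d)" "F = (\<lambda>x. \<Sum>d\<le>n. H d x)"
    using polyfun_forms[OF F(1)] by blast
  obtain m K where K: "\<And>d. is_form d (K d)" "G = (\<lambda>x. \<Sum>d\<le>m. K d x)"
    using polyfun_forms[OF F(2)] by blast
  obtain d where d: "d \<le> n" "H d (($) x) \<noteq> 0"
    using xy(2) unfolding H(2) by (metis (mono_tags, lifting) atMost_iff sum.neutral)
  obtain e where e: "e \<le> m" "K e (($) y) \<noteq> 0"
    using xy(4) unfolding K(2) by (metis (mono_tags, lifting) atMost_iff sum.neutral)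
  obtain z where z: "z \<in> Z" "H d (($) z) \<noteq> 0" "K e (($) z) \<noteq> 0"
    using irreducible_forms[OF Z H(1)[of d] K(1)[of e]] xy d e by blast
  have line: "($) (t *s z) = (\<lambda>v. t * z $ v)" for t by (simp add: fun_eq_iff)
  define P where "P = (\<Sum>d\<le>n. monom (H d (($) z)) d)"
  define Q where "Q = (\<Sum>d\<le>m. monom (K d (($) z)) d)"
  have P: "poly P t = F (($) (t *s z))" for t
    unfolding P_def H(2) line is_form_scale[OF H(1)] by (simp add: poly_sum poly_monom mult.commute)
  have Q: "poly Q t = G (($) (t *s z))" for t
    unfolding Q_def K(2) line is_form_scale[OF K(1)] by (simp add: poly_sum poly_monom mult.commute)
  have "coeff P d \<noteq> 0" "coeff Q e \<noteq> 0"
    using d e z by (simp_all add: P_def Q_def coeff_sum coeff_monom if_distrib cong: if_cong)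
  then have "[:0, 1:] * P * Q \<noteq> 0" by auto
  then obtain t where "poly ([:0, 1:] * P * Q) t \<noteq> 0" using poly_all_0_iff_0 by blast
  then have "t \<noteq> 0" "F (($) (t *s z)) \<noteq> 0" "G (($) (t *s z)) \<noteq> 0" by (auto simp: P Q)
  then show False using FG[OF proj_closed_scale[OF closed z(1)]] by blast
qed

text \<open>It suffices to test primality of the vanishing ideal on forms, as closed sets are separated from points by
  forms.\<close>

lemma zariski_closure_irreducible:
  assumes "S \<noteq> {}" "0 \<notin> S"
    and prime: "\<And>d e F G. is_form d F \<Longrightarrow> is_form e G \<Longrightarrow>
      (\<And>z. z \<in> S \<Longrightarrow> F (($) z) = 0 \<or> G (($) z) = 0) \<Longrightarrow>
      (\<forall>z\<in>S. F (($) z) = 0) \<or> (\<forall>z\<in>S. G (($) z) = 0)"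
  shows "proj_irreducible (zariski_closure S)"
  unfolding proj_irreducible_def
proof (intro conjI allI impI)
  show "proj_closed (zariski_closure S)" by (rule zariski_closure_closed[OF assms(2)])
  show "zariski_closure S \<noteq> {}" using assms(1) zariski_closure_supset by blast
next
  fix Z1 Z2 assume Z: "proj_closed Z1" "proj_closed Z2" "zariski_closure S = Z1 \<union> Z2"
  have "S \<subseteq> Z1 \<or> S \<subseteq> Z2"
  proof (rule ccontr)
    assume "\<not> ?thesis"
    then obtain x y where xy: "x \<in> S" "x \<notin> Z1" "y \<in> S" "y \<notin> Z2" by blast
    obtain d F where F: "is_form d F" "\<forall>z\<in>Z1. F (($) z) = 0" "F (($) x) \<noteq> 0"
      using proj_closed_separate[OF Z(1) xy(2)] assms(2) xy by metis
    obtain e G where G: "is_form e G" "\<forall>z\<in>Z2. G (($) z) = 0" "G (($) y) \<noteq> 0"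
      using proj_closed_separate[OF Z(2) xy(4)] assms(2) xy by metis
    have "F (($) z) = 0 \<or> G (($) z) = 0" if "z \<in> S" for z
      using that Z(3) zariski_closure_supset[of S] F G by blast
    then show False using prime[OF F(1) G(1)] F G xy by blast
  qed
  then show "zariski_closure S = Z1 \<or> zariski_closure S = Z2"
    using zariski_closure_minimal Z by blast
qed

section \<open>Straightening a transversal zero set\<close>

definition grad_at :: "('v \<Rightarrow> ('v \<Rightarrow> 'a) \<Rightarrow> 'a) \<Rightarrow> 'a ^ 'v::finite \<Rightarrow> 'a ^ 'v" where
  "grad_at F' z = (\<chi> v. F' v (($) z))"

lemma grad_at_nth [simp]: "grad_at F' z $ v = F' v (($) z)"
  by (simp add: grad_at_def)

lemma has_grad_has_derivative_pairing:
  fixes F :: "('v::finite \<Rightarrow> 'a::real_normed_field) \<Rightarrow> 'a"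
  assumes "has_grad F F'"
  shows "((\<lambda>z::'a^'v. F (($) z)) has_derivative pairing (grad_at F' z)) (at z)"
  using has_grad_has_derivative[OF assms, of z] by (simp add: pairing_def[abs_def])

lemma bounded_linear_pairing:
  "bounded_linear (pairing (a :: 'a::{real_normed_field,euclidean_space} ^ 'v::finite))"
  unfolding linear_conv_bounded_linear[symmetric]
  by (rule linearI) (simp_all add: pairing_def algebra_simps sum.distrib scaleR_sum_right)

lemma bounded_linear_vsmult:
  "bounded_linear (\<lambda>t. t *s (w :: 'a::{real_normed_field,euclidean_space} ^ 'v::finite))"
  unfolding linear_conv_bounded_linear[symmetric]
  by (rule linearI) (simp_all add: vec_eq_iff algebra_simps)

lemma polyfun_det:
  assumes "\<And>i j. polyfun I (\<lambda>x. M x $ i $ j)"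
  shows "polyfun I (\<lambda>x. det (M x))"
  unfolding det_def by (intro polyfun_sum polyfun_mult polyfun_prod polyfun_const assms)

text \<open>A common zero \<open>p\<close> of the functions \<open>G e\<close> at which their gradients are independent. The scalars are the real
  or the complex numbers.\<close>

locale regular_point =
  fixes R :: "'r set"
    and G :: "'r \<Rightarrow> ('v::finite \<Rightarrow> 'a::{real_normed_field,euclidean_space}) \<Rightarrow> 'a"
    and dG :: "'r \<Rightarrow> 'v \<Rightarrow> ('v \<Rightarrow> 'a) \<Rightarrow> 'a" and p :: "'a ^ 'v"
  assumes fin: "finite R"
    and grad: "\<And>e. e \<in> R \<Longrightarrow> has_grad (G e) (dG e)"
    and zero: "\<And>e. e \<in> R \<Longrightarrow> G e (($) p) = 0"
    and indep: "indep_fam R (\<lambda>e. grad_at (dG e) p)"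
begin

definition dual :: "'r \<Rightarrow> 'a ^ 'v" where
  "dual = (SOME s. \<forall>e\<in>R. \<forall>f\<in>R. pairing (grad_at (dG e) p) (s f) = (if e = f then 1 else 0))"

lemma dual: "e \<in> R \<Longrightarrow> f \<in> R \<Longrightarrow> pairing (grad_at (dG e) p) (dual f) = (if e = f then 1 else 0)"
  using someI_ex[OF indep_fam_dual[OF fin indep]] unfolding dual_def by blast

definition tangent :: "('a ^ 'v) set" where
  "tangent = {u. \<forall>e\<in>R. pairing (grad_at (dG e) p) u = 0}"

text \<open>This map is the identity to first order at \<open>p\<close>. It replaces the linear part of each \<open>G e\<close> by \<open>G e\<close> itself along a
  dual family, so that it maps the zero set to the tangent space.\<close>

definition flat :: "'a ^ 'v \<Rightarrow> 'a ^ 'v" where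
  "flat z = z - p + (\<Sum>e\<in>R. (G e (($) z) - pairing (grad_at (dG e) p) (z - p)) *s dual e)"

definition flat' :: "'a ^ 'v \<Rightarrow> 'a ^ 'v \<Rightarrow> 'a ^ 'v" where
  "flat' z u = u + (\<Sum>e\<in>R. (pairing (grad_at (dG e) z) u - pairing (grad_at (dG e) p) u) *s dual e)"

lemma pairing_dual_sum:
  "e \<in> R \<Longrightarrow> pairing (grad_at (dG e) p) (\<Sum>f\<in>R. c f *s dual f) = c e"
  using fin by (simp add: dual if_distrib cong: if_cong)

lemma pairing_flat: "e \<in> R \<Longrightarrow> pairing (grad_at (dG e) p) (flat z) = G e (($) z)"
  unfolding flat_def pairing_simps(1) by (subst pairing_dual_sum) auto

lemma pairing_flat': "e \<in> R \<Longrightarrow> pairing (grad_at (dG e) p) (flat' z u) = pairing (grad_at (dG e) z) u"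
  unfolding flat'_def pairing_simps(1) by (subst pairing_dual_sum) auto

lemma flat_in_tangent: "flat z \<in> tangent \<longleftrightarrow> (\<forall>e\<in>R. G e (($) z) = 0)"
  by (simp add: tangent_def pairing_flat)

lemma flat_p [simp]: "flat p = 0"
  by (simp add: flat_def zero)

lemma flat'_p [simp]: "flat' p u = u"
  by (simp add: flat'_def)

lemma flat'_smult: "flat' z (c *s u) = c *s flat' z u"
  by (simp add: flat'_def vec_eq_iff algebra_simps sum_distrib_left)

lemma flat_derivative: "(flat has_derivative flat' z) (at z)"
proof -
  have "((\<lambda>z. (G e (($) z) - pairing (grad_at (dG e) p) (z - p)) *s dual e) has_derivative
      (\<lambda>u. (pairing (grad_at (dG e) z) u - pairing (grad_at (dG e) p) u) *s dual e)) (at z)"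
    if "e \<in> R" for e
  proof (rule bounded_linear.has_derivative[OF bounded_linear_vsmult])
    have "((\<lambda>z. pairing (grad_at (dG e) p) (z - p)) has_derivative
        (\<lambda>u. pairing (grad_at (dG e) p) (u - 0))) (at z)"
      by (rule bounded_linear.has_derivative[OF bounded_linear_pairing])
        (auto intro!: derivative_eq_intros)
    then show "((\<lambda>z. G e (($) z) - pairing (grad_at (dG e) p) (z - p)) has_derivative
      (\<lambda>u. pairing (grad_at (dG e) z) u - pairing (grad_at (dG e) p) u)) (at z)"
      using has_derivative_diff[OF has_grad_has_derivative_pairing[OF grad[OF that], of z]] by simp
  qed
  note has_derivative_sum[OF this]
  moreover have "((\<lambda>z. z - p) has_derivative (\<lambda>u. u)) (at z)" by (auto intro!: derivative_eq_intros)
  ultimately have "((\<lambda>z. z - p + (\<Sum>e\<in>R. (G e (($) z) - pairing (grad_at (dG e) p) (z - p)) *s dual e))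
      has_derivative (\<lambda>u. u + (\<Sum>e\<in>R. (pairing (grad_at (dG e) z) u - pairing (grad_at (dG e) p) u) *s dual e))) (at z)"
    by (intro has_derivative_add)
  then show ?thesis by (simp add: flat_def[abs_def] flat'_def[abs_def])
qed

lemma continuous_flat': "continuous_on A (\<lambda>z. flat' z u)"
proof -
  have "continuous_on A (\<lambda>z. pairing (grad_at (dG e) z) u)" if "e \<in> R" for e
    unfolding pairing_def grad_at_nth
    by (intro continuous_intros polyfun_continuous[OF has_grad_imp_polyfun_grad[OF grad[OF that]]])
  then have "continuous_on A (\<lambda>z. (pairing (grad_at (dG e) z) u - pairing (grad_at (dG e) p) u) *s dual e)"
    if "e \<in> R" for e
    using that by (intro bounded_linear.continuous_on[OF bounded_linear_vsmult] continuous_intros) auto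
  then show ?thesis unfolding flat'_def by (intro continuous_intros) auto
qed

definition jacobian :: "('v \<Rightarrow> 'a) \<Rightarrow> 'a ^ 'v ^ 'v" where
  "jacobian x = (\<chi> v w. flat' (\<chi> v. x v) (axis w 1) $ v)"

lemma flat'_jacobian: "flat' z u = jacobian (($) z) *v u"
proof -
  have *: "(\<chi> v. z $ v) = z" by (simp add: vec_eq_iff)
  have add: "flat' z (u + w) = flat' z u + flat' z w" for u w
    using linear_add[OF bounded_linear.linear[OF has_derivative_bounded_linear[OF flat_derivative]]] .
  have "flat' z 0 = 0" using flat'_smult[of z 0 0] by simp
  then have sum: "flat' z (\<Sum>w\<in>A. f w) = (\<Sum>w\<in>A. flat' z (f w))" for A :: "'v set" and f
    by (induction A rule: infinite_finite_induct) (auto simp: add)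
  have "flat' z u = flat' z (\<Sum>w\<in>UNIV. u $ w *s axis w 1)" by (simp only: basis_expansion)
  also have "\<dots> = (\<Sum>w\<in>UNIV. u $ w *s flat' z (axis w 1))" by (simp only: sum flat'_smult)
  finally show ?thesis
    by (simp add: jacobian_def * vec_eq_iff matrix_vector_mult_def mult.commute)
qed

lemma polyfun_jacobian: "polyfun UNIV (\<lambda>x. jacobian x $ v $ w)"
  unfolding jacobian_def flat'_def pairing_def
  by (simp add: grad_at_def vec_lambda_inverse)
    (intro polyfun_add polyfun_sum polyfun_mult polyfun_diff polyfun_const
      has_grad_imp_polyfun_grad[OF grad]; simp)

lemma straightening:
  assumes "open U0" "p \<in> U0"
  obtains U W \<psi> \<psi>' where "open U" "U \<subseteq> U0" "p \<in> U" "open W" "0 \<in> W" "homeomorphism U W flat \<psi>"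
    "\<And>y. y \<in> W \<Longrightarrow> (\<psi> has_derivative \<psi>' y) (at y)"
    "\<And>y u. y \<in> W \<Longrightarrow> flat' (\<psi> y) (\<psi>' y u) = u" "\<And>y u. y \<in> W \<Longrightarrow> \<psi>' y (flat' (\<psi> y) u) = u"
proof -
  have bl: "bounded_linear (flat' z)" for z
    using flat_derivative by (rule has_derivative_bounded_linear)
  have "\<exists>U' V g g'. open U' \<and> U' \<subseteq> U0 \<and> p \<in> U' \<and> open V \<and> flat p \<in> V \<and> homeomorphism U' V flat g \<and>
    (\<forall>y\<in>V. (g has_derivative (g' y)) (at y)) \<and>
    (\<forall>y\<in>V. g' y = inv (blinfun_apply (Blinfun (flat' (g y))))) \<and>
    (\<forall>y\<in>V. bij (blinfun_apply (Blinfun (flat' (g y)))))"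
  proof (rule inverse_function_theorem[OF assms(1), of flat "\<lambda>z. Blinfun (flat' z)" p id_blinfun])
    show "(flat has_derivative blinfun_apply (Blinfun (flat' x))) (at x)" for x
      using flat_derivative by (simp add: bounded_linear_Blinfun_apply[OF bl])
    show "continuous_on U0 (\<lambda>z. Blinfun (flat' z))"
      by (intro continuous_on_blinfun_componentwise)
        (simp add: bounded_linear_Blinfun_apply[OF bl] continuous_flat')
    show "id_blinfun o\<^sub>L Blinfun (flat' p) = id_blinfun"
      by (rule blinfun_eqI) (simp add: bounded_linear_Blinfun_apply[OF bl])
  qed (use assms(2) in blast)+
  then obtain U' V g g' where *: "open U'" "U' \<subseteq> U0" "p \<in> U'" "open V" "flat p \<in> V" "homeomorphism U' V flat g"
    "\<And>y. y \<in> V \<Longrightarrow> (g has_derivative (g' y)) (at y)"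
    "\<And>y. y \<in> V \<Longrightarrow> g' y = inv (flat' (g y))" "\<And>y. y \<in> V \<Longrightarrow> bij (flat' (g y))"
    by (auto simp: bounded_linear_Blinfun_apply[OF bl])
  show ?thesis
  proof (rule that[OF *(1-4) _ *(6,7)])
    show "0 \<in> V" using *(5) by simp
    show "flat' (g y) (g' y u) = u" "g' y (flat' (g y) u) = u" if "y \<in> V" for y u
      using *(8,9)[OF that] by (simp_all add: bij_is_surj surj_f_inv_f bij_is_inj)
  qed
qed

end

section \<open>The length of chains of irreducible subvarieties\<close>

lemma poly_eq_sum_bound:
  fixes p :: "'a::comm_ring_1 poly"
  assumes "degree p \<le> n"
  shows "poly p x = (\<Sum>j\<le>n. coeff p j * x ^ j)"
  unfolding poly_altdef using assms
  by (intro sum.mono_neutral_left) (auto simp: coeff_eq_0)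

text \<open>A strictly increasing chain of irreducible sets carries algebraically independent functions: each
  \<open>h (Suc i)\<close> vanishes on \<open>Z i\<close> but not on \<open>Z (Suc i)\<close>. A relation on \<open>Z (Suc i)\<close> that involves
  \<open>h (Suc i)\<close> restricts to a relation on \<open>Z i\<close> between its constant terms, so that these vanish and a factor
  \<open>h (Suc i)\<close> can be cancelled.\<close>

lemma chain_algebraically_independent:
  fixes Z :: "nat \<Rightarrow> (complex ^ 'v::finite) set" and h :: "nat \<Rightarrow> ('v \<Rightarrow> complex) \<Rightarrow> complex"
  assumes irr: "\<And>i. i \<le> d \<Longrightarrow> proj_irreducible (Z i)"
    and sub: "\<And>i. i < d \<Longrightarrow> Z i \<subseteq> Z (Suc i)"
    and h: "\<And>i. i \<le> d \<Longrightarrow> polyfun UNIV (h i)"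
    and h0: "h 0 = (\<lambda>x. x v0)" "p \<in> Z 0" "p $ v0 \<noteq> 0"
    and hZ: "\<And>i z. i < d \<Longrightarrow> z \<in> Z i \<Longrightarrow> h (Suc i) (($) z) = 0"
    and hnZ: "\<And>i. i < d \<Longrightarrow> \<exists>z\<in>Z (Suc i). h (Suc i) (($) z) \<noteq> 0"
    and "i \<le> d" "polyfun {..i} F" "\<And>z. z \<in> Z i \<Longrightarrow> F (\<lambda>k. h k (($) z)) = 0"
  shows "F y = 0"
  using assms(9-)
proof (induction i arbitrary: F y)
  case 0
  obtain P where P: "\<And>s. F (\<lambda>v. 0 + s * 1) = poly P s"
    using polyfun_on_line[OF "0.prems"(2), of "\<lambda>_. 0" "\<lambda>_. 1"] by blast
  have root: "poly P (t * p $ v0) = 0" if "t \<noteq> 0" for t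
  proof -
    have "t *s p \<in> Z 0"
      using irr[of 0] by (intro proj_closed_scale h0(2) that) (simp add: proj_irreducible_def)
    then have "F (\<lambda>k. h k (($) (t *s p))) = 0" by (rule "0.prems"(3))
    moreover have "F (\<lambda>k. h k (($) (t *s p))) = F (\<lambda>v. 0 + (t * p $ v0) * 1)"
      by (rule polyfun_cong[OF "0.prems"(2)]) (simp add: h0(1))
    ultimately show ?thesis using P by simp
  qed
  have "poly (pCons 0 P) s = 0" for s
    using root[of "s / p $ v0"] h0(3) by (cases "s = 0") simp_all
  then have "pCons 0 P = 0" using poly_all_0_iff_0 by blast
  then have "F (\<lambda>v. 0 + y 0 * 1) = 0" using P by simp
  moreover have "F (\<lambda>v. 0 + y 0 * 1) = F y"
    by (rule polyfun_cong[OF "0.prems"(2)]) simp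
  ultimately show ?case by simp
next
  case (Suc i)
  have i: "i < d" "i \<le> d" using Suc.prems by auto
  have const: "coeff (P y) 0 = 0"
    if "\<And>j. polyfun {..i} (\<lambda>y. coeff (P y) j)"
      "\<And>z. z \<in> Z (Suc i) \<Longrightarrow> poly (P (\<lambda>k. h k (($) z))) (h (Suc i) (($) z)) = 0" for P y
  proof (rule Suc.IH[OF i(2) that(1)])
    fix z assume "z \<in> Z i"
    then show "coeff (P (\<lambda>k. h k (($) z))) 0 = 0"
      using that(2)[of z] sub[OF i(1)] hZ[OF i(1)] by (auto simp: poly_0_coeff_0)
  qed
  have cancel: "P y = 0"
    if "\<And>j. polyfun {..i} (\<lambda>y. coeff (P y) j)" "\<And>y. degree (P y) \<le> n"
      "\<And>z. z \<in> Z (Suc i) \<Longrightarrow> poly (P (\<lambda>k. h k (($) z))) (h (Suc i) (($) z)) = 0"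
    for n P y
    using that
  proof (induction n arbitrary: P y)
    case (0 P)
    then show ?case using const[OF 0(1,3), of y] leading_coeff_0_iff[of "P y"] by simp
  next
    case (Suc n P)
    define P1 where "P1 y = poly_shift 1 (P y)" for y
    have P: "P y = pCons 0 (P1 y)" for y
      using const[OF Suc.prems(1,3), of y]
      by (intro poly_eqI) (auto simp: P1_def coeff_pCons coeff_poly_shift split: nat.split)
    have P1: "polyfun {..i} (\<lambda>y. coeff (P1 y) j)" for j
      using Suc.prems(1)[of "Suc j"] by (simp add: P)
    have deg: "degree (P1 y) \<le> n" for y
      using Suc.prems(2)[of y] by (intro degree_le) (auto simp: P1_def coeff_poly_shift coeff_eq_0)
    have "polyfun UNIV (\<lambda>x. poly (P1 (\<lambda>k. h k x)) (h (Suc i) x))"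
      unfolding poly_eq_sum_bound[OF deg] using Suc.prems(1) i
      by (intro polyfun_sum polyfun_mult polyfun_power polyfun_comp[OF P1] h) auto
    moreover have "h (Suc i) (($) z) = 0 \<or> poly (P1 (\<lambda>k. h k (($) z))) (h (Suc i) (($) z)) = 0"
      if "z \<in> Z (Suc i)" for z
      using Suc.prems(3)[OF that] by (simp add: P)
    ultimately have "(\<forall>z\<in>Z (Suc i). h (Suc i) (($) z) = 0) \<or>
        (\<forall>z\<in>Z (Suc i). poly (P1 (\<lambda>k. h k (($) z))) (h (Suc i) (($) z)) = 0)"
      using irreducible_polyfuns[OF irr[of "Suc i"] h[of "Suc i"],
          of UNIV "\<lambda>x. poly (P1 (\<lambda>k. h k x)) (h (Suc i) x)"] i by simp
    then have "P1 y = 0" for y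
      using hnZ[OF i(1)] by (intro Suc.IH[OF P1 deg]) blast
    then show ?case by (simp add: P)
  qed
  obtain P n where P: "\<And>j. polyfun ({..Suc i} - {Suc i}) (\<lambda>y. coeff (P y) j)" "\<And>y. degree (P y) \<le> n"
    "\<And>y. F y = poly (P y) (y (Suc i))"
    using polyfun_expand[OF Suc.prems(2), of "Suc i"] by blast
  have "{..Suc i} - {Suc i} = {..i}" by auto
  then have 1: "polyfun {..i} (\<lambda>y. coeff (P y) j)" for j using P(1)[of j] by simp
  have "P y = 0"
  proof (rule cancel[OF 1 P(2)])
    fix z assume "z \<in> Z (Suc i)"
    from Suc.prems(3)[OF this]
    show "poly (P (\<lambda>k. h k (($) z))) (h (Suc i) (($) z)) = 0" by (simp only: P(3))
  qed
  then show ?case by (simp add: P(3))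
qed

text \<open>The Jacobian criterion turns these independent functions into a bound on the length of the chain.\<close>

lemma chain_bound:
  fixes Z :: "nat \<Rightarrow> (complex ^ 'v::finite) set"
  assumes irr: "\<And>i. i \<le> d \<Longrightarrow> proj_irreducible (Z i)"
    and strict: "\<And>i. i < d \<Longrightarrow> Z i \<subset> Z (Suc i)"
    and p: "p \<in> Z 0"
    and reg: "regular_point R G dG p"
    and vanish: "\<And>e z. e \<in> R \<Longrightarrow> z \<in> Z d \<Longrightarrow> G e (($) z) = 0"
  shows "d + 1 + card R \<le> CARD('v)"
proof (rule ccontr)
  assume less: "\<not> ?thesis"
  interpret regular_point R G dG p by fact
  have closed: "proj_closed (Z i)" if "i \<le> d" for i
    using irr[OF that] unfolding proj_irreducible_def by blast
  have "p \<noteq> 0" using proj_closed_nonzero[OF closed p] by simp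
  then obtain v0 where v0: "p $ v0 \<noteq> 0" by (auto simp: vec_eq_iff)
  have mono: "Z i \<subseteq> Z j" if "i \<le> j" "j \<le> d" for i j
    using that
  proof (induction rule: dec_induct)
    case (step n)
    then show ?case using strict[of n] by auto
  qed simp
  have "\<exists>F. polyfun UNIV F \<and> (\<forall>z\<in>Z i. F (($) z) = 0) \<and> (\<exists>z\<in>Z (Suc i). F (($) z) \<noteq> 0)" if "i < d" for i
  proof -
    obtain z where z: "z \<in> Z (Suc i)" "z \<notin> Z i" using strict[OF \<open>i < d\<close>] by blast
    then have "z \<noteq> 0" using proj_closed_nonzero[OF closed[of "Suc i"]] that by auto
    from proj_closed_separate[OF closed[of i] z(2) this] that show ?thesis
      using z(1) is_form_polyfun by fastforce
  qed
  then obtain f where f: "\<And>i. i < d \<Longrightarrow> polyfun UNIV (f i)"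
    "\<And>i z. i < d \<Longrightarrow> z \<in> Z i \<Longrightarrow> f i (($) z) = 0" "\<And>i. i < d \<Longrightarrow> \<exists>z\<in>Z (Suc i). f i (($) z) \<noteq> 0"
    by metis
  define h where "h i = (case i of 0 \<Rightarrow> (\<lambda>x. x v0) | Suc j \<Rightarrow> f j)" for i
  have h: "polyfun UNIV (h i)" if "i \<le> d" for i
    using that f(1) by (cases i) (auto simp: h_def intro: polyfun_var)
  then have "\<exists>g. has_grad (h i) g" if "i \<le> d" for i
    using polyfun_imp_has_grad that by blast
  then obtain dh where dh: "\<And>i. i \<in> {..d} \<Longrightarrow> has_grad (h i) (dh i)" by (metis atMost_iff)
  \<comment> \<open>The equations stay transversal where the straightening map has an invertible derivative.\<close>
  define J where "J x = det (jacobian x)" for x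
  have J: "polyfun UNIV J" unfolding J_def[abs_def] by (rule polyfun_det[OF polyfun_jacobian])
  have "jacobian (($) p) *v u = u" for u using flat'_jacobian[of p u] by simp
  then have Jp: "J (($) p) \<noteq> 0" unfolding J_def
    by (metis det_I matrix_eq matrix_vector_mul_lid zero_neq_one)
  have indep_J: "indep_fam R (\<lambda>e. grad_at (dG e) z)" if Jz: "J (($) z) \<noteq> 0" for z
    unfolding indep_fam_def
  proof (intro allI impI)
    fix c assume c: "\<forall>v. (\<Sum>e\<in>R. c e * grad_at (dG e) z $ v) = 0"
    have "(\<Sum>e\<in>R. c e * grad_at (dG e) p $ v) = 0" for v
    proof -
      obtain N :: "complex ^ 'v ^ 'v" where N: "jacobian (($) z) ** N = mat 1"
        using Jz unfolding J_def invertible_det_nz[symmetric] invertible_def by blast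
      define u where "u = N *v axis v 1"
      have u: "flat' z u = axis v 1" unfolding flat'_jacobian u_def by (simp add: matrix_vector_mul_assoc N)
      have "(\<Sum>e\<in>R. c e * pairing (grad_at (dG e) z) u) = (\<Sum>w\<in>UNIV. (\<Sum>e\<in>R. c e * grad_at (dG e) z $ w) * u $ w)"
        unfolding pairing_def by (simp add: sum_distrib_left sum_distrib_right mult.assoc) (rule sum.swap)
      then have "(\<Sum>e\<in>R. c e * pairing (grad_at (dG e) z) u) = 0" using c by simp
      moreover have "pairing (grad_at (dG e) z) u = grad_at (dG e) p $ v" if "e \<in> R" for e
        using pairing_flat'[OF that, of z u] by (simp add: u pairing_def axis_def if_distrib cong: if_cong)
      ultimately show ?thesis by simp
    qed
    then show "\<forall>e\<in>R. c e = 0" using indep unfolding indep_fam_def by blast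
  qed
  define B where "B = {x. (\<chi> v. x v) \<in> Z d \<and> J x \<noteq> 0}"
  have "\<exists>F. polyfun {..d} F \<and> (\<exists>y. F y \<noteq> 0) \<and> (\<forall>b\<in>B. F (\<lambda>k. h k b) = 0)"
  proof (rule algebraic_dependence[where G = G and dG = dG and R = R])
    show "G e b = 0" if "e \<in> R" "b \<in> B" for e b
      using vanish[OF that(1), of "\<chi> v. b v"] that(2) by (simp add: B_def vec_lambda_inverse)
    show "\<exists>l m. (\<exists>k\<in>{..d}. l k \<noteq> 0) \<and> (\<forall>v. (\<Sum>k\<le>d. l k * dh k v b) = (\<Sum>e\<in>R. m e * dG e v b))"
      if "b \<in> B" for b
    proof -
      have b: "($) (\<chi> v. b v) = b" by (simp add: fun_eq_iff)
      have "indep_fam R (\<lambda>e. grad_at (dG e) (\<chi> v. b v))"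
        using that indep_J[of "\<chi> v. b v"] by (simp add: B_def b)
      from dependent_modulo[OF fin _ this, of "{..d}" "\<lambda>k. grad_at (dh k) (\<chi> v. b v)"] less
      show ?thesis by (simp add: b)
    qed
  qed (use dh grad in auto)
  then obtain F y where F: "polyfun {..d} F" "F y \<noteq> 0" "\<And>b. b \<in> B \<Longrightarrow> F (\<lambda>k. h k b) = 0" by blast
  have "polyfun UNIV (\<lambda>x. F (\<lambda>k. h k x))" using h by (intro polyfun_comp[OF F(1)]) auto
  moreover have "J (($) z) = 0 \<or> F (\<lambda>k. h k (($) z)) = 0" if "z \<in> Z d" for z
    using F(3)[of "($) z"] that by (auto simp: B_def)
  ultimately have "(\<forall>z\<in>Z d. J (($) z) = 0) \<or> (\<forall>z\<in>Z d. F (\<lambda>k. h k (($) z)) = 0)"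
    using irreducible_polyfuns[OF irr[of d] J, of UNIV "\<lambda>x. F (\<lambda>k. h k x)"] by simp
  moreover have "p \<in> Z d" using mono[of 0 d] p by auto
  ultimately have Fh: "F (\<lambda>k. h k (($) z)) = 0" if "z \<in> Z d" for z using Jp that by blast
  have "F y = 0"
  proof (intro chain_algebraically_independent[of d Z h v0 p d F y])
    show "h (Suc i) (($) z) = 0" if "i < d" "z \<in> Z i" for i z using f(2) that by (simp add: h_def)
    show "\<exists>z\<in>Z (Suc i). h (Suc i) (($) z) \<noteq> 0" if "i < d" for i using f(3) that by (simp add: h_def)
    show "Z i \<subseteq> Z (Suc i)" if "i < d" for i using strict[OF that] by blast
    show "polyfun UNIV (h i)" if "i \<le> d" for i using h[OF that] .
    show "F (\<lambda>k. h k (($) z)) = 0" if "z \<in> Z d" for z using Fh[OF that] .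
    show "h 0 = (\<lambda>x. x v0)" by (simp add: h_def)
  qed (use irr p v0 F(1) in simp_all)
  then show False using F(2) by blast
qed

section \<open>Smoothness of the closure of a transversal zero set\<close>

lemma has_grad_line_derivative:
  fixes F :: "('v::finite \<Rightarrow> complex) \<Rightarrow> complex"
  assumes "has_grad F F'"
  shows "((\<lambda>t. F (($) (p + t *s u))) has_field_derivative pairing (grad_at F' p) u) (at 0)"
proof -
  have "((\<lambda>t. p + t *s u) has_derivative (\<lambda>t. 0 + t *s u)) (at 0)"
    by (intro has_derivative_add has_derivative_const bounded_linear_imp_has_derivative bounded_linear_vsmult)
  from has_derivative_compose[OF this, of "\<lambda>z. F (($) z)" "pairing (grad_at F' p)"]
  show ?thesis using has_grad_has_derivative_pairing[OF assms, of p]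
    by (simp add: has_field_derivative_def mult_commute_abs)
qed

lemma is_form_linear:
  fixes g :: "complex ^ 'v::finite \<Rightarrow> complex"
  assumes "\<And>u w. g (u + w) = g u + g w" "\<And>c u. g (c *s u) = c * g u"
  shows "is_form 1 (\<lambda>x. g (\<chi> v. x v))"
proof -
  have "g 0 = 0" using assms(2)[of 0 0] by simp
  then have sum: "g (\<Sum>v\<in>A. f v) = (\<Sum>v\<in>A. g (f v))" for A :: "'v set" and f
    by (induction A rule: infinite_finite_induct) (auto simp: assms(1))
  have "g u = (\<Sum>v\<in>UNIV. g (axis v 1) * u $ v)" for u
  proof -
    have "g u = g (\<Sum>v\<in>UNIV. u $ v *s axis v 1)" by (simp only: basis_expansion)
    also have "\<dots> = (\<Sum>v\<in>UNIV. g (axis v 1) * u $ v)" by (simp only: sum assms(2) mult.commute)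
    finally show ?thesis .
  qed
  from this[of "\<chi> v. x v" for x]
  have "(\<lambda>x. g (\<chi> v. x v)) = (\<lambda>x. \<Sum>v\<in>UNIV. g (axis v 1) * x v)" by (simp add: fun_eq_iff)
  then show ?thesis by (simp only:) (intro is_form_sum is_form_cmult is_form_var)
qed

text \<open>The identity theorem for holomorphic functions of one variable, applied to complex lines, shows that
  polynomials restrict to a holomorphically parametrized convex piece as to an integral domain.\<close>

lemma holomorphic_image_prime:
  fixes \<psi> :: "complex ^ 'v::finite \<Rightarrow> complex ^ 'v"
  assumes C: "convex C" "open C" and L: "vec.subspace L"
    and der: "\<And>y. y \<in> C \<Longrightarrow> (\<psi> has_derivative \<psi>' y) (at y)"
    and lin: "\<And>y t u. y \<in> C \<Longrightarrow> \<psi>' y (t *s u) = t *s \<psi>' y u"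
    and F: "polyfun I F" "polyfun J G"
    and zero: "\<And>z. z \<in> \<psi> ` (C \<inter> L) \<Longrightarrow> F (($) z) = 0 \<or> G (($) z) = 0"
  shows "(\<forall>z\<in>\<psi> ` (C \<inter> L). F (($) z) = 0) \<or> (\<forall>z\<in>\<psi> ` (C \<inter> L). G (($) z) = 0)"
proof (rule ccontr)
  assume "\<not> ?thesis"
  then obtain x y where x: "x \<in> C" "x \<in> L" "F (($) (\<psi> x)) \<noteq> 0" and y: "y \<in> C" "y \<in> L" "G (($) (\<psi> y)) \<noteq> 0"
    by blast
  define u where "u = y - x"
  define l where "l c = x + c *s u" for c
  define D where "D = l -` C"
  have l_der: "(l has_derivative (\<lambda>t. 0 + t *s u)) (at c)" for c
    unfolding l_def[abs_def]
    by (intro has_derivative_add has_derivative_const bounded_linear_imp_has_derivative bounded_linear_vsmult)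
  have "continuous_on UNIV l"
    using l_der by (meson has_derivative_continuous continuous_at_imp_continuous_on)
  then have "open D" unfolding D_def by (rule open_vimage[OF C(2)])
  have "convex D"
  proof (rule convexI)
    fix a b :: complex and s t :: real
    assume *: "a \<in> D" "b \<in> D" "0 \<le> s" "0 \<le> t" "s + t = 1"
    have "l (s *\<^sub>R a + t *\<^sub>R b) = s *\<^sub>R l a + t *\<^sub>R l b"
    proof -
      have st: "of_real s + of_real t = (1 :: complex)" using *(5) by (metis of_real_1 of_real_add)
      have "x $ i + (of_real s * a + of_real t * b) * u $ i
          = of_real s * (x $ i + a * u $ i) + of_real t * (x $ i + b * u $ i)" for i
      proof -
        have "of_real s * (x $ i + a * u $ i) + of_real t * (x $ i + b * u $ i)
          = (of_real s + of_real t) * x $ i + (of_real s * a + of_real t * b) * u $ i"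
          by (simp add: algebra_simps)
        then show ?thesis by (simp add: st)
      qed
      then show ?thesis
        by (simp add: l_def vec_eq_iff scaleR_conv_of_real[where 'a = complex] algebra_simps)
    qed
    then show "s *\<^sub>R a + t *\<^sub>R b \<in> D"
      using convexD[OF C(1), of "l a" "l b" s t] * by (simp add: D_def)
  qed
  have lL: "l c \<in> L" for c
    unfolding l_def u_def using x y L
    by (intro vec.subspace_add vec.subspace_scale vec.subspace_diff) auto
  have hol: "(\<lambda>c. E (($) (\<psi> (l c)))) holomorphic_on D" if E: "polyfun K E" for E :: "('v \<Rightarrow> complex) \<Rightarrow> complex" and K
  proof (rule holomorphic_onI)
    fix c assume c: "c \<in> D"
    obtain E' where E': "has_grad E E'" using polyfun_imp_has_grad[OF E] by blast
    have "((\<lambda>c. \<psi> (l c)) has_derivative (\<lambda>t. \<psi>' (l c) (0 + t *s u))) (at c)"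
      using c has_derivative_compose[OF l_der der[of "l c"]] by (simp add: D_def)
    from has_derivative_compose[OF this has_grad_has_derivative_pairing[OF E']]
    have "((\<lambda>c. E (($) (\<psi> (l c)))) has_derivative
        (\<lambda>t. pairing (grad_at E' (\<psi> (l c))) (\<psi>' (l c) u) * t)) (at c)"
      using c lin by (simp add: D_def mult.commute)
    then have "((\<lambda>c. E (($) (\<psi> (l c)))) has_field_derivative
        pairing (grad_at E' (\<psi> (l c))) (\<psi>' (l c) u)) (at c)"
      by (simp add: has_field_derivative_def)
    then show "(\<lambda>c. E (($) (\<psi> (l c)))) field_differentiable at c within D"
      using field_differentiable_at_within field_differentiable_def by blast
  qed
  let ?f = "\<lambda>c. F (($) (\<psi> (l c)))" and ?g = "\<lambda>c. G (($) (\<psi> (l c)))"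
  have D01: "0 \<in> D" "1 \<in> D" using x y by (simp_all add: D_def l_def u_def)
  have "open (?f -` (- {0}) \<inter> D)"
    using continuous_open_preimage[OF holomorphic_on_imp_continuous_on[OF hol[OF F(1)]] \<open>open D\<close>, of "- {0}"]
    by (simp add: Int_commute open_Compl)
  then have "?g 1 = 0"
  proof (rule analytic_continuation_open[where s = "?f -` (- {0}) \<inter> D" and s' = D and f = ?g and g = "\<lambda>_. 0"])
    have "0 \<in> ?f -` (- {0}) \<inter> D" using D01 x by (simp add: l_def)
    then show "?f -` (- {0}) \<inter> D \<noteq> {}" by blast
    show "?g c = 0" if "c \<in> ?f -` (- {0}) \<inter> D" for c
      using zero[of "\<psi> (l c)"] that lL by (auto simp: D_def)
  qed (use \<open>open D\<close> convex_connected[OF \<open>convex D\<close>] hol[OF F(2)] D01 in auto)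
  then show False using y by (simp add: l_def u_def)
qed

text \<open>A basis that starts with \<open>p\<close> is needed as all members of the flag have to contain the line through \<open>p\<close>, the
  tangent direction of the cone.\<close>

lemma indep_fam_basis:
  fixes T :: "('a::field ^ 'v::finite) set"
  assumes "vec.subspace T" "p \<in> T" "p \<noteq> 0" "vec.dim T = Suc d"
  obtains b where "indep_fam {..d} b" "b 0 = p" "\<And>i. i \<le> d \<Longrightarrow> b i \<in> T"
proof -
  have "vec.independent {p}" using assms(3) by (simp add: vec.dependent_single)
  then obtain Bs where Bs: "{p} \<subseteq> Bs" "Bs \<subseteq> T" "vec.independent Bs" "T \<subseteq> vec.span Bs"
    using vec.maximal_independent_subset_extend[of "{p}" T] assms(2) by auto
  have fin: "finite Bs" using Bs(3) by (rule vec.finiteI_independent)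
  have "card Bs = Suc d"
    using vec.dim_unique[OF Bs(2,4,3) refl] assms(4) by simp
  then have "card (Bs - {p}) = d" using Bs(1) fin by simp
  then obtain g where g: "bij_betw g {1..d} (Bs - {p})"
    using fin finite_same_card_bij[of "{1..d}" "Bs - {p}"] by auto
  define b where "b = g(0 := p)"
  have bij: "bij_betw b {..d} Bs"
  proof -
    have "bij_betw b {1..d} (Bs - {p})" using g by (rule bij_betw_cong[THEN iffD1, rotated]) (auto simp: b_def)
    moreover have "bij_betw b {0} {p}" by (simp add: b_def bij_betw_def)
    ultimately have "bij_betw b ({1..d} \<union> {0}) ((Bs - {p}) \<union> {p})" by (rule bij_betw_combine) auto
    moreover have "{1..d} \<union> {0} = {..d}" "(Bs - {p}) \<union> {p} = Bs" using Bs(1) by auto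
    ultimately show ?thesis by simp
  qed
  have "indep_fam {..d} b"
    unfolding indep_fam_def
  proof (intro allI impI ballI)
    fix c e assume c: "\<forall>v. (\<Sum>e\<le>d. c e * b e $ v) = 0" and e: "e \<in> {..d}"
    define u where "u x = c (the_inv_into {..d} b x)" for x
    have inj: "inj_on b {..d}" using bij by (rule bij_betw_imp_inj_on)
    have "(\<Sum>x\<in>Bs. u x *s x) = (\<Sum>e\<le>d. u (b e) *s b e)"
      using sum.reindex_bij_betw[OF bij, of "\<lambda>x. u x *s x"] by simp
    also have "\<dots> = (\<Sum>e\<le>d. c e *s b e)"
      by (intro sum.cong refl) (simp add: u_def the_inv_into_f_f[OF inj])
    also have "\<dots> = 0" using c by (simp add: vec_eq_iff)
    finally have "u (b e) = 0"
      using vec.independentD[OF Bs(3) fin order_refl, of u "b e"] bij_betwE[OF bij] e by simp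
    then show "c e = 0" using e by (simp add: u_def the_inv_into_f_f[OF inj])
  qed
  then show ?thesis using that[of b] bij_betwE[OF bij] Bs(2) by (auto simp: b_def)
qed

text \<open>Straighten the zero set at \<open>p\<close> by \<open>flat\<close>, with inverse \<open>\<psi>\<close>. Curves in the image of \<open>\<psi>\<close> show that every vector of the
  kernel \<open>tangent\<close> of the gradients is tangent to the closure; conversely the equations themselves bound the tangent space.
  The upper bound for the local dimension is \<open>chain_bound\<close>. For the lower bound, let \<open>Z i\<close> be the closure of
  the image under \<open>\<psi>\<close> of a ball in the span \<open>L i\<close> of the first \<open>i + 1\<close> members of a basis of \<open>tangent\<close>. It is irreducible
  by \<open>holomorphic_image_prime\<close>, and the inclusions are strict, as the projection \<open>\<pi>\<close> along the dual family
  satisfies \<open>\<pi> (\<psi> w) = p + w\<close>, so that the coordinates on \<open>tangent\<close> become linear forms which tell the images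
  apart.\<close>

theorem smooth_at_transversal:
  fixes G :: "'r \<Rightarrow> ('v::finite \<Rightarrow> complex) \<Rightarrow> complex"
  defines "S \<equiv> \<lambda>R G H. {z :: complex ^ 'v. z \<noteq> 0 \<and> (\<forall>e\<in>R. G e (($) z) = 0) \<and> H (($) z) \<noteq> 0}"
  assumes fin: "finite R"
    and grad: "\<And>e. e \<in> R \<Longrightarrow> has_grad (G e) (dG e)"
    and form: "\<And>e. e \<in> R \<Longrightarrow> is_form (deg e) (G e)"
    and H: "is_form n H"
    and trans: "\<And>z. z \<in> S R G H \<Longrightarrow> indep_fam R (\<lambda>e. grad_at (dG e) z)"
    and p: "p \<in> zariski_closure (S R G H)" "H (($) p) \<noteq> 0"
  shows "smooth_at (zariski_closure (S R G H)) p"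
proof -
  define V where "V = zariski_closure (S R G H)"
  have V: "V = {z. z \<noteq> 0 \<and> (\<forall>d F. is_form d F \<longrightarrow> (\<forall>x\<in>S R G H. F (($) x) = 0) \<longrightarrow> F (($) z) = 0)}"
    unfolding V_def by (rule zariski_closure_eq) (simp add: S_def)
  have V_zero: "G e (($) z) = 0" if "z \<in> V" "e \<in> R" for z e
    using that form[OF that(2)] unfolding V S_def by blast
  have SV: "S R G H \<subseteq> V" unfolding V_def by (rule zariski_closure_supset)
  have closed: "proj_closed V" unfolding V_def by (rule zariski_closure_closed) (simp add: S_def)
  have pV: "p \<in> V" using p(1) by (simp add: V_def)
  have "p \<noteq> 0" using pV by (simp add: V)
  have pS: "p \<in> S R G H"
    unfolding S_def using V_zero[OF pV] \<open>p \<noteq> 0\<close> p(2) by blast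
  interpret regular_point R G dG p
    by unfold_locales (use fin grad V_zero[OF pV] trans[OF pS] in auto)
  have sub: "vec.subspace tangent" unfolding tangent_def by (rule subspace_kernel)
  have dim: "vec.dim tangent + card R = CARD('v)"
    unfolding tangent_def by (rule dim_kernel[OF fin indep])
  have pT: "p \<in> tangent"
    using is_form_euler[OF form grad] zero by (simp add: tangent_def pairing_def)
  have "vec.dim tangent \<noteq> 0"
    using pT \<open>p \<noteq> 0\<close> by (auto simp: vec.dim_eq_0)
  then obtain d where d: "vec.dim tangent = Suc d" by (cases "vec.dim tangent") auto

  have "open {z. z \<noteq> 0 \<and> H (($) z) \<noteq> 0}"
  proof -
    have "open ((\<lambda>z. H (($) z)) -` (- {0}) \<inter> (- {0}))"
      using polyfun_continuous[OF is_form_polyfun[OF H], of UNIV]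
      by (intro open_Int open_vimage) auto
    moreover have "(\<lambda>z. H (($) z)) -` (- {0}) \<inter> (- {0}) = {z. z \<noteq> 0 \<and> H (($) z) \<noteq> 0}" by auto
    ultimately show ?thesis by simp
  qed
  then obtain U W \<psi> \<psi>' where
    U: "open U" "U \<subseteq> {z. z \<noteq> 0 \<and> H (($) z) \<noteq> 0}" "p \<in> U" and W: "open W" "0 \<in> W" and
    hom: "homeomorphism U W flat \<psi>" and
    der: "\<And>y. y \<in> W \<Longrightarrow> (\<psi> has_derivative \<psi>' y) (at y)" and
    inv: "\<And>y u. y \<in> W \<Longrightarrow> flat' (\<psi> y) (\<psi>' y u) = u" "\<And>y u. y \<in> W \<Longrightarrow> \<psi>' y (flat' (\<psi> y) u) = u"
    by (rule straightening[of "{z. z \<noteq> 0 \<and> H (($) z) \<noteq> 0}"]) (use \<open>p \<noteq> 0\<close> p(2) in auto)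
  have flat_\<psi>: "flat (\<psi> y) = y" and \<psi>U: "\<psi> y \<in> U" if "y \<in> W" for y
    using hom that unfolding homeomorphism_def by auto
  have \<psi>0: "\<psi> 0 = p" using hom U(3) unfolding homeomorphism_def by (metis flat_p)
  have \<psi>S: "\<psi> y \<in> S R G H" if "y \<in> W" "y \<in> tangent" for y
    using flat_in_tangent[of "\<psi> y"] flat_\<psi>[OF that(1)] \<psi>U[OF that(1)] that U(2) unfolding S_def by auto
  have \<psi>'_smult: "\<psi>' y (t *s u) = t *s \<psi>' y u" if "y \<in> W" for y t u
    using inv(2)[OF that, of "t *s \<psi>' y u"] by (simp add: flat'_smult inv(1)[OF that])

  have tangent: "cone_tangent_space V p = tangent"
  proof (intro equalityI subsetI)
    fix u assume u: "u \<in> cone_tangent_space V p"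
    have "pairing (grad_at (dG e) p) u = 0" if e: "e \<in> R" for e
    proof -
      obtain f where f: "homogeneous f" "mpoly_eval f = G e"
        using is_form_homogeneous[OF form[OF e]] by blast
      then have "homogeneous f \<and> (\<forall>z\<in>V. mpoly_eval f (($) z) = 0)" using V_zero[OF _ e] by simp
      then have "((\<lambda>t. mpoly_eval f (($) (p + t *s u))) has_field_derivative 0) (at 0)"
        using u unfolding cone_tangent_space_def by blast
      then have "((\<lambda>t. G e (($) (p + t *s u))) has_field_derivative 0) (at 0)" by (simp only: f(2))
      then show ?thesis using has_grad_line_derivative[OF grad[OF e], of p u] DERIV_unique by blast
    qed
    then show "u \<in> tangent" by (simp add: tangent_def)
  next
    fix u assume u: "u \<in> tangent"
    show "u \<in> cone_tangent_space V p"
      unfolding cone_tangent_space_def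
    proof (intro CollectI allI impI)
      fix f :: "('v, complex) mpoly"
      assume f: "homogeneous f \<and> (\<forall>z\<in>V. mpoly_eval f (($) z) = 0)"
      obtain F' where F': "has_grad (mpoly_eval f) F'"
        using polyfun_imp_has_grad[OF polyfun_mpoly_eval] by blast
      have "\<psi>' 0 u = u" using inv(1)[OF W(2), of u] by (simp add: \<psi>0)
      have 1: "((\<lambda>t::real. t *\<^sub>R u) has_derivative (\<lambda>t. t *\<^sub>R u)) (at 0)"
        by (intro bounded_linear_imp_has_derivative bounded_linear_scaleR_left)
      have "(\<psi> has_derivative \<psi>' 0) (at (0 *\<^sub>R u))" using der[OF W(2)] by simp
      note 2 = has_derivative_compose[OF 1 this]
      have "((\<lambda>z. mpoly_eval f (($) z)) has_derivative pairing (grad_at F' p)) (at (\<psi> (0 *\<^sub>R u)))"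
        using has_grad_has_derivative_pairing[OF F', of p] by (simp add: \<psi>0)
      from has_derivative_compose[OF 2 this]
      have "((\<lambda>t::real. mpoly_eval f (($) (\<psi> (t *\<^sub>R u)))) has_derivative
          (\<lambda>t. pairing (grad_at F' p) (\<psi>' 0 (t *\<^sub>R u)))) (at 0)" .
      moreover have "((\<lambda>t::real. mpoly_eval f (($) (\<psi> (t *\<^sub>R u)))) has_derivative (\<lambda>t. 0)) (at 0)"
      proof (rule has_derivative_transform_within_open[OF has_derivative_const])
        show "open ((\<lambda>t::real. t *\<^sub>R u) -` W)"
          by (intro open_vimage W(1) continuous_intros)
        show "0 \<in> (\<lambda>t::real. t *\<^sub>R u) -` W" using W(2) by simp
        fix t :: real assume t: "t \<in> (\<lambda>t::real. t *\<^sub>R u) -` W"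
        have "t *\<^sub>R u = of_real t *s u" by (simp add: vec_eq_iff scaleR_conv_of_real[where 'a = complex])
        then have "t *\<^sub>R u \<in> tangent" using u sub by (simp add: vec.subspace_scale)
        then have "\<psi> (t *\<^sub>R u) \<in> V" using \<psi>S t SV by blast
        then show "0 = mpoly_eval f (($) (\<psi> (t *\<^sub>R u)))" using f by simp
      qed
      ultimately have "(\<lambda>t. pairing (grad_at F' p) (\<psi>' 0 (t *\<^sub>R u))) = (\<lambda>t. 0)"
        by (rule has_derivative_unique)
      from fun_cong[OF this, of 1] have "pairing (grad_at F' p) (\<psi>' 0 (1 *\<^sub>R u)) = 0" .
      then have "pairing (grad_at F' p) u = 0" using \<open>\<psi>' 0 u = u\<close> by simp
      then show "((\<lambda>t. mpoly_eval f (($) (p + t *s u))) has_field_derivative 0) (at 0)"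
        using has_grad_line_derivative[OF F', of p u] by simp
    qed
  qed

  have upper: "k \<le> d" if Z: "\<forall>i\<le>k. proj_irreducible (Z i)" "\<forall>i<k. Z i \<subset> Z (Suc i)" "p \<in> Z 0" "Z k \<subseteq> V" for k Z
  proof -
    have "k + 1 + card R \<le> CARD('v)"
      by (rule chain_bound[of k Z p R G dG]) (use Z V_zero regular_point_axioms in auto)
    then show ?thesis using dim d by simp
  qed

  \<comment> \<open>A flag of subspaces of the tangent space yields a chain of maximal length.\<close>
  obtain b where b: "indep_fam {..d} b" "b 0 = p" "\<And>i. i \<le> d \<Longrightarrow> b i \<in> tangent"
    using indep_fam_basis[OF sub pT \<open>p \<noteq> 0\<close> d] by blast
  obtain s where s: "\<And>i j. i \<le> d \<Longrightarrow> j \<le> d \<Longrightarrow> pairing (b i) (s j) = (if i = j then 1 else 0)"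
    using indep_fam_dual[OF _ b(1)] by auto
  obtain \<epsilon> where \<epsilon>: "\<epsilon> > 0" "ball 0 \<epsilon> \<subseteq> W" using W openE by blast
  define L where "L i = vec.span (b ` {..i})" for i
  define Q where "Q i = \<psi> ` (ball 0 \<epsilon> \<inter> L i)" for i
  define Z where "Z i = zariski_closure (Q i)" for i
  have L_tangent: "L i \<subseteq> tangent" if "i \<le> d" for i
    unfolding L_def using that b(3) by (intro vec.span_minimal sub) auto
  have L_mono: "L i \<subseteq> L (Suc i)" for i unfolding L_def by (intro vec.span_mono) auto
  have QS: "Q i \<subseteq> S R G H" if "i \<le> d" for i
    using \<psi>S L_tangent[OF that] \<epsilon>(2) unfolding Q_def by blast
  have Q0: "0 \<notin> Q i" if "i \<le> d" for i using QS[OF that] by (auto simp: S_def)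
  have pQ: "p \<in> Q i" for i
    unfolding Q_def using \<epsilon>(1) \<psi>0 by (intro image_eqI[of _ _ 0]) (auto simp: L_def vec.span_zero)
  have irr: "proj_irreducible (Z i)" if i: "i \<le> d" for i
    unfolding Z_def
  proof (rule zariski_closure_irreducible)
    show "Q i \<noteq> {}" using pQ by blast
    show "0 \<notin> Q i" using Q0 i by blast
    fix d e F E assume *: "is_form d F" "is_form e E" "\<And>z. z \<in> Q i \<Longrightarrow> F (($) z) = 0 \<or> E (($) z) = 0"
    show "(\<forall>z\<in>Q i. F (($) z) = 0) \<or> (\<forall>z\<in>Q i. E (($) z) = 0)"
      unfolding Q_def
    proof (rule holomorphic_image_prime[OF convex_ball open_ball, where \<psi>' = \<psi>'])
      show "vec.subspace (L i)" unfolding L_def by (rule vec.subspace_span)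
    qed (use der \<psi>'_smult \<epsilon>(2) is_form_polyfun[OF *(1)] is_form_polyfun[OF *(2)] *(3) in \<open>auto simp: Q_def\<close>)
  qed
  have ZV: "Z i \<subseteq> V" if "i \<le> d" for i
    unfolding Z_def using QS[OF that] SV by (intro zariski_closure_minimal closed) auto
  define \<pi> where "\<pi> z = z - (\<Sum>e\<in>R. pairing (grad_at (dG e) p) z *s dual e)" for z
  have \<pi>\<psi>: "\<pi> (\<psi> w) = p + w" if "w \<in> W" "w \<in> tangent" for w
  proof -
    have "G e (($) (\<psi> w)) = 0" "pairing (grad_at (dG e) p) p = 0" if "e \<in> R" for e
      using \<psi>S[OF \<open>w \<in> W\<close> \<open>w \<in> tangent\<close>] that pT unfolding S_def tangent_def by auto
    then have "flat (\<psi> w) = \<psi> w - p + (\<Sum>e\<in>R. (- pairing (grad_at (dG e) p) (\<psi> w)) *s dual e)"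
      unfolding flat_def by (intro arg_cong2[where f = "(+)"] sum.cong refl) simp
    then show ?thesis
      using flat_\<psi>[OF that(1)] by (simp add: \<pi>_def vec.scale_minus_left sum_negf algebra_simps)
  qed
  define \<Phi> where "\<Phi> i x = pairing (\<pi> (\<chi> v. x v)) (s i)" for i x
  have \<Phi>_form: "is_form 1 (\<Phi> i)" for i
    unfolding \<Phi>_def[abs_def]
    by (rule is_form_linear[of "\<lambda>z. pairing (\<pi> z) (s i)"])
      (simp_all add: \<pi>_def pairing_def sum.distrib algebra_simps sum_distrib_left sum_distrib_right sum_subtractf)
  have \<Phi>\<psi>: "\<Phi> i (($) (\<psi> w)) = pairing (p + w) (s i)" if "w \<in> W" "w \<in> tangent" for w i
  proof -
    have "(\<chi> v. \<psi> w $ v) = \<psi> w" by (simp add: vec_eq_iff)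
    then show ?thesis using \<pi>\<psi>[OF that] by (simp add: \<Phi>_def)
  qed
  have strict: "Z i \<subset> Z (Suc i)" if i: "i < d" for i
  proof
    have "Q i \<subseteq> Q (Suc i)" unfolding Q_def using L_mono by blast
    then show "Z i \<subseteq> Z (Suc i)"
      unfolding Z_def using zariski_closure_supset[of "Q (Suc i)"] i
      by (intro zariski_closure_minimal zariski_closure_closed Q0) auto
    have L0: "pairing w (s (Suc i)) = 0" if "w \<in> L i" for w
      using that unfolding L_def
    proof (induction rule: vec.span_induct_alt)
      case (step c x y)
      then show ?case using i s by auto
    qed (simp add: pairing_def)
    have p0: "pairing p (s (Suc i)) = 0" using s[of 0 "Suc i"] b(2) i by simp
    define \<delta> where "\<delta> = \<epsilon> / (2 * (norm (b (Suc i)) + 1))"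
    have \<delta>: "\<delta> > 0" using \<epsilon>(1) by (simp add: \<delta>_def add_nonneg_pos)
    define w where "w = \<delta> *\<^sub>R b (Suc i)"
    have w_smult: "w = of_real \<delta> *s b (Suc i)"
      unfolding w_def by (simp add: vec_eq_iff scaleR_conv_of_real[where 'a = complex])
    have wL: "w \<in> L (Suc i)" unfolding w_smult L_def by (intro vec.span_scale vec.span_base) auto
    have "norm w < \<epsilon>"
    proof -
      have "norm w = \<epsilon> * (norm (b (Suc i)) / (2 * (norm (b (Suc i)) + 1)))"
        using \<delta> by (simp add: w_def) (simp add: \<delta>_def)
      also have "\<dots> < \<epsilon> * 1"
        using \<epsilon>(1) by (intro mult_strict_left_mono) (simp_all add: divide_simps add_nonneg_pos)
      finally show ?thesis by simp
    qed
    then have w: "\<psi> w \<in> Q (Suc i)" "w \<in> W" "w \<in> tangent"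
      using wL \<epsilon>(2) L_tangent[of "Suc i"] i by (auto simp: Q_def)
    have "pairing w (s (Suc i)) \<noteq> 0"
      using \<delta> s[of "Suc i" "Suc i"] i by (simp add: w_smult)
    then have "\<Phi> (Suc i) (($) (\<psi> w)) \<noteq> 0" using \<Phi>\<psi>[OF w(2,3)] p0 by simp
    moreover have "\<Phi> (Suc i) (($) z) = 0" if "z \<in> Z i" for z
    proof -
      have "\<Phi> (Suc i) (($) x) = 0" if "x \<in> Q i" for x
        using that \<Phi>\<psi> L_tangent[of i] i \<epsilon>(2) p0 L0 by (auto simp: Q_def subset_iff)
      then have Q: "\<forall>x\<in>Q i. \<Phi> (Suc i) (($) x) = 0" by blast
      have "z \<in> zariski_closure (Q i)" "0 \<notin> Q i" using that Q0 i by (auto simp: Z_def)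
      then have "\<forall>d F. is_form d F \<longrightarrow> (\<forall>x\<in>Q i. F (($) x) = 0) \<longrightarrow> F (($) z) = 0"
        by (simp add: zariski_closure_eq)
      then show ?thesis using \<Phi>_form Q by blast
    qed
    ultimately have "\<psi> w \<notin> Z i" by blast
    moreover have "\<psi> w \<in> Z (Suc i)" unfolding Z_def using w(1) zariski_closure_supset by blast
    ultimately show "Z i \<noteq> Z (Suc i)" by blast
  qed
  have "local_dim V p = enat d"
    unfolding local_dim_def
  proof (rule antisym)
    show "(SUP k\<in>{k. \<exists>Z. (\<forall>i\<le>k. proj_irreducible (Z i)) \<and> (\<forall>i<k. Z i \<subset> Z (Suc i)) \<and> p \<in> Z 0 \<and> Z k \<subseteq> V}. enat k) \<le> enat d"
      using upper by (intro SUP_least) auto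
    have "p \<in> Z 0" unfolding Z_def using pQ zariski_closure_supset by blast
    then show "enat d \<le> (SUP k\<in>{k. \<exists>Z. (\<forall>i\<le>k. proj_irreducible (Z i)) \<and> (\<forall>i<k. Z i \<subset> Z (Suc i)) \<and> p \<in> Z 0 \<and> Z k \<subseteq> V}. enat k)"
      using irr strict ZV by (intro SUP_upper) blast
  qed
  then have "smooth_at V p"
    unfolding smooth_at_def tangent d by (simp add: one_enat_def)
  then show ?thesis by (simp add: V_def)
qed

section \<open>The graphical model on the torus\<close>

definition supp :: "'n profile \<Rightarrow> 'n set" where
  "supp j = {i. j i \<noteq> 1}"

definition clique :: "('n \<times> 'n) set \<Rightarrow> 'n set \<Rightarrow> bool" where
  "clique E S \<longleftrightarrow> (\<forall>a\<in>S. \<forall>b\<in>S. a \<noteq> b \<longrightarrow> (a, b) \<in> E)"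

definition noncliques :: "('n \<times> 'n) set \<Rightarrow> 'n profile set" where
  "noncliques E = {j. \<not> clique E (supp j)}"

text \<open>A fixed pair of distinct nonadjacent players among those who play their second strategy.\<close>

definition gap :: "('n \<times> 'n) set \<Rightarrow> 'n profile \<Rightarrow> 'n \<times> 'n" where
  "gap E j = (SOME (a, b). a \<in> supp j \<and> b \<in> supp j \<and> a \<noteq> b \<and> (a, b) \<notin> E)"

lemma gap:
  assumes "j \<in> noncliques E" "gap E j = (a, b)"
  shows "a \<in> supp j" "b \<in> supp j" "a \<noteq> b" "(a, b) \<notin> E"
proof -
  have "\<exists>x. case x of (a, b) \<Rightarrow> a \<in> supp j \<and> b \<in> supp j \<and> a \<noteq> b \<and> (a, b) \<notin> E"
    using assms(1) unfolding noncliques_def clique_def by auto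
  from someI_ex[OF this] show "a \<in> supp j" "b \<in> supp j" "a \<noteq> b" "(a, b) \<notin> E"
    using assms(2) unfolding gap_def by auto
qed

text \<open>The equation of one conditional independence statement of the chosen pair given all other players. The quadric
  of \<open>j\<close> involves, besides \<open>x j\<close>, only profiles of smaller support.\<close>

definition ci_quadric :: "('n \<times> 'n) set \<Rightarrow> 'n profile \<Rightarrow> ('n profile \<Rightarrow> 'a::comm_ring_1) \<Rightarrow> 'a" where
  "ci_quadric E j x = (case gap E j of (a, b) \<Rightarrow>
    x j * x (j(a := 1, b := 1)) - x (j(a := 1)) * x (j(b := 1)))"

lemma two_cases: "x = 1 \<or> x = (2::2)"
  using exhaust_2[of x] by auto

lemma one_neq_two [simp]: "(1::2) \<noteq> 2" "(2::2) \<noteq> 1"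
  by simp_all

lemma supp_update [simp]: "supp (j(a := 1)) = supp j - {a}"
  by (auto simp: supp_def)

definition indicator_profile :: "'n set \<Rightarrow> 'n profile" where
  "indicator_profile S = (\<lambda>i. if i \<in> S then 2 else 1)"

lemma indicator_supp [simp]: "indicator_profile (supp j) = j"
  using two_cases by (fastforce simp: indicator_profile_def supp_def fun_eq_iff)

lemma supp_indicator [simp]: "supp (indicator_profile S) = S"
  by (auto simp: indicator_profile_def supp_def)

lemma indicator_update: "(indicator_profile S)(a := 1) = indicator_profile (S - {a})"
  by (auto simp: indicator_profile_def fun_eq_iff)

text \<open>Solve for \<open>\<theta> S\<close> by recursion on the size of \<open>S\<close>.\<close>

lemma multiplicative_moebius:
  fixes y :: "'n::finite set \<Rightarrow> 'a::field"
  assumes "\<And>S. y S \<noteq> 0"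
  shows "\<exists>\<theta>. (\<forall>A. \<theta> A \<noteq> 0) \<and> (\<forall>S. y S = (\<Prod>A\<in>Pow S. \<theta> A))"
proof -
  have "\<exists>\<theta>. (\<forall>A. \<theta> A \<noteq> 0) \<and> (\<forall>S. card S < n \<longrightarrow> y S = (\<Prod>A\<in>Pow S. \<theta> A))" for n
  proof (induction n)
    case 0
    show ?case by (rule exI[of _ "\<lambda>_. 1"]) simp
  next
    case (Suc n)
    then obtain \<theta> where \<theta>: "\<And>A. \<theta> A \<noteq> 0" "\<And>S. card S < n \<Longrightarrow> y S = (\<Prod>A\<in>Pow S. \<theta> A)" by blast
    define \<theta>' where "\<theta>' S = (if card S = n then y S / (\<Prod>A\<in>Pow S - {S}. \<theta> A) else \<theta> S)" for S
    have "\<theta>' A \<noteq> 0" for A using assms \<theta>(1) by (simp add: \<theta>'_def)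
    moreover have "y S = (\<Prod>A\<in>Pow S. \<theta>' A)" if "card S < Suc n" for S
    proof -
      have lt: "card A < card S" if "A \<in> Pow S - {S}" for A
        using that by (intro psubset_card_mono) auto
      have eq: "(\<Prod>A\<in>Pow S. f A) = f S * (\<Prod>A\<in>Pow S - {S}. f A)" for f :: "'n set \<Rightarrow> 'a"
        by (rule prod.remove) auto
      have "(\<Prod>A\<in>Pow S - {S}. \<theta>' A) = (\<Prod>A\<in>Pow S - {S}. \<theta> A)"
      proof (rule prod.cong)
        fix A assume "A \<in> Pow S - {S}"
        from lt[OF this] that show "\<theta>' A = \<theta> A" by (simp add: \<theta>'_def)
      qed simp
      then show ?thesis
        using that \<theta> eq[of \<theta>'] eq[of \<theta>] by (cases "card S = n") (simp_all add: \<theta>'_def)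
    qed
    ultimately show ?case by blast
  qed
  from this[of "Suc (CARD('n))"] show ?thesis
    by (simp add: card_mono less_Suc_eq_le)
qed

text \<open>The multiplicative Moebius transform of a point of the torus is trivial on every set that is not a
  clique, as the quadric of that set says, inductively, that the product of the transform over all subsets
  which contain the chosen pair of nonadjacent vertices is \<open>1\<close>.\<close>

lemma clique_factorization:
  fixes z :: "complex ^ ('n::finite) profile"
  assumes nz: "\<And>j. z $ j \<noteq> 0"
    and quad: "\<And>j. j \<in> noncliques E \<Longrightarrow> ci_quadric E j (($) z) = 0"
  shows "\<exists>\<theta>. \<forall>j. z $ j = (\<Prod>A\<in>{A. clique E A}. if A \<subseteq> supp j then \<theta> A else 1)"
proof -
  define y where "y S = z $ indicator_profile S" for S
  obtain \<theta> where \<theta>: "\<And>A. \<theta> A \<noteq> 0" "\<And>S. y S = (\<Prod>A\<in>Pow S. \<theta> A)"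
    using multiplicative_moebius[of y] nz by (auto simp: y_def)
  have triv: "\<theta> S = 1" if "\<not> clique E S" for S
    using that
  proof (induction "card S" arbitrary: S rule: less_induct)
    case less
    obtain a b where ab: "gap E (indicator_profile S) = (a, b)" by force
    have S: "indicator_profile S \<in> noncliques E" using less.prems by (simp add: noncliques_def)
    note g = gap[OF S ab, simplified]
    have q: "y S * y (S - {a} - {b}) = y (S - {a}) * y (S - {b})"
      using quad[OF S] by (simp add: ci_quadric_def ab indicator_update y_def)
    define X where "X = {A. A \<subseteq> S \<and> a \<in> A \<and> b \<in> A}"
    have "(\<Prod>A\<in>Pow S. \<theta> A) = (\<Prod>A\<in>Pow (S - {a}) \<union> Pow (S - {b}). \<theta> A) * (\<Prod>A\<in>X. \<theta> A)"
    proof (subst prod.union_disjoint[symmetric])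
      show "(\<Prod>A\<in>Pow S. \<theta> A) = (\<Prod>A\<in>Pow (S - {a}) \<union> Pow (S - {b}) \<union> X. \<theta> A)"
        by (intro prod.cong refl) (auto simp: X_def)
    qed (auto simp: X_def)
    moreover have "(\<Prod>A\<in>Pow (S - {a}) \<union> Pow (S - {b}). \<theta> A) * (\<Prod>A\<in>Pow (S - {a}) \<inter> Pow (S - {b}). \<theta> A)
        = y (S - {a}) * y (S - {b})"
      unfolding \<theta>(2) by (rule prod.union_inter) auto
    moreover have "Pow (S - {a}) \<inter> Pow (S - {b}) = Pow (S - {a} - {b})" by blast
    ultimately have "y S * y (S - {a} - {b}) = y (S - {a}) * y (S - {b}) * (\<Prod>A\<in>X. \<theta> A)"
      using \<theta>(2)[of S] \<theta>(2)[of "S - {a} - {b}"] by (simp add: ac_simps)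
    then have "(\<Prod>A\<in>X. \<theta> A) = 1" using q nz by (simp add: y_def)
    moreover have "(\<Prod>A\<in>X. \<theta> A) = \<theta> S * (\<Prod>A\<in>X - {S}. \<theta> A)"
      using g by (intro prod.remove) (auto simp: X_def)
    moreover have "(\<Prod>A\<in>X - {S}. \<theta> A) = 1"
    proof (rule prod.neutral, rule ballI)
      fix A assume "A \<in> X - {S}"
      then have "A \<subset> S" "a \<in> A" "b \<in> A" by (auto simp: X_def)
      then show "\<theta> A = 1"
        using g by (intro less.hyps psubset_card_mono) (auto simp: clique_def)
    qed
    ultimately show "\<theta> S = 1" by simp
  qed
  have "z $ j = (\<Prod>A\<in>{A. clique E A}. if A \<subseteq> supp j then \<theta> A else 1)" for j
  proof -
    have "z $ j = (\<Prod>A\<in>Pow (supp j). \<theta> A)" using \<theta>(2)[of "supp j"] by (simp add: y_def)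
    also have "\<dots> = (\<Prod>A\<in>Pow (supp j) \<inter> {A. clique E A}. \<theta> A)"
      using triv by (intro prod.mono_neutral_right) auto
    also have "\<dots> = (\<Prod>A\<in>{A. clique E A} \<inter> {A. A \<subseteq> supp j}. \<theta> A)" by (intro prod.cong) auto
    also have "\<dots> = (\<Prod>A\<in>{A. clique E A}. if A \<subseteq> supp j then \<theta> A else 1)"
      by (simp add: prod.inter_restrict)
    finally show ?thesis .
  qed
  then show ?thesis by blast
qed

definition reachable :: "('n \<times> 'n) set \<Rightarrow> 'n set \<Rightarrow> 'n set \<Rightarrow> 'n set" where
  "reachable E A C = {v. \<exists>xs. graph_path E xs \<and> hd xs \<in> A \<and> last xs = v \<and> set xs \<inter> C = {}}"

lemma reachable_start: "A \<inter> C = {} \<Longrightarrow> A \<subseteq> reachable E A C"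
proof (rule subsetI)
  fix v assume "A \<inter> C = {}" "v \<in> A"
  then show "v \<in> reachable E A C"
    by (auto simp: reachable_def graph_path_def intro!: exI[of _ "[v]"])
qed

lemma reachable_disjoint: "reachable E A C \<inter> C = {}"
  unfolding reachable_def graph_path_def by (auto dest: last_in_set)

lemma reachable_separates: "separates E C A B \<Longrightarrow> reachable E A C \<inter> B = {}"
  unfolding reachable_def separates_def by blast

text \<open>Paths are required to be free of repetitions, so a walk that returns to \<open>v\<close> has to be cut off there.\<close>

lemma reachable_step:
  assumes "u \<in> reachable E A C" "(u, v) \<in> E" "v \<notin> C"
  shows "v \<in> reachable E A C"
proof -
  obtain xs where xs: "xs \<noteq> []" "distinct xs" "successively (\<lambda>u v. (u, v) \<in> E) xs" "hd xs \<in> A"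
      "last xs = u" "set xs \<inter> C = {}"
    using assms(1) unfolding reachable_def graph_path_def by blast
  show ?thesis
  proof (cases "v \<in> set xs")
    case False
    have "graph_path E (xs @ [v])"
      using xs False assms(2) by (auto simp: graph_path_def successively_append_iff)
    then show ?thesis
      unfolding reachable_def using xs assms(3) by (intro CollectI exI[of _ "xs @ [v]"]) auto
  next
    case True
    then obtain ys zs where yz: "xs = ys @ v # zs" by (meson split_list)
    have "graph_path E (ys @ [v])"
      using xs unfolding graph_path_def yz by (auto simp: successively_append_iff)
    moreover have "hd (ys @ [v]) = hd xs" unfolding yz by (cases ys) auto
    ultimately show ?thesis
      unfolding reachable_def using xs unfolding yz by (intro CollectI exI[of _ "ys @ [v]"]) auto
  qed
qed

text \<open>Let \<open>V\<close> be the set of vertices that can be reached from \<open>A\<close> outside of \<open>C\<close>. Every clique lies in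
  \<open>V \<union> C\<close> or misses \<open>V\<close>, so the factors split into two groups and each marginal is a product.\<close>

lemma factorization_imp_ci:
  fixes z :: "complex ^ ('n::finite) profile"
  assumes fac: "\<And>j. z $ j = (\<Prod>K\<in>{K. clique E K}. if K \<subseteq> supp j then \<theta> K else 1)"
    and ABC: "(A, B, C) \<in> global_markov E"
  shows "marginal z A a B b C c * marginal z A a' B b' C c
    - marginal z A a B b' C c * marginal z A a' B b C c = 0"
proof -
  define V where "V = reachable E A C"
  have V: "A \<subseteq> V" "V \<inter> B = {}" "V \<inter> C = {}"
    using ABC reachable_start[of A C E] reachable_separates[of E C A B] reachable_disjoint[of E A C]
    by (auto simp: V_def global_markov_def)
  have step: "v \<in> V" if "u \<in> V" "(u, v) \<in> E" "v \<notin> C" for u v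
    using reachable_step[of u E A C v] that unfolding V_def by blast
  define w where "w K j = (if K \<subseteq> supp j then \<theta> K else 1)" for K and j :: "'n profile"
  define f where "f j = (\<Prod>K\<in>{K. clique E K \<and> K \<subseteq> V \<union> C}. w K j)" for j
  define g where "g j = (\<Prod>K\<in>{K. clique E K \<and> \<not> K \<subseteq> V \<union> C}. w K j)" for j
  have fg: "z $ j = f j * g j" for j
    unfolding fac f_def g_def w_def[symmetric]
    by (subst prod.union_disjoint[symmetric]) (auto intro!: prod.cong)
  have f_cong: "f j = f k" if "\<And>v. v \<in> V \<union> C \<Longrightarrow> j v = k v" for j k
    unfolding f_def
  proof (rule prod.cong)
    fix K assume "K \<in> {K. clique E K \<and> K \<subseteq> V \<union> C}"
    then have "K \<subseteq> supp j \<longleftrightarrow> K \<subseteq> supp k" using that by (fastforce simp: supp_def)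
    then show "w K j = w K k" by (simp add: w_def)
  qed simp
  have g_cong: "g j = g k" if "\<And>v. v \<notin> V \<Longrightarrow> j v = k v" for j k
    unfolding g_def
  proof (rule prod.cong)
    fix K assume K: "K \<in> {K. clique E K \<and> \<not> K \<subseteq> V \<union> C}"
    then obtain v where v: "v \<in> K" "v \<notin> V" "v \<notin> C" by blast
    have "K \<inter> V = {}"
    proof (rule ccontr)
      assume "K \<inter> V \<noteq> {}"
      then obtain u where u: "u \<in> K" "u \<in> V" by blast
      then have "(u, v) \<in> E" using K v unfolding clique_def by auto
      then show False using step[OF u(2)] v by blast
    qed
    then have "K \<subseteq> supp j \<longleftrightarrow> K \<subseteq> supp k" using that by (fastforce simp: supp_def)
    then show "w K j = w K k" by (simp add: w_def)
  qed simp
  define S where "S a = {j. (\<forall>v\<in>A. j v = a v) \<and> (\<forall>v. v \<notin> V \<longrightarrow> j v = c v)}" for a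
  define T where "T b = {j. (\<forall>v\<in>B. j v = b v) \<and> (\<forall>v\<in>V \<union> C. j v = c v)}" for b
  have "marginal z A a B b C c = (\<Sum>j\<in>S a. f j) * (\<Sum>j\<in>T b. g j)" for a b
  proof -
    have "(\<Sum>j\<in>S a. f j) * (\<Sum>j\<in>T b. g j) = (\<Sum>(j, k)\<in>S a \<times> T b. f j * g k)"
      by (simp add: sum_product sum.cartesian_product)
    also have "\<dots> = marginal z A a B b C c"
      unfolding marginal_def
    proof (rule sum.reindex_bij_witness[where
          j = "\<lambda>(j, k) v. if v \<in> V then j v else k v" and
          i = "\<lambda>j. (\<lambda>v. if v \<in> V then j v else c v, \<lambda>v. if v \<in> V then c v else j v)"])
      fix x assume x: "x \<in> S a \<times> T b"
      then obtain j k where jk: "x = (j, k)" "j \<in> S a" "k \<in> T b" by blast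
      let ?l = "\<lambda>v. if v \<in> V then j v else k v"
      show "(\<lambda>j. (\<lambda>v. if v \<in> V then j v else c v, \<lambda>v. if v \<in> V then c v else j v))
          ((\<lambda>(j, k) v. if v \<in> V then j v else k v) x) = x"
        using jk by (auto simp: S_def T_def fun_eq_iff)
      show "(\<lambda>(j, k) v. if v \<in> V then j v else k v) x \<in>
          {j. (\<forall>v\<in>A. j v = a v) \<and> (\<forall>v\<in>B. j v = b v) \<and> (\<forall>v\<in>C. j v = c v)}"
        using jk V by (auto simp: S_def T_def)
      have "f ?l = f j" by (rule f_cong) (use jk V in \<open>auto simp: S_def T_def\<close>)
      moreover have "g ?l = g k" by (rule g_cong) simp
      ultimately show "z $ ((\<lambda>(j, k) v. if v \<in> V then j v else k v) x) = (case x of (j, k) \<Rightarrow> f j * g k)"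
        using jk by (simp add: fg)
    next
      fix j assume "j \<in> {j. (\<forall>v\<in>A. j v = a v) \<and> (\<forall>v\<in>B. j v = b v) \<and> (\<forall>v\<in>C. j v = c v)}"
      then show "(\<lambda>(j, k) v. if v \<in> V then j v else k v)
          ((\<lambda>v. if v \<in> V then j v else c v, \<lambda>v. if v \<in> V then c v else j v)) = j"
        "(\<lambda>v. if v \<in> V then j v else c v, \<lambda>v. if v \<in> V then c v else j v) \<in> S a \<times> T b"
        using V by (auto simp: S_def T_def fun_eq_iff)
    qed
    finally show ?thesis by simp
  qed
  then show ?thesis by (simp add: ac_simps)
qed

text \<open>Two nonadjacent vertices are separated by all the others, and the marginals of this statement are single
  coordinates.\<close>

lemma ci_imp_quadric:
  fixes z :: "complex ^ ('n::finite) profile"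
  assumes z: "z \<in> independence_model (global_markov E)" and j: "j \<in> noncliques E"
  shows "ci_quadric E j (($) z) = 0"
proof -
  obtain a b where ab: "gap E j = (a, b)" by force
  note g = gap[OF j ab]
  have "separates E (- {a, b}) {a} {b}"
    unfolding separates_def
  proof (intro allI impI notI)
    fix xs assume xs: "graph_path E xs \<and> hd xs \<in> {a} \<and> last xs \<in> {b}" "set xs \<inter> - {a, b} = {}"
    then obtain ys where ys: "xs = a # ys" unfolding graph_path_def by (cases xs) auto
    then obtain y zs where "ys = y # zs" using xs g(3) by (cases ys) auto
    then show False using xs g(4) ys by (auto simp: graph_path_def)
  qed
  then have "({a}, {b}, - {a, b}) \<in> global_markov E"
    using g(3) by (auto simp: global_markov_def)
  then have ci: "marginal z {a} \<alpha> {b} \<beta> (- {a, b}) j * marginal z {a} \<alpha>' {b} \<beta>' (- {a, b}) j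
      - marginal z {a} \<alpha> {b} \<beta>' (- {a, b}) j * marginal z {a} \<alpha>' {b} \<beta> (- {a, b}) j = 0" for \<alpha> \<alpha>' \<beta> \<beta>'
    using z unfolding independence_model_def by blast
  have marg: "marginal z {a} \<alpha> {b} \<beta> (- {a, b}) j = z $ (j(a := \<alpha> a, b := \<beta> b))" for \<alpha> \<beta>
  proof -
    have "{k. (\<forall>v\<in>{a}. k v = \<alpha> v) \<and> (\<forall>v\<in>{b}. k v = \<beta> v) \<and> (\<forall>v\<in>- {a, b}. k v = j v)}
        = {j(a := \<alpha> a, b := \<beta> b)}"
      using g(3) by (auto simp: fun_eq_iff split: if_splits)
    then show ?thesis unfolding marginal_def by simp
  qed
  have "j(a := 1, b := j b) = j(a := 1)" using g(3) by (auto simp: fun_eq_iff)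
  then show ?thesis
    using ci[of j j "j(a := 1)" "j(b := 1)"] g(3)
    by (simp add: marg ci_quadric_def ab fun_upd_twist)
qed

lemma independence_model_torus:
  fixes z :: "complex ^ ('n::finite) profile"
  assumes "\<And>j. z $ j \<noteq> 0"
  shows "z \<in> independence_model (global_markov E) \<longleftrightarrow> (\<forall>j\<in>noncliques E. ci_quadric E j (($) z) = 0)"
proof
  assume *: "\<forall>j\<in>noncliques E. ci_quadric E j (($) z) = 0"
  obtain \<theta> where "\<forall>j. z $ j = (\<Prod>A\<in>{A. clique E A}. if A \<subseteq> supp j then \<theta> A else 1)"
    using clique_factorization[OF assms, of E] * by auto
  then have "marginal z A a B b C c * marginal z A a' B b' C c
      - marginal z A a B b' C c * marginal z A a' B b C c = 0"
    if "(A, B, C) \<in> global_markov E" for A B C a a' b b' c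
    using factorization_imp_ci[OF _ that] by blast
  moreover have "z \<noteq> 0" using assms by (metis zero_index)
  ultimately show "z \<in> independence_model (global_markov E)" unfolding independence_model_def by blast
qed (use ci_imp_quadric in blast)

section \<open>The equations of the Spohn CI variety on the torus\<close>

definition spohn_poly :: "('n::finite \<times> 'n profile \<Rightarrow> 'a::comm_ring_1) \<Rightarrow> 'n \<Rightarrow> ('n profile \<Rightarrow> 'a) \<Rightarrow> 'a" where
  "spohn_poly X i x =
    (\<Sum>j\<in>{j. j i = 1}. x j) * (\<Sum>j\<in>{j. j i = 2}. X (i, j) * x j)
    - (\<Sum>j\<in>{j. j i = 1}. X (i, j) * x j) * (\<Sum>j\<in>{j. j i = 2}. x j)"

abbreviation kron :: "'b \<Rightarrow> 'b \<Rightarrow> 'a::comm_ring_1" where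
  "kron v w \<equiv> if v = w then 1 else 0"

definition ci_quadric_grad :: "('n \<times> 'n) set \<Rightarrow> 'n profile \<Rightarrow> 'n profile \<Rightarrow> ('n profile \<Rightarrow> 'a::comm_ring_1) \<Rightarrow> 'a" where
  "ci_quadric_grad E j v x = (case gap E j of (a, b) \<Rightarrow>
    (kron v j * x (j(a := 1, b := 1)) + x j * kron v (j(a := 1, b := 1)))
    - (kron v (j(a := 1)) * x (j(b := 1)) + x (j(a := 1)) * kron v (j(b := 1))))"

definition spohn_poly_grad ::
  "('n::finite \<times> 'n profile \<Rightarrow> 'a::comm_ring_1) \<Rightarrow> 'n \<Rightarrow> 'n profile \<Rightarrow> ('n profile \<Rightarrow> 'a) \<Rightarrow> 'a" where
  "spohn_poly_grad X i v x =
    ((\<Sum>j\<in>{j. j i = 1}. kron v j) * (\<Sum>j\<in>{j. j i = 2}. X (i, j) * x j)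
      + (\<Sum>j\<in>{j. j i = 1}. x j) * (\<Sum>j\<in>{j. j i = 2}. X (i, j) * kron v j))
    - ((\<Sum>j\<in>{j. j i = 1}. X (i, j) * kron v j) * (\<Sum>j\<in>{j. j i = 2}. x j)
      + (\<Sum>j\<in>{j. j i = 1}. X (i, j) * x j) * (\<Sum>j\<in>{j. j i = 2}. kron v j))"

text \<open>The quadrics of the graphical model and the Spohn equations form one family, as only their joint
  transversality matters. The number of equations does not depend on the game.\<close>

definition eq_index :: "('n \<times> 'n) set \<Rightarrow> ('n profile + 'n) set" where
  "eq_index E = noncliques E <+> UNIV"

definition eq_fun :: "('n \<times> 'n) set \<Rightarrow> ('n::finite \<times> 'n profile \<Rightarrow> 'a::comm_ring_1) \<Rightarrow>
    'n profile + 'n \<Rightarrow> ('n profile \<Rightarrow> 'a) \<Rightarrow> 'a" where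
  "eq_fun E X e = (case e of Inl j \<Rightarrow> ci_quadric E j | Inr i \<Rightarrow> spohn_poly X i)"

definition eq_grad :: "('n \<times> 'n) set \<Rightarrow> ('n::finite \<times> 'n profile \<Rightarrow> 'a::comm_ring_1) \<Rightarrow>
    'n profile + 'n \<Rightarrow> 'n profile \<Rightarrow> ('n profile \<Rightarrow> 'a) \<Rightarrow> 'a" where
  "eq_grad E X e = (case e of Inl j \<Rightarrow> ci_quadric_grad E j | Inr i \<Rightarrow> spohn_poly_grad X i)"

lemma finite_eq_index: "finite (eq_index (E :: ('n::finite \<times> 'n) set))"
  by simp

lemma has_grad_ci_quadric: "has_grad (ci_quadric E j) (ci_quadric_grad E j)"
proof -
  obtain a b where ab: "gap E j = (a, b)" by force
  show ?thesis
    unfolding ci_quadric_def[abs_def] ci_quadric_grad_def[abs_def] ab prod.case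
    by (intro has_grad_diff has_grad_mult has_grad_var)
qed

lemma has_grad_cmult: "has_grad F F' \<Longrightarrow> has_grad (\<lambda>x. c * F x) (\<lambda>v x. c * F' v x)"
  using has_grad_mult[OF has_grad_const[of c]] by fastforce

lemma has_grad_spohn_poly: "has_grad (spohn_poly X i) (spohn_poly_grad X i)"
  unfolding spohn_poly_def[abs_def] spohn_poly_grad_def[abs_def]
  by (intro has_grad_diff has_grad_mult has_grad_sum has_grad_cmult has_grad_var)

lemma has_grad_eq_fun: "has_grad (eq_fun E X e) (eq_grad E X e)"
  unfolding eq_fun_def eq_grad_def by (cases e) (simp_all add: has_grad_ci_quadric has_grad_spohn_poly)

lemma is_form_eq_fun:
  fixes E :: "('n::finite \<times> 'n) set" and X :: "'n \<times> 'n profile \<Rightarrow> 'a::comm_ring_1"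
  shows "is_form 2 (eq_fun E X e)"
proof -
  have var: "is_form (1 + 1) (\<lambda>x. F x * G x)" if "is_form 1 F" "is_form 1 G" for F G :: "('n profile \<Rightarrow> 'a) \<Rightarrow> 'a"
    using that by (rule is_form_mult)
  have "is_form (1 + 1) (eq_fun E X e)"
  proof (cases e)
    case (Inl j)
    then show ?thesis
      unfolding eq_fun_def ci_quadric_def[abs_def]
      by (simp only: sum.case split_def) (intro is_form_diff var is_form_var)
  next
    case (Inr i)
    then show ?thesis
      unfolding eq_fun_def spohn_poly_def[abs_def]
      by (simp only: sum.case) (intro is_form_diff var is_form_sum is_form_cmult is_form_var)
  qed
  then show ?thesis by (simp add: numeral_2_eq_2)
qed

lemma det_spohn_matrix:
  "det (spohn_matrix X i p) = spohn_poly (\<lambda>(i, j). complex_of_real (X $ i $ j)) i (($) p)"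
  by (simp add: det_2 spohn_matrix_def spohn_poly_def)

text \<open>One form for all the excluded hyperplanes, as \<open>smooth_at_transversal\<close> removes the zeros of a single form.\<close>

definition boundary_form :: "('n::finite profile \<Rightarrow> 'a::comm_ring_1) \<Rightarrow> 'a" where
  "boundary_form x = (\<Prod>j\<in>UNIV. x j) * (\<Sum>j\<in>UNIV. x j)"

lemma is_form_boundary_form:
  "is_form (CARD('n::finite profile) + 1) (boundary_form :: ('n profile \<Rightarrow> 'a::comm_ring_1) \<Rightarrow> 'a)"
proof -
  have 1: "is_form (\<Sum>j\<in>(UNIV :: 'n profile set). 1) (\<lambda>x :: 'n profile \<Rightarrow> 'a. \<Prod>j\<in>UNIV. x j)"
    by (rule is_form_prod) (rule is_form_var)
  have 2: "is_form 1 (\<lambda>x :: 'n profile \<Rightarrow> 'a. \<Sum>j\<in>UNIV. x j)"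
    by (intro is_form_sum is_form_var)
  from is_form_mult[OF 1 2] show ?thesis unfolding boundary_form_def[abs_def] by simp
qed

lemma spohn_ci_variety_eq:
  "spohn_ci_variety X (global_markov E) = zariski_closure {z. z \<noteq> 0 \<and>
    (\<forall>e\<in>eq_index E. eq_fun E (\<lambda>(i, j). complex_of_real (X $ i $ j)) e (($) z) = 0) \<and> boundary_form (($) z) \<noteq> 0}"
  unfolding spohn_ci_variety_def
proof (rule arg_cong[where f = zariski_closure], intro set_eqI)
  fix z :: "complex ^ 'a profile"
  have *: "boundary_form (($) z) \<noteq> 0 \<longleftrightarrow> (\<forall>j. z $ j \<noteq> 0) \<and> (\<Sum>j\<in>UNIV. z $ j) \<noteq> 0"
    by (simp add: boundary_form_def)
  have "(\<forall>e\<in>eq_index E. eq_fun E X e x = 0) \<longleftrightarrow>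
      (\<forall>j\<in>noncliques E. ci_quadric E j x = 0) \<and> (\<forall>i. spohn_poly X i x = 0)" for X :: "_ \<Rightarrow> complex" and x
    by (simp add: eq_index_def eq_fun_def Plus_def ball_Un)
  then show "z \<in> spohn_variety X \<inter> independence_model (global_markov E) - hyperplanes \<longleftrightarrow>
    z \<in> {z. z \<noteq> 0 \<and> (\<forall>e\<in>eq_index E. eq_fun E (\<lambda>(i, j). complex_of_real (X $ i $ j)) e (($) z) = 0) \<and> boundary_form (($) z) \<noteq> 0}"
    using independence_model_torus[of z E]
    by (auto simp: * spohn_variety_def det_spohn_matrix hyperplanes_def)
qed

section \<open>Transversality for generic payoffs\<close>

text \<open>The quadrics are triangular with respect to the size of the support: if \<open>k\<close> has maximal support among
  the profiles that occur in a relation, then \<open>x k\<close> occurs in no other quadric of the relation.\<close>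

lemma ci_quadrics_independent:
  fixes x :: "'n::finite profile \<Rightarrow> 'a::field"
  assumes nz: "\<And>j. x j \<noteq> 0"
    and rel: "\<And>v. (\<Sum>j\<in>noncliques E. c j * ci_quadric_grad E j v x) = 0"
    and j: "j \<in> noncliques E"
  shows "c j = 0"
proof (rule ccontr)
  assume "c j \<noteq> 0"
  define A where "A = {j\<in>noncliques E. c j \<noteq> 0}"
  have "A \<noteq> {}" "finite A" using j \<open>c j \<noteq> 0\<close> by (auto simp: A_def)
  then have "\<exists>k\<in>A. card (supp k) = Max ((\<lambda>j. card (supp j)) ` A)"
    using Max_in[of "(\<lambda>j. card (supp j)) ` A"] by fastforce
  then obtain k where k: "k \<in> A" "\<And>l. l \<in> A \<Longrightarrow> card (supp l) \<le> card (supp k)"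
    using \<open>finite A\<close> by (metis (no_types, lifting) Max_ge finite_imageI imageI)
  have other: "c l * ci_quadric_grad E l k x = 0" if l: "l \<in> noncliques E" "l \<noteq> k" for l
  proof (cases "c l = 0")
    case False
    obtain a b where ab: "gap E l = (a, b)" by force
    note g = gap[OF l(1) ab]
    have le: "card (supp l) \<le> card (supp k)" using k(2) l False by (simp add: A_def)
    have "card (supp (l(a := 1))) < card (supp l)" "card (supp (l(b := 1))) < card (supp l)"
      "card (supp (l(a := 1, b := 1))) < card (supp l)"
      using g by (auto simp del: card_Diff_insert intro!: psubset_card_mono)
    then have "k \<noteq> l(a := 1)" "k \<noteq> l(b := 1)" "k \<noteq> l(a := 1, b := 1)" using le by auto
    then show ?thesis using l(2) by (simp add: ci_quadric_grad_def ab)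
  qed simp
  obtain a b where ab: "gap E k = (a, b)" by force
  have kN: "k \<in> noncliques E" using k(1) by (simp add: A_def)
  note g = gap[OF kN ab]
  have "k \<noteq> k(a := 1)" "k \<noteq> k(b := 1)" "k \<noteq> k(a := 1, b := 1)"
    using g by (auto simp: supp_def fun_eq_iff)
  then have "ci_quadric_grad E k k x = x (k(a := 1, b := 1))"
    by (simp add: ci_quadric_grad_def ab)
  moreover have "(\<Sum>l\<in>noncliques E - {k}. c l * ci_quadric_grad E l k x) = 0"
    using other by (intro sum.neutral) blast
  then have "(\<Sum>l\<in>noncliques E. c l * ci_quadric_grad E l k x) = c k * ci_quadric_grad E k k x"
    using sum.remove[OF _ kN, of "\<lambda>l. c l * ci_quadric_grad E l k x"] by simp
  ultimately have "c k * x (k(a := 1, b := 1)) = 0" using rel[of k] by simp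
  then show False using nz k(1) by (simp add: A_def)
qed

text \<open>The coefficient of a payoff of player \<open>i\<close> in the Spohn equation of that player.\<close>

definition payoff_coeff :: "'n::finite \<Rightarrow> 'n profile \<Rightarrow> ('n profile \<Rightarrow> 'a::comm_ring_1) \<Rightarrow> 'a" where
  "payoff_coeff i j x = (if j i = 2 then (\<Sum>k\<in>{k. k i = 1}. x k) * x j else - (x j * (\<Sum>k\<in>{k. k i = 2}. x k)))"

text \<open>All coefficients of player \<open>i\<close> vanish only if both marginal probabilities of that player do, and these sum
  to the total.\<close>

lemma payoff_coeff_nonzero:
  fixes x :: "'n::finite profile \<Rightarrow> 'a::field"
  assumes "\<And>j. x j \<noteq> 0" "(\<Sum>j\<in>UNIV. x j) \<noteq> 0"
  shows "\<exists>j. payoff_coeff i j x \<noteq> 0"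
proof -
  have "(\<Sum>j\<in>UNIV. x j) = (\<Sum>k\<in>{k. k i = 1}. x k) + (\<Sum>k\<in>{k. k i = 2}. x k)"
    using two_cases by (subst sum.union_disjoint[symmetric]) (auto intro!: sum.cong)
  then consider "(\<Sum>k\<in>{k. k i = 1}. x k) \<noteq> 0" | "(\<Sum>k\<in>{k. k i = 2}. x k) \<noteq> 0" using assms(2) by fastforce
  then show ?thesis
  proof cases
    case 1
    then show ?thesis using assms(1) by (intro exI[of _ "\<lambda>_. 2"]) (simp add: payoff_coeff_def)
  next
    case 2
    then show ?thesis using assms(1) by (intro exI[of _ "\<lambda>_. 1"]) (simp add: payoff_coeff_def)
  qed
qed

text \<open>Payoffs and probabilities are variables on an equal footing here, tagged by \<open>Inl\<close> and \<open>Inr\<close>.\<close>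

definition joint_grad :: "('n \<times> 'n) set \<Rightarrow> 'n profile + 'n \<Rightarrow> ('n::finite \<times> 'n profile) + 'n profile \<Rightarrow>
    (('n \<times> 'n profile) + 'n profile \<Rightarrow> 'a::comm_ring_1) \<Rightarrow> 'a" where
  "joint_grad E e w b = (case w of
     Inr v \<Rightarrow> eq_grad E (\<lambda>k. b (Inl k)) e v (\<lambda>j. b (Inr j))
   | Inl (i, j) \<Rightarrow> (case e of Inl k \<Rightarrow> 0 | Inr i' \<Rightarrow> if i = i' then payoff_coeff i j (\<lambda>j. b (Inr j)) else 0))"

lemma has_grad_joint:
  "has_grad (\<lambda>b. eq_fun E (\<lambda>k. b (Inl k)) e (\<lambda>j. b (Inr j))) (joint_grad E e)"
proof (cases e)
  case (Inl k)
  obtain a b where ab: "gap E k = (a, b)" by force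
  have "has_grad (\<lambda>b. ci_quadric E k (\<lambda>j. b (Inr j))) (\<lambda>w b'. (kron w (Inr k) * b' (Inr (k(a := 1, b := 1))) + b' (Inr k) * kron w (Inr (k(a := 1, b := 1))))
    - (kron w (Inr (k(a := 1))) * b' (Inr (k(b := 1))) + b' (Inr (k(a := 1))) * kron w (Inr (k(b := 1)))))"
    unfolding ci_quadric_def ab prod.case
    by (intro has_grad_diff has_grad_mult has_grad_var)
  then show ?thesis
    by (rule has_grad_cong)
      (auto simp: Inl eq_fun_def joint_grad_def eq_grad_def ci_quadric_grad_def ab split: sum.split prod.split)
next
  case (Inr i)
  have "has_grad (\<lambda>b. spohn_poly (\<lambda>k. b (Inl k)) i (\<lambda>j. b (Inr j))) (\<lambda>w b.
     ((\<Sum>j\<in>{j. j i = 1}. kron w (Inr j)) * (\<Sum>j\<in>{j. j i = 2}. b (Inl (i, j)) * b (Inr j))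
      + (\<Sum>j\<in>{j. j i = 1}. b (Inr j)) * (\<Sum>j\<in>{j. j i = 2}. kron w (Inl (i, j)) * b (Inr j) + b (Inl (i, j)) * kron w (Inr j)))
    - ((\<Sum>j\<in>{j. j i = 1}. kron w (Inl (i, j)) * b (Inr j) + b (Inl (i, j)) * kron w (Inr j)) * (\<Sum>j\<in>{j. j i = 2}. b (Inr j))
      + (\<Sum>j\<in>{j. j i = 1}. b (Inl (i, j)) * b (Inr j)) * (\<Sum>j\<in>{j. j i = 2}. kron w (Inr j))))"
    unfolding spohn_poly_def
    by (intro has_grad_diff has_grad_mult has_grad_sum has_grad_var)
  then show ?thesis
  proof (rule has_grad_cong)
    fix w :: "('a \<times> 'a profile) + 'a profile" and b :: "('a \<times> 'a profile) + 'a profile \<Rightarrow> 'b"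
    have s: "(\<Sum>k\<in>{k. k i = t}. kron (i', j) (i, k) * b (Inr k)) = (if i' = i \<and> j i = t then b (Inr j) else 0)" for i' j t
      by (cases "i' = i") (simp_all add: if_distrib[of "\<lambda>a. a * _"] cong: if_cong)
    show "((\<Sum>j\<in>{j. j i = 1}. kron w (Inr j)) * (\<Sum>j\<in>{j. j i = 2}. b (Inl (i, j)) * b (Inr j))
      + (\<Sum>j\<in>{j. j i = 1}. b (Inr j)) * (\<Sum>j\<in>{j. j i = 2}. kron w (Inl (i, j)) * b (Inr j) + b (Inl (i, j)) * kron w (Inr j)))
    - ((\<Sum>j\<in>{j. j i = 1}. kron w (Inl (i, j)) * b (Inr j) + b (Inl (i, j)) * kron w (Inr j)) * (\<Sum>j\<in>{j. j i = 2}. b (Inr j))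
      + (\<Sum>j\<in>{j. j i = 1}. b (Inl (i, j)) * b (Inr j)) * (\<Sum>j\<in>{j. j i = 2}. kron w (Inr j)))
      = joint_grad E e w b"
    proof (cases w)
      case (Inr v)
      then show ?thesis
        by (simp add: joint_grad_def \<open>e = Inr i\<close> eq_grad_def spohn_poly_grad_def)
    next
      case (Inl q)
      obtain i' j where q: "q = (i', j)" by force
      show ?thesis
        using two_cases[of "j i"]
        by (auto simp: joint_grad_def \<open>e = Inr i\<close> Inl q s payoff_coeff_def simp del: prod.inject)
    qed
  qed (simp add: Inr eq_fun_def)
qed

text \<open>If the equations are not transversal at a point, some combination of the gradients involves only
  differentials of payoffs. It is not trivial, as the quadrics are independent and the Spohn equation of each
  player depends on the payoffs of that player. So the bad payoffs satisfy a polynomial relation, by the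
  Jacobian criterion.\<close>

lemma generic_transversality:
  fixes E :: "('n::finite \<times> 'n) set"
  shows "\<exists>A :: ('n \<times> 'n profile \<Rightarrow> real) \<Rightarrow> real. polyfun UNIV A \<and> (\<exists>y. A y \<noteq> 0) \<and>
    (\<forall>X z. A X \<noteq> 0 \<longrightarrow> boundary_form (($) z) \<noteq> 0 \<longrightarrow>
      (\<forall>e\<in>eq_index E. eq_fun E (\<lambda>k. complex_of_real (X k)) e (($) z) = 0) \<longrightarrow>
      indep_fam (eq_index E) (\<lambda>e. grad_at (eq_grad E (\<lambda>k. complex_of_real (X k)) e) z))"
proof -
  define B where "B = {b :: ('n \<times> 'n profile) + 'n profile \<Rightarrow> complex.
    boundary_form (\<lambda>j. b (Inr j)) \<noteq> 0 \<and>
    (\<forall>e\<in>eq_index E. eq_fun E (\<lambda>k. b (Inl k)) e (\<lambda>j. b (Inr j)) = 0) \<and>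
    \<not> indep_fam (eq_index E) (\<lambda>e. grad_at (eq_grad E (\<lambda>k. b (Inl k)) e) (\<chi> j. b (Inr j)))}"
  have "\<exists>F. polyfun (UNIV :: ('n \<times> 'n profile) set) F \<and> (\<exists>y. F y \<noteq> 0) \<and> (\<forall>b\<in>B. F (\<lambda>k. b (Inl k)) = 0)"
  proof (rule algebraic_dependence[where R = "eq_index E" and dG = "joint_grad E"])
    fix b assume b: "b \<in> B"
    define x where "x = (\<lambda>j. b (Inr j))"
    have x: "x j \<noteq> 0" "(\<Sum>j\<in>UNIV. x j) \<noteq> 0" for j
      using b by (auto simp: B_def boundary_form_def x_def)
    have "\<not> indep_fam (eq_index E) (\<lambda>e. grad_at (eq_grad E (\<lambda>k. b (Inl k)) e) (\<chi> j. x j))"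
      using b by (simp add: B_def x_def)
    then obtain c e0 where c: "\<And>v. (\<Sum>e\<in>eq_index E. c e * eq_grad E (\<lambda>k. b (Inl k)) e v x) = 0"
      and e0: "e0 \<in> eq_index E" "c e0 \<noteq> 0"
      unfolding indep_fam_def by (auto simp: vec_lambda_inverse)
    define l where "l k = (\<Sum>e\<in>eq_index E. c e * joint_grad E e (Inl k) b)" for k
    have l: "l (i, j) = c (Inr i) * payoff_coeff i j x" for i j
    proof -
      have "l (i, j) = (\<Sum>k\<in>noncliques E. c (Inl k) * 0) + (\<Sum>i'\<in>UNIV. c (Inr i') * (if i = i' then payoff_coeff i j x else 0))"
        unfolding l_def eq_index_def x_def by (subst sum.Plus) (simp_all add: joint_grad_def)
      then show ?thesis by (simp add: if_distrib cong: if_cong)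
    qed
    have "\<exists>k. l k \<noteq> 0"
    proof (rule ccontr)
      assume "\<not> ?thesis"
      then have 0: "c (Inr i) = 0" for i
        using l payoff_coeff_nonzero[OF x, of i] by (metis no_zero_divisors)
      have "(\<Sum>j\<in>noncliques E. c (Inl j) * ci_quadric_grad E j v x) = 0" for v
        using c[of v] unfolding eq_index_def by (subst (asm) sum.Plus) (simp_all add: 0 eq_grad_def)
      from ci_quadrics_independent[OF x(1) this] e0 show False
        unfolding eq_index_def using 0 by auto
    qed
    moreover have "(\<Sum>k\<in>UNIV. l k * kron w (Inl k)) = (\<Sum>e\<in>eq_index E. c e * joint_grad E e w b)" for w
    proof (cases w)
      case (Inl k)
      then show ?thesis by (simp add: l_def if_distrib[of "\<lambda>a. _ * a"] cong: if_cong)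
    next
      case (Inr v)
      then show ?thesis using c[of v] unfolding x_def by (simp add: joint_grad_def)
    qed
    ultimately show "\<exists>l m. (\<exists>k\<in>UNIV. l k \<noteq> 0) \<and>
      (\<forall>w. (\<Sum>k\<in>UNIV. l k * kron w (Inl k)) = (\<Sum>e\<in>eq_index E. m e * joint_grad E e w b))"
      by blast
  next
    show "has_grad (\<lambda>b. b (Inl k)) (\<lambda>w b. kron w (Inl k))" for k by (rule has_grad_var)
    show "has_grad (\<lambda>b. eq_fun E (\<lambda>k. b (Inl k)) e (\<lambda>j. b (Inr j))) (joint_grad E e)" for e
      by (rule has_grad_joint)
    show "eq_fun E (\<lambda>k. b (Inl k)) e (\<lambda>j. b (Inr j)) = 0" if "e \<in> eq_index E" "b \<in> B" for e b
      using that by (simp add: B_def)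
  qed simp
  then obtain F y where F: "polyfun (UNIV :: ('n \<times> 'n profile) set) F" "F y \<noteq> 0"
    "\<And>b. b \<in> B \<Longrightarrow> F (\<lambda>k. b (Inl k)) = 0" by blast
  obtain P Q :: "('n \<times> 'n profile \<Rightarrow> real) \<Rightarrow> real" where PQ: "polyfun UNIV P" "polyfun UNIV Q"
    "\<And>X. F (\<lambda>k. complex_of_real (X k)) = Complex (P X) (Q X)"
    using polyfun_re_im[OF F(1)] by blast
  obtain X where "F (\<lambda>k. complex_of_real (X k)) \<noteq> 0" using polyfun_zero_of_real[OF F(1)] F(2) by blast
  then have "P X \<noteq> 0 \<or> Q X \<noteq> 0" by (auto simp: PQ(3) complex_eq_iff)
  then obtain A where A: "polyfun UNIV A" "A X \<noteq> 0" "A = P \<or> A = Q" using PQ by blast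
  show ?thesis
  proof (intro exI[of _ A] conjI allI impI)
    fix X z
    assume X: "A X \<noteq> 0" "boundary_form (($) z) \<noteq> 0"
      "\<forall>e\<in>eq_index E. eq_fun E (\<lambda>k. complex_of_real (X k)) e (($) z) = 0"
    define b where "b = case_sum (\<lambda>k. complex_of_real (X k)) (($) z)"
    have "F (\<lambda>k. b (Inl k)) \<noteq> 0" using A(3) X(1) by (auto simp: b_def PQ(3) complex_eq_iff)
    then have "b \<notin> B" using F(3) by blast
    then show "indep_fam (eq_index E) (\<lambda>e. grad_at (eq_grad E (\<lambda>k. complex_of_real (X k)) e) z)"
      using X by (simp add: B_def b_def)
  qed (use A in auto)
qed

section \<open>Smooth submanifolds of real space\<close>

lemma has_derivative_vec_lambda:
  fixes f :: "'v::finite \<Rightarrow> 'e::real_normed_vector \<Rightarrow> real"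
  assumes "\<And>v. (f v has_derivative f' v) (at y)"
  shows "((\<lambda>y. \<chi> v. f v y) has_derivative (\<lambda>u. \<chi> v. f' v u)) (at y)"
proof -
  have *: "(\<chi> v. g v) = (\<Sum>v\<in>UNIV. g v *s axis v 1)" for g :: "'v \<Rightarrow> real"
    using basis_expansion[of "\<chi> v. g v"] by simp
  show ?thesis
    unfolding * by (intro has_derivative_sum bounded_linear.has_derivative[OF bounded_linear_vsmult] assms)
qed

text \<open>The directional derivatives of a polynomial in the family \<open>\<Psi>\<close> are again polynomials in \<open>\<Psi>\<close>, so the order of
  differentiability can be raised step by step.\<close>

lemma cont_diff_polyfun_comp:
  fixes \<Psi> :: "'w::finite \<Rightarrow> 'e::euclidean_space \<Rightarrow> real" and P :: "'v::finite \<Rightarrow> ('w \<Rightarrow> real) \<Rightarrow> real"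
  assumes der: "\<And>w y. y \<in> W \<Longrightarrow> (\<Psi> w has_derivative D w y) (at y)"
    and closed: "\<And>w u. \<exists>Q. polyfun UNIV Q \<and> (\<forall>y\<in>W. D w y u = Q (\<lambda>w. \<Psi> w y))"
    and P: "\<And>v. polyfun UNIV (P v)"
  shows "cont_diff k (\<lambda>y. \<chi> v. P v (\<lambda>w. \<Psi> w y)) W"
  using P
proof (induction k arbitrary: P)
  case 0
  have "isCont (\<lambda>y. \<chi> v. P v (\<lambda>w. \<Psi> w y)) y" if "y \<in> W" for y
  proof -
    have "\<exists>P'. \<forall>v. has_grad (P v) (P' v)" using polyfun_imp_has_grad[OF 0] by metis
    then obtain P' where "\<And>v. has_grad (P v) (P' v)" by blast
    from has_derivative_continuous[OF has_derivative_vec_lambda[OF has_derivative_polyfun_comp[OF this der[OF that]]]]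
    show ?thesis .
  qed
  then show ?case by (simp add: continuous_at_imp_continuous_on)
next
  case (Suc k)
  have "\<exists>P'. \<forall>v. has_grad (P v) (P' v)" using polyfun_imp_has_grad[OF Suc.prems] by metis
  then obtain P' where P': "\<And>v. has_grad (P v) (P' v)" by blast
  obtain Q where Q: "\<And>w u. polyfun UNIV (Q w u)" "\<And>w u y. y \<in> W \<Longrightarrow> D w y u = Q w u (\<lambda>w. \<Psi> w y)"
    using closed by metis
  define f' where "f' y u = (\<chi> v. \<Sum>w\<in>UNIV. P' v w (\<lambda>w. \<Psi> w y) * Q w u (\<lambda>w. \<Psi> w y))" for y u
  have "((\<lambda>y. \<chi> v. P v (\<lambda>w. \<Psi> w y)) has_derivative f' y) (at y)" if "y \<in> W" for y
    using has_derivative_vec_lambda[OF has_derivative_polyfun_comp[OF P' der[OF that]]]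
    by (simp add: f'_def[abs_def] Q(2)[OF that])
  moreover have "cont_diff k (\<lambda>y. f' y u) W" for u
    unfolding f'_def
    by (rule Suc.IH[of "\<lambda>v x. \<Sum>w\<in>UNIV. P' v w x * Q w u x"])
      (intro polyfun_sum polyfun_mult has_grad_imp_polyfun_grad[OF P'] Q(1))
  ultimately show ?case by (auto intro!: exI[of _ f'])
qed

context regular_point
begin

lemma polyfun_flat: "polyfun UNIV (\<lambda>x. flat (\<chi> v. x v) $ v)"
  unfolding flat_def pairing_def
  by (simp add: vec_lambda_inverse)
    (intro polyfun_add polyfun_sum polyfun_mult polyfun_diff polyfun_const polyfun_var
      has_grad_imp_polyfun[OF grad]; simp)

end

text \<open>The inverse of the straightening map is smooth: by Cramer's rule, its derivatives are polynomials in
  the map itself and in the inverse of the Jacobian determinant.\<close>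

lemma regular_point_diffeomorphism:
  fixes p :: "real ^ 'v::finite"
  assumes reg: "regular_point R G dG p" and Om: "open Om" "p \<in> Om"
  shows "\<exists>U W \<psi>. p \<in> U \<and> U \<subseteq> Om \<and> diffeomorphism U W (regular_point.flat R G dG p) \<psi>"
proof -
  interpret regular_point R G dG p by fact
  obtain U W \<psi> \<psi>' where
    U: "open U" "U \<subseteq> Om" "p \<in> U" and W: "open W" "0 \<in> W" and hom: "homeomorphism U W flat \<psi>" and
    der: "\<And>y. y \<in> W \<Longrightarrow> (\<psi> has_derivative \<psi>' y) (at y)" and
    inv: "\<And>y u. y \<in> W \<Longrightarrow> flat' (\<psi> y) (\<psi>' y u) = u" "\<And>y u. y \<in> W \<Longrightarrow> \<psi>' y (flat' (\<psi> y) u) = u"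
    by (rule straightening[OF Om]) auto
  have "cont_diff k flat U" for k
  proof -
    have "cont_diff k (\<lambda>z. \<chi> v. (\<lambda>x. flat (\<chi> v. x v) $ v) (\<lambda>w. z $ w)) U"
    proof (rule cont_diff_polyfun_comp[where \<Psi> = "\<lambda>w z. z $ w" and D = "\<lambda>w y u. u $ w"])
      show "((\<lambda>z. z $ w) has_derivative (\<lambda>u. u $ w)) (at y)" for w and y :: "real ^ 'v"
        by (intro bounded_linear_imp_has_derivative bounded_linear_vec_nth)
      show "\<exists>Q. polyfun UNIV Q \<and> (\<forall>y\<in>U. u $ w = Q (($) y))" for w and u :: "real ^ 'v"
        by (rule exI[of _ "\<lambda>_. u $ w"]) (simp add: polyfun_const)
    qed (rule polyfun_flat)
    then show ?thesis by simp
  qed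
  moreover have "cont_diff k \<psi> W" for k
  proof -
    define J where "J x = det (jacobian x)" for x
    have J: "polyfun UNIV J" unfolding J_def[abs_def] by (rule polyfun_det[OF polyfun_jacobian])
    obtain J' where J': "has_grad J J'" using polyfun_imp_has_grad[OF J] by blast
    have J0: "J (($) (\<psi> y)) \<noteq> 0" if "y \<in> W" for y
    proof -
      have "u = 0" if "jacobian (($) (\<psi> y)) *v u = 0" for u
        using inv(2)[OF \<open>y \<in> W\<close>, of u] inv(2)[OF \<open>y \<in> W\<close>, of 0] that by (simp add: flat'_jacobian)
      then show ?thesis
        unfolding J_def invertible_det_nz[symmetric] invertible_left_inverse
        using matrix_left_invertible_ker by blast
    qed
    define N where "N v u x = det (\<chi> i j. if j = v then u $ i else jacobian x $ i $ j)" for v u x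
    have N: "polyfun UNIV (N v u)" for v u
      unfolding N_def[abs_def]
    proof (rule polyfun_det)
      show "polyfun UNIV (\<lambda>x. (\<chi> i j. if j = v then u $ i else jacobian x $ i $ j) $ i $ j)" for i j
        by (cases "j = v") (simp_all add: polyfun_const polyfun_jacobian)
    qed
    have cramer: "\<psi>' y u $ v = N v u (($) (\<psi> y)) * inverse (J (($) (\<psi> y)))" if "y \<in> W" for y u v
    proof -
      have "jacobian (($) (\<psi> y)) *v \<psi>' y u = u" using inv(1)[OF that] by (simp add: flat'_jacobian)
      then show ?thesis
        using cramer[OF J0[OF that, unfolded J_def], of "\<psi>' y u" u] by (simp add: N_def J_def divide_inverse)
    qed
    define \<Psi> where "\<Psi> w y = (case w of None \<Rightarrow> inverse (J (($) (\<psi> y))) | Some v \<Rightarrow> \<psi> y $ v)" for w y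
    define D where "D w y u = (case w of
        None \<Rightarrow> - (inverse (J (($) (\<psi> y))) * (\<Sum>v\<in>UNIV. J' v (($) (\<psi> y)) * \<psi>' y u $ v) * inverse (J (($) (\<psi> y))))
      | Some v \<Rightarrow> \<psi>' y u $ v)" for w y u
    have comp: "((\<lambda>y. \<psi> y $ v) has_derivative (\<lambda>u. \<psi>' y u $ v)) (at y)" if "y \<in> W" for y v
      by (rule bounded_linear.has_derivative[OF bounded_linear_vec_nth der[OF that]])
    have "cont_diff k (\<lambda>y. \<chi> v. (\<lambda>x. x (Some v)) (\<lambda>w. \<Psi> w y)) W"
    proof (rule cont_diff_polyfun_comp[where D = D])
      fix w y assume y: "y \<in> W"
      show "(\<Psi> w has_derivative D w y) (at y)"
      proof (cases w)
        case None
        have "((\<lambda>y. J (\<lambda>v. \<psi> y $ v)) has_derivative (\<lambda>u. \<Sum>v\<in>UNIV. J' v (\<lambda>v. \<psi> y $ v) * \<psi>' y u $ v)) (at y)"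
          by (rule has_derivative_polyfun_comp[OF J' comp[OF y]])
        from Deriv.has_derivative_inverse[OF J0[OF y] this] show ?thesis
          by (simp add: None \<Psi>_def[abs_def] D_def[abs_def])
      next
        case (Some v)
        then show ?thesis using comp[OF y] by (simp add: \<Psi>_def[abs_def] D_def[abs_def])
      qed
    next
      fix w and u :: "real ^ 'v"
      have S: "polyfun UNIV (\<lambda>x. F (\<lambda>v. x (Some v)))" if "polyfun UNIV F" for F :: "('v \<Rightarrow> real) \<Rightarrow> real"
        using that by (rule polyfun_comp) (simp add: polyfun_var)
      show "\<exists>Q. polyfun UNIV Q \<and> (\<forall>y\<in>W. D w y u = Q (\<lambda>w. \<Psi> w y))"
      proof (cases w)
        case None
        let ?Q = "\<lambda>x :: 'v option \<Rightarrow> real. - (x None * (\<Sum>v\<in>UNIV. J' v (\<lambda>v. x (Some v)) * (N v u (\<lambda>v. x (Some v)) * x None)) * x None)"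
        have "polyfun UNIV ?Q"
          by (intro polyfun_uminus polyfun_mult polyfun_sum polyfun_var S has_grad_imp_polyfun_grad[OF J'] N UNIV_I)
        moreover have "D w y u = ?Q (\<lambda>w. \<Psi> w y)" if "y \<in> W" for y
          by (simp add: None D_def \<Psi>_def cramer[OF that])
        ultimately show ?thesis by blast
      next
        case (Some v)
        let ?Q = "\<lambda>x :: 'v option \<Rightarrow> real. N v u (\<lambda>v. x (Some v)) * x None"
        have "polyfun UNIV ?Q" by (intro polyfun_mult polyfun_var S N UNIV_I)
        moreover have "D w y u = ?Q (\<lambda>w. \<Psi> w y)" if "y \<in> W" for y
          by (simp add: Some D_def \<Psi>_def cramer[OF that])
        ultimately show ?thesis by blast
      qed
    qed (simp add: polyfun_var)
    then show ?thesis by (simp add: \<Psi>_def)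
  qed
  ultimately show ?thesis
    unfolding diffeomorphism_def using U W hom by blast
qed

text \<open>The straightening map at each point is a chart.\<close>

lemma smooth_submanifold_transversal:
  fixes G :: "'r \<Rightarrow> ('v::finite \<Rightarrow> real) \<Rightarrow> real"
  assumes "finite R" and grad: "\<And>e. e \<in> R \<Longrightarrow> has_grad (G e) (dG e)" and "open Om"
    and indep: "\<And>q. q \<in> Om \<Longrightarrow> \<forall>e\<in>R. G e (($) q) = 0 \<Longrightarrow> indep_fam R (\<lambda>e. grad_at (dG e) q)"
  shows "smooth_submanifold (CARD('v) - card R) {q\<in>Om. \<forall>e\<in>R. G e (($) q) = 0}" (is "smooth_submanifold _ ?M")
  unfolding smooth_submanifold_def
proof
  fix q assume q: "q \<in> ?M"
  have reg: "regular_point R G dG q"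
    by unfold_locales (use assms q in auto)
  interpret regular_point R G dG q by (rule reg)
  obtain U W \<psi> where U: "q \<in> U" "U \<subseteq> Om" and diff: "diffeomorphism U W flat \<psi>"
    using regular_point_diffeomorphism[OF reg \<open>open Om\<close>] q by blast
  have "subspace tangent"
    unfolding subspace_vec_eq[symmetric] tangent_def by (rule subspace_kernel)
  moreover have "dim tangent = CARD('v) - card R"
    unfolding dim_vec_eq[symmetric] using dim_kernel[OF fin regular_point.indep[OF reg]]
    by (simp add: tangent_def)
  moreover have "flat ` (?M \<inter> U) = tangent \<inter> W"
  proof -
    have "flat ` U = W" using diff unfolding diffeomorphism_def homeomorphism_def by blast
    then show ?thesis using U(2) flat_in_tangent by blast
  qed
  ultimately have "q \<in> U \<and> diffeomorphism U W flat \<psi> \<and> subspace tangent \<and>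
      dim tangent = CARD('v) - card R \<and> flat ` (?M \<inter> U) = tangent \<inter> W"
    using U(1) diff by simp
  then show "\<exists>U W \<phi> \<psi> (L :: (real ^ 'v) set). q \<in> U \<and> diffeomorphism U W \<phi> \<psi> \<and> subspace L \<and>
      dim L = CARD('v) - card R \<and> \<phi> ` (?M \<inter> U) = L \<inter> W"
    by (intro exI)
qed

section \<open>The equilibria of a generic game\<close>

lemma eq_fun_of_real:
  "eq_fun E (\<lambda>k. complex_of_real (X k)) e (\<lambda>j. of_real (x j)) = of_real (eq_fun E X e x)"
  by (cases e) (auto simp: eq_fun_def ci_quadric_def spohn_poly_def split: prod.split)

lemma eq_grad_of_real:
  "eq_grad E (\<lambda>k. complex_of_real (X k)) e v (\<lambda>j. of_real (x j)) = of_real (eq_grad E X e v x)"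
proof -
  have kron: "complex_of_real (kron v w) = kron v w" for v w :: 'b by simp
  show ?thesis
    by (cases e; cases "gap E (projl e)")
      (simp_all only: eq_grad_def sum.case sum.sel ci_quadric_grad_def spohn_poly_grad_def prod.case
        of_real_add of_real_diff of_real_mult of_real_sum kron)
qed

text \<open>On the affine hyperplane where the probabilities sum to \<open>1\<close>, the equations stay transversal, as by Euler's
  formula their gradients vanish in the radial direction.\<close>

lemma indep_fam_with_sum:
  fixes q :: "real ^ ('n::finite) profile"
  assumes indep: "indep_fam (eq_index E) (\<lambda>e. grad_at (eq_grad E X e) q)"
    and zero: "\<And>e. e \<in> eq_index E \<Longrightarrow> eq_fun E X e (($) q) = 0"
    and sum: "(\<Sum>j\<in>UNIV. q $ j) = 1"
  shows "indep_fam (insert None (Some ` eq_index E))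
    (\<lambda>e. grad_at (case e of None \<Rightarrow> (\<lambda>v x. 1) | Some e \<Rightarrow> eq_grad E X e) q)"
  unfolding indep_fam_def
proof (intro allI impI)
  fix c
  assume "\<forall>v. (\<Sum>e\<in>insert None (Some ` eq_index E).
    c e * grad_at (case e of None \<Rightarrow> (\<lambda>v x. 1) | Some e \<Rightarrow> eq_grad E X e) q $ v) = 0"
  then have c: "c None + (\<Sum>e\<in>eq_index E. c (Some e) * eq_grad E X e v (($) q)) = 0" for v
    by (subst (asm) sum.insert) (auto simp: sum.reindex)
  have "(\<Sum>v\<in>UNIV. eq_grad E X e v (($) q) * q $ v) = 0" if "e \<in> eq_index E" for e
    using is_form_euler[OF is_form_eq_fun has_grad_eq_fun, of E X e q] zero[OF that] by simp
  then have "(\<Sum>v\<in>UNIV. (\<Sum>e\<in>eq_index E. c (Some e) * eq_grad E X e v (($) q)) * q $ v) = 0"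
    unfolding sum_distrib_right
    by (subst sum.swap) (simp add: mult.assoc sum_distrib_left[symmetric])
  moreover have "(\<Sum>v\<in>UNIV. (c None + (\<Sum>e\<in>eq_index E. c (Some e) * eq_grad E X e v (($) q))) * q $ v) = 0"
    using c by simp
  ultimately have "(\<Sum>v\<in>UNIV. c None * q $ v) = 0" by (simp add: distrib_right sum.distrib)
  then have c0: "c None = 0" using sum by (simp add: sum_distrib_left[symmetric])
  have "\<forall>v. (\<Sum>e\<in>eq_index E. c (Some e) * grad_at (eq_grad E X e) q $ v) = 0"
    using c by (simp add: c0)
  then have "\<forall>e\<in>eq_index E. c (Some e) = 0"
    using indep[unfolded indep_fam_def, rule_format, of "\<lambda>e. c (Some e)"] by blast
  then show "\<forall>e\<in>insert None (Some ` eq_index E). c e = 0" using c0 by auto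
qed

lemma semialgebraic_equations:
  fixes G :: "'r \<Rightarrow> ('v::finite \<Rightarrow> real) \<Rightarrow> real"
  assumes "finite R" "\<And>e. e \<in> R \<Longrightarrow> polyfun UNIV (G e)"
  shows "semialgebraic {q. (\<forall>j. q $ j > 0) \<and> (\<forall>e\<in>R. G e (($) q) = 0)}"
proof -
  obtain g where g: "\<And>e. e \<in> R \<Longrightarrow> mpoly_eval (g e) = G e"
    using polyfun_imp_mpoly[OF assms(2)] by metis
  obtain x :: "'v \<Rightarrow> ('v, real) mpoly" where x: "\<And>j. mpoly_eval (x j) = (\<lambda>y. y j)"
    using polyfun_imp_mpoly[OF polyfun_var[of _ UNIV]] by (metis UNIV_I)
  show ?thesis
    unfolding semialgebraic_def
  proof (intro exI conjI)
    show "finite {(g ` R, range x)}" by simp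
    show "\<forall>(P, Q)\<in>{(g ` R, range x)}. finite P \<and> finite Q" using assms(1) by simp
    show "{q. (\<forall>j. q $ j > 0) \<and> (\<forall>e\<in>R. G e (($) q) = 0)} = (\<Union>(P, Q)\<in>{(g ` R, range x)}.
      {q. (\<forall>f\<in>P. mpoly_eval f (($) q) = 0) \<and> (\<forall>f\<in>Q. mpoly_eval f (($) q) > 0)})"
      using g x by auto
  qed
qed

lemma boundary_form_simplex:
  fixes q :: "real ^ ('n::finite) profile"
  assumes "\<And>j. q $ j > 0" "(\<Sum>j\<in>UNIV. q $ j) = 1"
  shows "boundary_form (\<lambda>j. complex_of_real (q $ j)) \<noteq> 0"
proof -
  have "(\<Sum>j\<in>UNIV. complex_of_real (q $ j)) = of_real (\<Sum>j\<in>UNIV. q $ j)" by simp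
  then show ?thesis
    using assms by (simp add: boundary_form_def less_imp_neq[THEN not_sym])
qed

text \<open>A point of the open simplex avoids the excluded hyperplanes, and there the closure adds nothing to the
  solution set of the equations.\<close>

lemma totally_mixed_ci_equilibria_eq:
  fixes X :: "('n::finite) game"
  shows "totally_mixed_ci_equilibria X (global_markov E) = {q. (\<forall>j. q $ j > 0) \<and> (\<Sum>j\<in>UNIV. q $ j) = 1 \<and>
    (\<forall>e\<in>eq_index E. eq_fun E (\<lambda>(i, j). X $ i $ j) e (($) q) = 0)}"
proof -
  let ?x = "\<lambda>(i, j). X $ i $ j"
  have x: "(\<lambda>(i, j). complex_of_real (X $ i $ j)) = (\<lambda>k. complex_of_real (?x k))"
    by (auto simp: fun_eq_iff)
  define S where "S = {z :: complex ^ 'n profile. z \<noteq> 0 \<and>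
    (\<forall>e\<in>eq_index E. eq_fun E (\<lambda>k. complex_of_real (?x k)) e (($) z) = 0) \<and> boundary_form (($) z) \<noteq> 0}"
  have "0 \<notin> S" by (simp add: S_def)
  have "(\<chi> j. complex_of_real (q $ j)) \<in> zariski_closure S \<longleftrightarrow> (\<forall>e\<in>eq_index E. eq_fun E ?x e (($) q) = 0)"
    if q: "q \<in> open_simplex" for q
  proof -
    define z where "z = (\<chi> j. complex_of_real (q $ j))"
    have eq: "eq_fun E (\<lambda>k. complex_of_real (?x k)) e (($) z) = of_real (eq_fun E ?x e (($) q))" for e
      unfolding eq_fun_of_real[symmetric] by (simp add: z_def vec_lambda_inverse)
    have b: "boundary_form (($) z) \<noteq> 0"
      using boundary_form_simplex[of q] q by (simp add: z_def vec_lambda_inverse open_simplex_def)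
    then have "z \<noteq> 0" by (auto simp: boundary_form_def)
    have "z \<in> zariski_closure S \<longleftrightarrow> (\<forall>e\<in>eq_index E. eq_fun E (\<lambda>k. complex_of_real (?x k)) e (($) z) = 0)"
    proof
      assume z: "z \<in> zariski_closure S"
      show "\<forall>e\<in>eq_index E. eq_fun E (\<lambda>k. complex_of_real (?x k)) e (($) z) = 0"
      proof
        fix e assume "e \<in> eq_index E"
        then have "\<forall>y\<in>S. eq_fun E (\<lambda>k. complex_of_real (?x k)) e (($) y) = 0" by (simp add: S_def)
        then show "eq_fun E (\<lambda>k. complex_of_real (?x k)) e (($) z) = 0"
          using z is_form_eq_fun unfolding zariski_closure_eq[OF \<open>0 \<notin> S\<close>] by blast
      qed
    next
      assume "\<forall>e\<in>eq_index E. eq_fun E (\<lambda>k. complex_of_real (?x k)) e (($) z) = 0"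
      then have "z \<in> S" using b \<open>z \<noteq> 0\<close> by (simp add: S_def)
      then show "z \<in> zariski_closure S" using zariski_closure_supset by blast
    qed
    then show ?thesis by (simp add: eq z_def[symmetric])
  qed
  then show ?thesis
    unfolding totally_mixed_ci_equilibria_def spohn_ci_variety_eq x S_def[symmetric]
    by (auto simp: open_simplex_def)
qed

lemma indep_fam_eq_grad_real:
  fixes q :: "real ^ ('n::finite) profile"
  assumes "indep_fam (eq_index E) (\<lambda>e. grad_at (eq_grad E (\<lambda>k. complex_of_real (x k)) e) (\<chi> j. complex_of_real (q $ j)))"
  shows "indep_fam (eq_index E) (\<lambda>e. grad_at (eq_grad E x e) q)"
  unfolding indep_fam_def
proof (intro allI impI)
  fix c assume "\<forall>v. (\<Sum>e\<in>eq_index E. c e * grad_at (eq_grad E x e) q $ v) = 0"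
  then have "complex_of_real (\<Sum>e\<in>eq_index E. c e * eq_grad E x e v (($) q)) = 0" for v by simp
  then have "\<forall>v. (\<Sum>e\<in>eq_index E. complex_of_real (c e) *
      grad_at (eq_grad E (\<lambda>k. complex_of_real (x k)) e) (\<chi> j. complex_of_real (q $ j)) $ v) = 0"
    by (simp add: vec_lambda_inverse eq_grad_of_real)
  then show "\<forall>e\<in>eq_index E. c e = 0"
    using assms[unfolded indep_fam_def, rule_format, of "\<lambda>e. of_real (c e)"] by simp
qed

theorem theorem12:
  fixes E :: "('n::finite \<times> 'n) set"
  assumes "sym E"
  shows "generic_game (\<lambda>X :: 'n game.
    (\<forall>p \<in> spohn_ci_variety X (global_markov E) - hyperplanes.
      smooth_at (spohn_ci_variety X (global_markov E)) p) \<and>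
    smooth_semialgebraic_manifold (totally_mixed_ci_equilibria X (global_markov E)))"
proof -
  obtain A :: "('n \<times> 'n profile \<Rightarrow> real) \<Rightarrow> real" and y where A: "polyfun UNIV A" "A y \<noteq> 0"
    and trans: "\<And>X z. A X \<noteq> 0 \<Longrightarrow> boundary_form (($) z) \<noteq> 0 \<Longrightarrow>
      \<forall>e\<in>eq_index E. eq_fun E (\<lambda>k. complex_of_real (X k)) e (($) z) = 0 \<Longrightarrow>
      indep_fam (eq_index E) (\<lambda>e. grad_at (eq_grad E (\<lambda>k. complex_of_real (X k)) e) z)"
    using generic_transversality[of E] by blast
  obtain f where f: "mpoly_eval f = A" using polyfun_imp_mpoly[OF A(1)] by blast
  \<comment> \<open>The exceptional set: the zeros of the relation that is satisfied by all bad payoffs.\<close>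
  define Z where "Z = {X :: 'n game. mpoly_eval f (\<lambda>(i, j). X $ i $ j) = 0}"
  have "game_zariski_closed Z" unfolding game_zariski_closed_def Z_def by (rule exI[of _ "{f}"]) simp
  moreover have "(\<chi> i j. y (i, j)) \<notin> Z" using A(2) by (simp add: Z_def f split_def)
  moreover have "(\<forall>p \<in> spohn_ci_variety X (global_markov E) - hyperplanes.
      smooth_at (spohn_ci_variety X (global_markov E)) p) \<and>
    smooth_semialgebraic_manifold (totally_mixed_ci_equilibria X (global_markov E))" if "X \<notin> Z" for X :: "'n game"
  proof
    define x where "x = (\<lambda>(i, j). X $ i $ j)"
    have x: "(\<lambda>(i, j). complex_of_real (X $ i $ j)) = (\<lambda>k. complex_of_real (x k))"
      by (auto simp: x_def fun_eq_iff)
    have "A x \<noteq> 0" using that by (simp add: Z_def f x_def)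
    note trans = trans[OF this]
    define S where "S = {z :: complex ^ 'n profile. z \<noteq> 0 \<and>
      (\<forall>e\<in>eq_index E. eq_fun E (\<lambda>k. complex_of_real (x k)) e (($) z) = 0) \<and> boundary_form (($) z) \<noteq> 0}"
    have V: "spohn_ci_variety X (global_markov E) = zariski_closure S"
      unfolding spohn_ci_variety_eq x S_def by simp
    have "0 \<notin> S" by (simp add: S_def)
    show "\<forall>p \<in> spohn_ci_variety X (global_markov E) - hyperplanes.
      smooth_at (spohn_ci_variety X (global_markov E)) p"
    proof
      fix p assume p: "p \<in> spohn_ci_variety X (global_markov E) - hyperplanes"
      then have "p \<noteq> 0" unfolding V using zariski_closure_closed[OF \<open>0 \<notin> S\<close>] proj_closed_nonzero by blast
      then have "boundary_form (($) p) \<noteq> 0" using p by (auto simp: boundary_form_def hyperplanes_def)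
      then show "smooth_at (spohn_ci_variety X (global_markov E)) p"
        using p unfolding V S_def
        by (intro smooth_at_transversal[OF finite_eq_index has_grad_eq_fun is_form_eq_fun is_form_boundary_form]
            trans) auto
    qed
    \<comment> \<open>The equations in affine space, with \<open>None\<close> for the normalization.\<close>
    define G where "G e = (case e of None \<Rightarrow> (\<lambda>y. (\<Sum>j\<in>UNIV. y j) - 1) | Some e \<Rightarrow> eq_fun E x e)" for e
    define dG where "dG e = (case e of None \<Rightarrow> (\<lambda>v y. 1) | Some e \<Rightarrow> eq_grad E x e)" for e
    define R where "R = insert None (Some ` eq_index E)"
    define Om where "Om = {q :: real ^ 'n profile. \<forall>j. q $ j > 0}"
    have finR: "finite R" unfolding R_def using finite_eq_index by auto
    have gradG: "has_grad (G e) (dG e)" for e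
    proof (cases e)
      case None
      have "has_grad (\<lambda>y. (\<Sum>j\<in>UNIV. y j) - 1) (\<lambda>v y. (\<Sum>j\<in>UNIV. kron v j) - 0)"
        by (intro has_grad_diff has_grad_sum has_grad_var has_grad_const)
      then show ?thesis by (rule has_grad_cong) (simp_all add: None G_def dG_def)
    qed (simp add: G_def dG_def has_grad_eq_fun)
    have equilibria: "totally_mixed_ci_equilibria X (global_markov E) = {q\<in>Om. \<forall>e\<in>R. G e (($) q) = 0}"
      unfolding totally_mixed_ci_equilibria_eq x_def[symmetric] by (auto simp: Om_def R_def G_def)
    have "open Om"
    proof -
      have "Om = (\<Inter>j. {q. q $ j > 0})" by (auto simp: Om_def)
      then show ?thesis by (simp add: open_INT open_halfspace_component_gt_cart)
    qed
    have indep: "indep_fam R (\<lambda>e. grad_at (dG e) q)" if q: "q \<in> Om" "\<forall>e\<in>R. G e (($) q) = 0" for q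
    proof -
      have sum: "(\<Sum>j\<in>UNIV. q $ j) = 1" and zero: "\<And>e. e \<in> eq_index E \<Longrightarrow> eq_fun E x e (($) q) = 0"
        using q(2) by (auto simp: R_def G_def)
      have "boundary_form (($) (\<chi> j. complex_of_real (q $ j))) \<noteq> 0"
        using boundary_form_simplex[of q] q(1) sum by (simp add: Om_def vec_lambda_inverse)
      then have "indep_fam (eq_index E)
          (\<lambda>e. grad_at (eq_grad E (\<lambda>k. complex_of_real (x k)) e) (\<chi> j. complex_of_real (q $ j)))"
        by (rule trans) (simp add: vec_lambda_inverse eq_fun_of_real zero)
      then have "indep_fam (eq_index E) (\<lambda>e. grad_at (eq_grad E x e) q)" by (rule indep_fam_eq_grad_real)
      then show ?thesis unfolding R_def dG_def by (rule indep_fam_with_sum) (use zero sum in auto)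
    qed
    have "semialgebraic {q\<in>Om. \<forall>e\<in>R. G e (($) q) = 0}"
      using semialgebraic_equations[OF finR, of G] has_grad_imp_polyfun[OF gradG] by (simp add: Om_def)
    moreover have "smooth_submanifold (CARD('n profile) - card R) {q\<in>Om. \<forall>e\<in>R. G e (($) q) = 0}"
      by (rule smooth_submanifold_transversal[OF finR gradG \<open>open Om\<close> indep])
    ultimately show "smooth_semialgebraic_manifold (totally_mixed_ci_equilibria X (global_markov E))"
      unfolding smooth_semialgebraic_manifold_def equilibria by blast
  qed
  ultimately show ?thesis unfolding generic_game_def by blast
qed

end
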